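(* Let $\Omega\subset\mathbb{R}^3$ be a bounded convex domain and let $(i,j,k)$ be a permutation of $\{1,2,3\}$. Let $\varphi\in\mathsf H^1(\Omega)$ be scalar-valued, and assume that $\varphi\in\mathsf L^2_0(\Omega_i)$ for every set $\Omega_i=\{x\in\Omega\mid\alpha_i<x_i<\beta_i\}$ with $0\le\alpha_i<\beta_i\le l_i$. Then $$|\varphi|_{\mathsf L^2(\Omega)}\le c_{\mathrm{p},i}\,|\nabla\varphi|_{\mathsf L^2(\Omega)},\qquad c_{\mathrm{p},i}\le c_{\mathrm p},\qquad c_{\mathrm{p},i}\le\frac{d_{jk}}{\pi},$$ where $c_{\mathrm{p},i}$ denotes the smallest constant for which the first inequality holds for all such $\varphi$, $c_{\mathrm p}$ is the Poincaré constant of $\Omega$, and $d_{jk}$ is the diameter of the two-dimensional projection of $\Omega$ into the $(e_j,e_k)$-plane.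
   Context: $\Omega$ is translated so that it is contained in the rectangular cuboid $I=(0,l_1)\times(0,l_2)\times(0,l_3)$, $0<l_1,l_2,l_3<\infty$, with $I$ as small as possible. $\mathsf H^1(\Omega)=\{\varphi\in\mathsf L^2(\Omega)\mid\nabla\varphi\in\mathsf L^2(\Omega)\}$. For a bounded open set $\omega$, $\mathsf L^2_0(\omega)=\{\varphi\in\mathsf L^2(\omega)\mid\int_\omega\varphi\,\mathrm{d}x=0\}$; a function on $\Omega$ is said to belong to $\mathsf L^2_0(\omega)$, $\omega\subset\Omega$, if its restriction to $\omega$ does. The Poincaré constant $c_{\mathrm p}$ is the smallest constant such that $|\varphi|_{\mathsf L^2(\Omega)}\le c_{\mathrm p}|\nabla\varphi|_{\mathsf L^2(\Omega)}$ for all scalar-valued $\varphi\in\mathsf H^1(\Omega)\cap\mathsf L^2_0(\Omega)$. $e_j$ and $e_k$ are the $j$-th and $k$-th Euclidean orthonormal basis vectors, and the projection is the orthogonal projection onto the plane they span. *)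

theory Defs
  imports "HOL-Analysis.Analysis"
begin

text \<open>
  Elements of the function spaces below are total functions of which only the values on
  the given set matter; they are not identified up to null sets.
\<close>

definition L2 :: "'a::euclidean_space set \<Rightarrow> ('a \<Rightarrow> 'b::euclidean_space) set" where
  "L2 \<Omega> = {f. f \<in> borel_measurable (lebesgue_on \<Omega>) \<and>
              integrable (lebesgue_on \<Omega>) (\<lambda>x. (norm (f x))\<^sup>2)}"

definition norm_L2 :: "'a::euclidean_space set \<Rightarrow> ('a \<Rightarrow> 'b::euclidean_space) \<Rightarrow> real" where
  "norm_L2 \<Omega> f = sqrt (\<integral>x. (norm (f x))\<^sup>2 \<partial>lebesgue_on \<Omega>)"

definition L2_0 :: "'a::euclidean_space set \<Rightarrow> ('a \<Rightarrow> real) set" where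
  "L2_0 \<omega> = {f \<in> L2 \<omega>. (\<integral>x. f x \<partial>lebesgue_on \<omega>) = 0}"

primrec C_k :: "nat \<Rightarrow> ('a::euclidean_space \<Rightarrow> real) \<Rightarrow> bool" where
  "C_k 0 f \<longleftrightarrow> continuous_on UNIV f"
| "C_k (Suc n) f \<longleftrightarrow> f differentiable_on UNIV \<and>
     (\<forall>v. C_k n (\<lambda>x. frechet_derivative f (at x) v))"

definition test_functions :: "'a::euclidean_space set \<Rightarrow> ('a \<Rightarrow> real) set" where
  "test_functions \<Omega> = {\<psi>. (\<forall>n. C_k n \<psi>) \<and>
     compact (closure {x. \<psi> x \<noteq> 0}) \<and> closure {x. \<psi> x \<noteq> 0} \<subseteq> \<Omega>}"

definition has_weak_grad ::
    "'a::euclidean_space set \<Rightarrow> ('a \<Rightarrow> real) \<Rightarrow> ('a \<Rightarrow> 'a) \<Rightarrow> bool" where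
  "has_weak_grad \<Omega> \<phi> g \<longleftrightarrow> g \<in> L2 \<Omega> \<and>
     (\<forall>\<psi>\<in>test_functions \<Omega>. \<forall>b\<in>Basis.
        (\<integral>x. \<phi> x * frechet_derivative \<psi> (at x) b \<partial>lebesgue_on \<Omega>) =
        - (\<integral>x. (g x \<bullet> b) * \<psi> x \<partial>lebesgue_on \<Omega>))"

definition H1 :: "'a::euclidean_space set \<Rightarrow> ('a \<Rightarrow> real) set" where
  "H1 \<Omega> = {\<phi> \<in> L2 \<Omega>. \<exists>g. has_weak_grad \<Omega> \<phi> g}"

text \<open>
  On an open set weak gradients agree almost everywhere, so
  \<open>norm_L2 \<Omega> (weak_grad \<Omega> \<phi>)\<close> does not depend on the choice.
\<close>

definition weak_grad :: "'a::euclidean_space set \<Rightarrow> ('a \<Rightarrow> real) \<Rightarrow> 'a \<Rightarrow> 'a" where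
  "weak_grad \<Omega> \<phi> = (SOME g. has_weak_grad \<Omega> \<phi> g)"

definition is_poincare_bound :: "'a::euclidean_space set \<Rightarrow> ('a \<Rightarrow> real) set \<Rightarrow> real \<Rightarrow> bool" where
  "is_poincare_bound \<Omega> F c \<longleftrightarrow> 0 \<le> c \<and>
     (\<forall>\<phi>\<in>F. norm_L2 \<Omega> \<phi> \<le> c * norm_L2 \<Omega> (weak_grad \<Omega> \<phi>))"

definition best_poincare_bound :: "'a::euclidean_space set \<Rightarrow> ('a \<Rightarrow> real) set \<Rightarrow> real" where
  "best_poincare_bound \<Omega> F = (LEAST c. is_poincare_bound \<Omega> F c)"

text \<open>As soon as some bound exists, there is a smallest one, so the definition is meaningful.\<close>

lemma best_poincare_bound_least:
  assumes "is_poincare_bound \<Omega> F c"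
  shows "is_poincare_bound \<Omega> F (best_poincare_bound \<Omega> F)"
    and "best_poincare_bound \<Omega> F \<le> c"
proof -
  let ?S = "Collect (is_poincare_bound \<Omega> F)"
  have ne: "?S \<noteq> {}" and bdd: "bdd_below ?S"
    using assms by (auto simp: is_poincare_bound_def bdd_below_def)
  have "?S = {0..} \<inter> (\<Inter>\<phi>\<in>F. {c. norm_L2 \<Omega> \<phi> \<le> c * norm_L2 \<Omega> (weak_grad \<Omega> \<phi>)})"
    by (auto simp: is_poincare_bound_def)
  also have "closed \<dots>"
    by (intro closed_Int closed_INT ballI closed_atLeast closed_Collect_le continuous_intros)
  finally have Inf: "is_poincare_bound \<Omega> F (Inf ?S)"
    using closed_contains_Inf[OF ne bdd] by simp
  have low: "Inf ?S \<le> y" if "is_poincare_bound \<Omega> F y" for y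
    using that bdd by (intro cInf_lower) auto
  have "best_poincare_bound \<Omega> F = Inf ?S"
    unfolding best_poincare_bound_def using Inf low by (rule Least_equality)
  with Inf low assms show "is_poincare_bound \<Omega> F (best_poincare_bound \<Omega> F)"
    and "best_poincare_bound \<Omega> F \<le> c" by auto
qed

definition poincare_const :: "'a::euclidean_space set \<Rightarrow> real" where
  "poincare_const \<Omega> = best_poincare_bound \<Omega> (H1 \<Omega> \<inter> L2_0 \<Omega>)"

definition slab :: "(real^3) set \<Rightarrow> 3 \<Rightarrow> real \<Rightarrow> real \<Rightarrow> (real^3) set" where
  "slab \<Omega> i \<alpha> \<beta> = {x \<in> \<Omega>. \<alpha> < x $ i \<and> x $ i < \<beta>}"

definition slab_mean_free :: "(real^3) set \<Rightarrow> real^3 \<Rightarrow> 3 \<Rightarrow> (real^3 \<Rightarrow> real) set" where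
  "slab_mean_free \<Omega> l i =
     {\<phi>. \<forall>\<alpha> \<beta>. 0 \<le> \<alpha> \<and> \<alpha> < \<beta> \<and> \<beta> \<le> l $ i \<longrightarrow> \<phi> \<in> L2_0 (slab \<Omega> i \<alpha> \<beta>)}"

definition slab_poincare_const :: "(real^3) set \<Rightarrow> real^3 \<Rightarrow> 3 \<Rightarrow> real" where
  "slab_poincare_const \<Omega> l i = best_poincare_bound \<Omega> (H1 \<Omega> \<inter> slab_mean_free \<Omega> l i)"

definition plane_proj :: "3 \<Rightarrow> 3 \<Rightarrow> real^3 \<Rightarrow> real^3" where
  "plane_proj j k x = (x \<bullet> axis j 1) *\<^sub>R axis j 1 + (x \<bullet> axis k 1) *\<^sub>R axis k 1"

lemma plane_proj_orthogonal:
  assumes "j \<noteq> k"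
  shows "plane_proj j k x \<in> span {axis j 1, axis k 1}"
    and "y \<in> span {axis j 1, axis k 1} \<Longrightarrow> orthogonal (x - plane_proj j k x) y"
proof -
  show "plane_proj j k x \<in> span {axis j 1, axis k 1}"
    unfolding plane_proj_def by (intro span_add span_scale span_base) auto
  show "orthogonal (x - plane_proj j k x) y" if "y \<in> span {axis j 1, axis k 1}"
    using that
  proof (rule orthogonal_to_span)
    fix z assume "z \<in> {axis j 1, axis k (1::real)}"
    then show "orthogonal (x - plane_proj j k x) z"
      using assms
      by (auto simp: orthogonal_def plane_proj_def inner_diff_left inner_add_left inner_axis_axis)
  qed
qed

end

theory Submission
  imports Defs "HOL-Real_Asymp.Real_Asymp"
begin

text \<open>
  Since \<open>\<phi>\<close> has mean zero on every slab, its integral over almost every slice orthogonal to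
  \<open>e\<^sub>i\<close> vanishes. Hence \<open>\<integral>\<phi>u = \<integral>\<phi>(u - m)\<close> for smooth \<open>u\<close>, where \<open>m\<close> is the slice mean of \<open>u\<close>, and the
  sharp planar Payne-Weinberger inequality on the slices bounds \<open>u - m\<close> by
  \<open>d\<^sub>j\<^sub>k/\<pi>\<close> times the gradient of \<open>u\<close>. Letting \<open>u\<close> tend to \<open>\<phi>\<close> gives the estimate for \<open>\<phi>\<close>; no
  approximation of \<open>\<phi>\<close> within the class of slab-mean-free functions is needed.

  The planar inequality follows Payne and Weinberger: a counterexample can be bisected by lines
  into convex pieces on which \<open>u\<close> still has mean zero, and one of the two pieces always
  remains a counterexample. Bisecting through the points of a finite net makes the piece so
  thin that \<open>u\<close> is almost a function of one variable, weighted by the concave length of the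
  cross-sections.

  That \<open>c\<^sub>p\<^sub>,\<^sub>i \<le> c\<^sub>p\<close> is an inclusion of function classes, once \<open>c\<^sub>p\<close> is
  known to be finite, that is, once some Poincare inequality on convex sets is available.
\<close>

section \<open>A weighted inequality on an interval\<close>

text \<open>Mollifying \<open>\<phi>\<close> would destroy the slab condition. Duality avoids this:
  the squared norm of \<open>\<phi>\<close> is nearly the integral of \<open>\<phi> * u\<close>,
  which Cauchy-Schwarz bounds by the norm of \<open>\<phi>\<close> times that of
  \<open>u - m\<close>. So \<open>u\<close> only has to pair correctly with \<open>\<phi>\<close>
  and to have almost no more energy. The diameter of the projection appears because each slice
  projects isometrically into the projection of \<open>\<Omega>\<close>; the third component of the
  gradient is given away. The number \<open>1 / pi\<close> is the Wirtinger constant of the unit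
  interval. To keep it sharp, neither the concave weight nor the passage to the plane may cost a
  factor. The contradiction argument therefore starts from a strict excess, spread as a constant
  density \<open>e\<close> over the set, and all errors of replacing \<open>u\<close> by a function
  on a chord are additive and absorbed by \<open>e\<close>. The slope of the chord is harmless: the
  factor by which the derivative with respect to the abscissa exceeds the gradient turns the width
  of the needle into the length of the chord. On the chord the mean is only nearly zero, so the
  interval inequality is needed as a variance estimate.\<close>

text \<open>
  Let \<open>F\<close> be the primitive of \<open>p * f\<close>. Dividing \<open>F\<close> by the square root of \<open>p\<close> turns
  \<open>F'\<^sup>2 / p\<close> into an unweighted Dirichlet energy plus a term that is nonnegative for concave
  \<open>p\<close>, so Wirtinger's inequality applies. Its Riccati calibration \<open>c' = - k\<^sup>2 - c\<^sup>2\<close>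
  becomes the function \<open>Z\<close> below, which vanishes at both ends.
\<close>

lemma weighted_poincare_smooth:
  fixes p p' p'' f f' :: "real \<Rightarrow> real"
  assumes ab: "a < b" and k: "0 < k" "k * (b - a) < pi"
    and p_pos: "\<And>x. x \<in> {a..b} \<Longrightarrow> 0 < p x"
    and p1: "\<And>x. x \<in> {a..b} \<Longrightarrow> (p has_real_derivative p' x) (at x within {a..b})"
    and p2: "\<And>x. x \<in> {a..b} \<Longrightarrow> (p' has_real_derivative p'' x) (at x within {a..b})"
    and p''_le: "\<And>x. x \<in> {a..b} \<Longrightarrow> p'' x \<le> 0"
    and f: "\<And>x. x \<in> {a..b} \<Longrightarrow> (f has_real_derivative f' x) (at x within {a..b})"
    and f'_cont: "continuous_on {a..b} f'"
    and mean: "integral {a..b} (\<lambda>x. p x * f x) = 0"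
  shows "k^2 * integral {a..b} (\<lambda>x. p x * (f x)^2) \<le> integral {a..b} (\<lambda>x. p x * (f' x)^2)"
proof -
  have p_cont: "continuous_on {a..b} p" and p'_cont: "continuous_on {a..b} p'"
    and f_cont: "continuous_on {a..b} f"
    by (rule DERIV_continuous_on, erule p1 p2 f)+
  define F where "F x = integral {a..x} (\<lambda>x. p x * f x)" for x
  have F: "(F has_real_derivative p x * f x) (at x within {a..b})" if "x \<in> {a..b}" for x
    unfolding F_def using that
    by (intro integral_has_real_derivative continuous_intros p_cont f_cont)
  have F0: "F a = 0" "F b = 0"
    using mean by (auto simp: F_def)
  define mid where "mid = (a + b) / 2"
  \<comment> \<open>The Riccati solution is centred at the midpoint: \<open>k * (b - a) < pi\<close>
    then keeps the argument of \<open>tan\<close> strictly between \<open>- (pi / 2)\<close> and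
    \<open>pi / 2\<close>, so \<open>c\<close> has no pole on \<open>{a..b}\<close>.\<close>
  define c where "c x = - k * tan (k * (x - mid))" for x
  have cos_pos: "cos (k * (x - mid)) > 0" if "x \<in> {a..b}" for x
  proof (rule cos_gt_zero_pi)
    have "\<bar>x - mid\<bar> \<le> (b - a) / 2"
      using that by (auto simp: mid_def abs_le_iff field_simps)
    then have "k * \<bar>x - mid\<bar> \<le> k * ((b - a) / 2)"
      using k by (intro mult_left_mono) auto
    also have "\<dots> < pi / 2" using k by simp
    finally have *: "\<bar>k * (x - mid)\<bar> < pi / 2"
      using k by (simp add: abs_mult mult.assoc)
    then show "- (pi / 2) < k * (x - mid)" "k * (x - mid) < pi / 2" by linarith+
  qed
  have c: "(c has_real_derivative - (k^2) - (c x)^2) (at x within {a..b})" if "x \<in> {a..b}" for x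
  proof -
    have "(c has_real_derivative - k * (inverse ((cos (k * (x - mid)))^2) * k)) (at x within {a..b})"
      unfolding c_def using cos_pos[OF that] by (auto intro!: derivative_eq_intros)
    moreover have "inverse ((cos (k * (x - mid)))^2) = 1 + (tan (k * (x - mid)))^2"
      using cos_pos[OF that] by (subst tan_sec) (auto simp: power_inverse)
    ultimately show ?thesis
      by (simp add: c_def power2_eq_square algebra_simps)
  qed
  define q where "q x = p' x / p x" for x
  have q: "(q has_real_derivative p'' x / p x - (q x)^2) (at x within {a..b})" if "x \<in> {a..b}" for x
    unfolding q_def using p_pos[OF that] that
    by (auto intro!: derivative_eq_intros p1 p2 simp: field_simps power2_eq_square)
  \<comment> \<open>With \<open>y = F / sqrt p\<close> one has \<open>y^2 = p * S^2\<close>, and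
    \<open>Z\<close> is \<open>F * f\<close> minus half of \<open>(c + q / 2) * y^2\<close>. The
    summand \<open>q / 2\<close> compensates for the derivative of \<open>sqrt p\<close>, the
    summand \<open>c\<close> is the calibration. \<open>W'\<close> is the derivative of
    \<open>(c + q / 2) * y^2\<close>.\<close>
  define S where "S x = F x / p x" for x
  define Z where "Z x = F x * f x - (c x + q x / 2) * (F x)^2 / p x / 2" for x
  define W' where "W' x = p x * ((- (k^2) - (c x)^2 + (p'' x / p x - (q x)^2) / 2) * (S x)^2
      + 2 * (c x + q x / 2) * S x * f x - (c x + q x / 2) * q x * (S x)^2)" for x
  define Z' where "Z' x = p x * (f x)^2 + p x * S x * f' x - W' x / 2" for x
  have Z: "(Z has_real_derivative Z' x) (at x within {a..b})" if "x \<in> {a..b}" for x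
  proof -
    have F_eq: "F x = p x * S x" and p'_eq: "p' x = q x * p x" "p x \<noteq> 0"
      using p_pos[OF that] by (auto simp: S_def q_def)
    have \<psi>: "((\<lambda>x. c x + q x / 2) has_real_derivative (- (k^2) - (c x)^2) + (p'' x / p x - (q x)^2) / 2) (at x within {a..b})"
      by (intro DERIV_add DERIV_cdivide c q that)
    have FF: "((\<lambda>x. (F x)^2) has_real_derivative 2 * F x * (p x * f x)) (at x within {a..b})"
      using F[OF that] by (auto intro!: derivative_eq_intros)
    show ?thesis
      unfolding Z_def
      by (rule DERIV_cong[OF DERIV_diff[OF DERIV_mult[OF F f]
              DERIV_cdivide[OF DERIV_divide[OF DERIV_mult[OF \<psi> FF] p1]]]])
        (use p'_eq(2) that in \<open>simp_all add: Z'_def W'_def F_eq p'_eq(1) field_simps power2_eq_square\<close>)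
  qed
  have lower: "p x * (f x)^2 / 2 - p x * (f' x)^2 / (2 * k^2) \<le> Z' x" if "x \<in> {a..b}" for x
  proof -
    \<comment> \<open>Completing the square: multiplied by \<open>p\<close>, this quantity is
      \<open>p * (f^2 - k^2 * S^2) - W'\<close>. Concavity of \<open>p\<close> enters through the
      sign of \<open>p''\<close>.\<close>
    have "0 \<le> (f x - (c x + q x / 2) * S x)^2 + (S x)^2 * (3 / 4 * (q x)^2 - p'' x / p x / 2)"
    proof (intro add_nonneg_nonneg mult_nonneg_nonneg zero_le_power2)
      have "p'' x / p x \<le> 0"
        using p_pos[OF that] p''_le[OF that] by (simp add: divide_nonpos_pos)
      then have "- (p'' x / p x) / 2 \<ge> 0" by simp
      then show "0 \<le> 3 / 4 * (q x)^2 - p'' x / p x / 2"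
        using zero_le_power2[of "q x"] by (simp only: diff_conv_add_uminus minus_divide_left)
    qed
    then have "(- (k^2) - (c x)^2 + (p'' x / p x - (q x)^2) / 2) * (S x)^2
      + 2 * (c x + q x / 2) * S x * f x - (c x + q x / 2) * q x * (S x)^2 \<le> (f x)^2 - k^2 * (S x)^2"
      by (simp add: power2_eq_square algebra_simps add_divide_distrib diff_divide_distrib)
    then have 1: "W' x \<le> p x * ((f x)^2 - k^2 * (S x)^2)"
      unfolding W'_def using p_pos[OF that] by (intro mult_left_mono) auto
    \<comment> \<open>Young's inequality with weight \<open>k\<close>: the term
      \<open>k^2 * S^2\<close> that it costs is exactly the one supplied by the calibration, so the
      constant stays sharp.\<close>
    have "0 \<le> (k * S x + f' x / k)^2" by simp
    then have "- (k^2 * (S x)^2) - (f' x)^2 / k^2 \<le> 2 * (S x * f' x)"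
      using k by (simp add: power2_eq_square field_simps)
    then have "p x * (- (k^2 * (S x)^2) - (f' x)^2 / k^2) \<le> p x * (2 * (S x * f' x))"
      using p_pos[OF that] by (intro mult_left_mono) auto
    with 1 show ?thesis
      by (simp add: Z'_def algebra_simps)
  qed
  have Z'_int: "(Z' has_integral 0) {a..b}"
  proof -
    have "(Z' has_integral Z b - Z a) {a..b}"
      using ab Z by (intro fundamental_theorem_of_calculus)
        (auto simp: has_real_derivative_iff_has_vector_derivative[symmetric])
    then show ?thesis by (simp add: Z_def F0)
  qed
  have int1: "(\<lambda>x. p x * (f x)^2) integrable_on {a..b}" and int2: "(\<lambda>x. p x * (f' x)^2) integrable_on {a..b}"
    by (intro integrable_continuous_real continuous_intros p_cont f_cont f'_cont)+
  have "integral {a..b} (\<lambda>x. p x * (f x)^2 / 2 - p x * (f' x)^2 / (2 * k^2)) \<le> 0"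
    using lower Z'_int int1 int2
    by (intro has_integral_le[OF integrable_integral Z'_int]) (auto intro!: integrable_diff integrable_on_divide)
  also have "integral {a..b} (\<lambda>x. p x * (f x)^2 / 2 - p x * (f' x)^2 / (2 * k^2))
      = integral {a..b} (\<lambda>x. p x * (f x)^2) / 2 - integral {a..b} (\<lambda>x. p x * (f' x)^2) / (2 * k^2)"
    using int1 int2 by (subst Henstock_Kurzweil_Integration.integral_diff) (auto intro!: integrable_on_divide)
  finally show ?thesis
    using k by (simp add: field_simps)
qed

text \<open>Subtracting the weighted mean \<open>m\<close> reduces this to mean zero. Multiplying by
  the total weight removes the division, so that the form passes to limits and stays usable when the
  mean is merely small.\<close>

lemma weighted_variance_smooth:
  fixes p p' p'' f f' :: "real \<Rightarrow> real"
  assumes ab: "a < b" and k: "0 < k" "k * (b - a) < pi"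
    and p_pos: "\<And>x. x \<in> {a..b} \<Longrightarrow> 0 < p x"
    and p1: "\<And>x. x \<in> {a..b} \<Longrightarrow> (p has_real_derivative p' x) (at x within {a..b})"
    and p2: "\<And>x. x \<in> {a..b} \<Longrightarrow> (p' has_real_derivative p'' x) (at x within {a..b})"
    and p''_le: "\<And>x. x \<in> {a..b} \<Longrightarrow> p'' x \<le> 0"
    and f: "\<And>x. x \<in> {a..b} \<Longrightarrow> (f has_real_derivative f' x) (at x within {a..b})"
    and f'_cont: "continuous_on {a..b} f'"
  shows "k^2 * (integral {a..b} (\<lambda>x. p x * (f x)^2) * integral {a..b} p - (integral {a..b} (\<lambda>x. p x * f x))^2)
    \<le> integral {a..b} (\<lambda>x. p x * (f' x)^2) * integral {a..b} p"
proof -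
  have p_cont: "continuous_on {a..b} p" by (rule DERIV_continuous_on, erule p1)
  have f_cont: "continuous_on {a..b} f" by (rule DERIV_continuous_on, erule f)
  define P where "P = integral {a..b} p"
  have "integral {a..b} (\<lambda>x. 0) < integral {a..b} p"
    using ab p_pos p_cont by (intro integral_less_real) (auto intro!: continuous_intros)
  then have P: "P > 0" by (simp add: P_def)
  define m where "m = integral {a..b} (\<lambda>x. p x * f x) / P"
  have i: "p integrable_on {a..b}" "(\<lambda>x. p x * f x) integrable_on {a..b}" "(\<lambda>x. p x * (f x)^2) integrable_on {a..b}"
    by (intro integrable_continuous_real continuous_intros p_cont f_cont)+
  have "k^2 * integral {a..b} (\<lambda>x. p x * (f x - m)^2) \<le> integral {a..b} (\<lambda>x. p x * (f' x)^2)"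
  proof (rule weighted_poincare_smooth[OF ab k p_pos p1 p2 p''_le _ f'_cont])
    show "((\<lambda>x. f x - m) has_real_derivative f' x) (at x within {a..b})" if "x \<in> {a..b}" for x
      using f[OF that] by (auto intro!: derivative_eq_intros)
    have "integral {a..b} (\<lambda>x. p x * f x - m * p x) = integral {a..b} (\<lambda>x. p x * f x) - m * P"
      using i integrable_on_mult_right[OF i(1), of m]
      by (subst Henstock_Kurzweil_Integration.integral_diff) (auto simp: P_def)
    then show "integral {a..b} (\<lambda>x. p x * (f x - m)) = 0"
      using P by (simp add: m_def algebra_simps)
  qed auto
  moreover have "integral {a..b} (\<lambda>x. p x * (f x - m)^2) = integral {a..b} (\<lambda>x. p x * (f x)^2 - 2 * m * (p x * f x) + m^2 * p x)"
    by (intro integral_cong) (simp add: power2_eq_square algebra_simps)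
  also have "\<dots> = integral {a..b} (\<lambda>x. p x * (f x)^2) - 2 * m * integral {a..b} (\<lambda>x. p x * f x) + m^2 * P"
    using i(3) integrable_on_mult_right[OF i(2), of "2 * m"] integrable_on_mult_right[OF i(1), of "m^2"]
    by (simp add: Henstock_Kurzweil_Integration.integral_add Henstock_Kurzweil_Integration.integral_diff
        integrable_diff P_def)
  also have "\<dots> = integral {a..b} (\<lambda>x. p x * (f x)^2) - (integral {a..b} (\<lambda>x. p x * f x))^2 / P"
    using P by (simp add: m_def power2_eq_square field_simps)
  ultimately have "k^2 * (integral {a..b} (\<lambda>x. p x * (f x)^2) - (integral {a..b} (\<lambda>x. p x * f x))^2 / P) * P
     \<le> integral {a..b} (\<lambda>x. p x * (f' x)^2) * P"
    using P by (intro mult_right_mono) auto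
  moreover have "(u - v / P) * P = u * P - v" for u v
    using P by (simp add: field_simps)
  ultimately show ?thesis
    unfolding P_def[symmetric] by (simp only: mult.assoc)
qed

text \<open>
  The smoothing is the second difference quotient of a double primitive of \<open>p\<close>; by the mean
  value theorem, used twice, its values are values of \<open>p\<close>.
\<close>

lemma concave_smoothing:
  fixes p :: "real \<Rightarrow> real"
  assumes conc: "concave_on {a<..<b} p" and "0 < h"
  obtains r r' r'' where
    "\<And>x. x \<in> {a + 2 * h..b - 4 * h} \<Longrightarrow> (r has_real_derivative r' x) (at x)"
    "\<And>x. x \<in> {a + 2 * h..b - 4 * h} \<Longrightarrow> (r' has_real_derivative r'' x) (at x)"
    "\<And>x. x \<in> {a + 2 * h..b - 4 * h} \<Longrightarrow> r'' x \<le> 0"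
    "\<And>x. x \<in> {a + 2 * h..b - 4 * h} \<Longrightarrow> \<exists>y\<in>{x..x + 2 * h}. r x = p y"
proof -
  \<comment> \<open>\<open>p\<close> need not extend continuously to the endpoints, hence the
    primitives live on an inset interval. The averaging window reaches up to
    \<open>x + 2 * h\<close>, which is why the right end is moved in by \<open>4 * h\<close> and the
    left end by only \<open>2 * h\<close>.\<close>
  define c where "c = a + h"
  define d where "d = b - h"
  have "continuous_on {a<..<b} p"
    using conc convex_on_continuous[of "{a<..<b}" "\<lambda>x. - p x"]
    by (auto simp: concave_on_def dest: continuous_on_minus)
  then have p_cont: "continuous_on {c..d} p"
    by (rule continuous_on_subset) (use \<open>0 < h\<close> in \<open>auto simp: c_def d_def\<close>)
  obtain P1 where P1: "\<And>x. x \<in> {c..d} \<Longrightarrow> (P1 has_real_derivative p x) (at x within {c..d})"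
    using antiderivative_continuous[OF p_cont] by (auto simp: has_real_derivative_iff_has_vector_derivative)
  have "continuous_on {c..d} P1" by (rule DERIV_continuous_on, erule P1)
  then obtain P2 where P2: "\<And>x. x \<in> {c..d} \<Longrightarrow> (P2 has_real_derivative P1 x) (at x within {c..d})"
    using antiderivative_continuous[of c d P1] by (auto simp: has_real_derivative_iff_has_vector_derivative)
  have D1: "(P1 has_real_derivative p x) (at x)" and D2: "(P2 has_real_derivative P1 x) (at x)"
    if "x \<in> {a + 2 * h..b - 2 * h}" for x
    using P1[of x] P2[of x] that \<open>0 < h\<close> by (auto simp: c_def d_def at_within_Icc_at)
  define r where "r x = inverse (h^2) * (P2 (x + 2 * h) - 2 * P2 (x + h) + P2 x)" for x
  define r' where "r' x = inverse (h^2) * (P1 (x + 2 * h) - 2 * P1 (x + h) + P1 x)" for x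
  define r'' where "r'' x = inverse (h^2) * (p (x + 2 * h) - 2 * p (x + h) + p x)" for x
  have shift1: "((\<lambda>x. P1 (x + s)) has_real_derivative p (x + s)) (at x)"
    and shift2: "((\<lambda>x. P2 (x + s)) has_real_derivative P1 (x + s)) (at x)"
    if "x \<in> {a + 2 * h..b - 2 * h - s}" "0 \<le> s" for x s
    using D1[of "x + s"] D2[of "x + s"] that by (auto simp: DERIV_shift)
  show thesis
  proof
    fix x assume x: "x \<in> {a + 2 * h..b - 4 * h}"
    show "(r has_real_derivative r' x) (at x)"
      unfolding r_def r'_def using x \<open>0 < h\<close>
      by (auto intro!: derivative_eq_intros shift2 D2)
    show "(r' has_real_derivative r'' x) (at x)"
      unfolding r'_def r''_def using x \<open>0 < h\<close>
      by (auto intro!: derivative_eq_intros shift1 D1)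
    have "(1 / 2) * p x + (1 / 2) * p (x + 2 * h) \<le> p ((1 / 2) *\<^sub>R x + (1 / 2) *\<^sub>R (x + 2 * h))"
      using x \<open>0 < h\<close> concave_onD[OF conc, of "1/2" x "x + 2 * h"] by auto
    also have "(1 / 2) *\<^sub>R x + (1 / 2) *\<^sub>R (x + 2 * h) = x + h" by (simp add: field_simps)
    finally show "r'' x \<le> 0"
      by (simp add: r''_def mult_nonneg_nonpos)
    have "\<exists>y. x < y \<and> y < x + h \<and> (\<lambda>x. P2 (x + h) - P2 x) (x + h) - (\<lambda>x. P2 (x + h) - P2 x) x = (x + h - x) * (P1 (y + h) - P1 y)"
      using x \<open>0 < h\<close> by (intro MVT2) (auto intro!: derivative_eq_intros shift2 D2)
    then obtain y where y: "x < y" "y < x + h" "P2 (x + 2 * h) - 2 * P2 (x + h) + P2 x = h * (P1 (y + h) - P1 y)"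
      by (auto simp: algebra_simps)
    have "\<exists>z. y < z \<and> z < y + h \<and> P1 (y + h) - P1 y = (y + h - y) * p z"
      using x y \<open>0 < h\<close> by (intro MVT2) (auto intro!: D1)
    then obtain z where z: "y < z" "z < y + h" "P1 (y + h) - P1 y = h * p z" by auto
    show "\<exists>y\<in>{x..x + 2 * h}. r x = p y"
      using y z \<open>0 < h\<close> by (intro bexI[of _ z]) (auto simp: r_def power2_eq_square field_simps)
  qed
qed

text \<open>Section lengths of a convex set are concave, but in general neither smooth nor bounded
  away from zero near the ends. Smoothed weights on interior intervals avoid both defects, and
  \<open>M\<close> dominates them in the limit.\<close>

lemma weighted_variance_concave:
  fixes p f f' :: "real \<Rightarrow> real"
  assumes ab: "a < b" and conc: "concave_on {a<..<b} p"
    and p_pos: "\<And>x. x \<in> {a<..<b} \<Longrightarrow> 0 < p x" and p_le: "\<And>x. x \<in> {a<..<b} \<Longrightarrow> p x \<le> M"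
    and f: "\<And>x. x \<in> {a..b} \<Longrightarrow> (f has_real_derivative f' x) (at x within {a..b})"
    and f'_cont: "continuous_on {a..b} f'"
  shows "integral {a<..<b} (\<lambda>x. p x * (f x)^2) * integral {a<..<b} p - (integral {a<..<b} (\<lambda>x. p x * f x))^2
    \<le> ((b - a) / pi)^2 * (integral {a<..<b} (\<lambda>x. p x * (f' x)^2) * integral {a<..<b} p)"
proof -
  \<comment> \<open>The summand 8 gives \<open>8 * h n \<le> b - a\<close> already for
    \<open>n = 0\<close>, so the interval shortened by \<open>2 * h n\<close> and
    \<open>4 * h n\<close> never degenerates.\<close>
  define h where "h n = (b - a) / (real n + 8)" for n
  have h: "0 < h n" "8 * h n \<le> b - a" for n
    using ab by (auto simp: h_def field_simps intro!: mult_right_mono)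
  have h_lim: "h \<longlonglongrightarrow> 0"
    unfolding h_def by real_asymp
  have "\<exists>r r' r''. \<forall>x\<in>{a + 2 * h n..b - 4 * h n}. (r has_real_derivative r' x) (at x)
      \<and> (r' has_real_derivative r'' x) (at x) \<and> r'' x \<le> 0 \<and> (\<exists>y\<in>{x..x + 2 * h n}. r x = p y)" for n
    by (rule concave_smoothing[OF conc h(1)[of n]]) blast
  then obtain r r' r'' where
    r: "\<And>n x. x \<in> {a + 2 * h n..b - 4 * h n} \<Longrightarrow> (r n has_real_derivative r' n x) (at x)"
    and r': "\<And>n x. x \<in> {a + 2 * h n..b - 4 * h n} \<Longrightarrow> (r' n has_real_derivative r'' n x) (at x)"
    and r'': "\<And>n x. x \<in> {a + 2 * h n..b - 4 * h n} \<Longrightarrow> r'' n x \<le> 0"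
    and r_val: "\<And>n x. x \<in> {a + 2 * h n..b - 4 * h n} \<Longrightarrow> \<exists>y\<in>{x..x + 2 * h n}. r n x = p y"
    by metis
  define A where "A n = a + 2 * h n" for n
  define B where "B n = b - 4 * h n" for n
  have AB: "a < A n" "A n < B n" "B n < b" "B n - A n < b - a" for n
    using h[of n] by (auto simp: A_def B_def)
  have sub: "{A n..B n} \<subseteq> {a<..<b}" "{A n..B n} \<subseteq> {a..b}" for n using AB[of n] by auto
  have r_in: "\<exists>y\<in>{a<..<b}. x \<le> y \<and> y \<le> x + 2 * h n \<and> r n x = p y" if "x \<in> {A n..B n}" for n x
    using r_val[of x n] that h[of n] by (force simp: A_def B_def)
  have f_cont: "continuous_on {a..b} f" by (rule DERIV_continuous_on, erule f)
  have p_cont: "continuous_on {a<..<b} p"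
    using conc convex_on_continuous[of "{a<..<b}" "\<lambda>x. - p x"]
    by (auto simp: concave_on_def dest: continuous_on_minus)
  have r_cont: "continuous_on {A n..B n} (r n)" for n
    by (rule DERIV_continuous_on, rule has_field_derivative_at_within, rule r) (auto simp: A_def B_def)
  have lim: "(\<lambda>n. integral {A n..B n} (\<lambda>x. r n x * g x)) \<longlonglongrightarrow> integral {a<..<b} (\<lambda>x. p x * g x)"
    if g: "continuous_on {a..b} g" for g
  proof -
    obtain G where "\<forall>y\<in>g ` {a..b}. norm y \<le> G"
      using compact_imp_bounded[OF compact_continuous_image[OF g]] by (auto simp: bounded_iff)
    then have G: "\<bar>g x\<bar> \<le> G" if "x \<in> {a..b}" for x
      using that by auto
    have "(\<lambda>n. integral {a<..<b} (\<lambda>x. if x \<in> {A n..B n} then r n x * g x else 0)) \<longlonglongrightarrow> integral {a<..<b} (\<lambda>x. p x * g x)"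
    proof (rule dominated_convergence(2))
      show "(\<lambda>x. if x \<in> {A n..B n} then r n x * g x else 0) integrable_on {a<..<b}" for n
      proof -
        have "(\<lambda>x. r n x * g x) integrable_on {A n..B n}"
          using sub(2) by (intro integrable_continuous_real continuous_intros r_cont continuous_on_subset[OF g])
        then show ?thesis
          using sub(1)[of n] by (subst integrable_restrict_Int) (simp add: Int_absorb2)
      qed
      show "(\<lambda>x. M * G) integrable_on {a<..<b}"
        by (intro integrable_on_const) auto
      show "norm (if x \<in> {A n..B n} then r n x * g x else 0) \<le> M * G" if x: "x \<in> {a<..<b}" for n x
      proof -
        have "0 \<le> M" "0 \<le> G" using p_pos[OF x] p_le[OF x] G[of x] x by auto
        moreover have "\<bar>r n x\<bar> \<le> M" if "x \<in> {A n..B n}"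
          using r_in[OF that] p_pos p_le by force
        ultimately show ?thesis
          using G[of x] x by (auto simp: abs_mult intro!: mult_mono)
      qed
      show "(\<lambda>n. if x \<in> {A n..B n} then r n x * g x else 0) \<longlonglongrightarrow> p x * g x" if x: "x \<in> {a<..<b}" for x
      proof -
        have "(\<lambda>n. A n) \<longlonglongrightarrow> a + 2 * 0" "(\<lambda>n. B n) \<longlonglongrightarrow> b - 4 * 0"
          unfolding A_def B_def by (intro tendsto_intros h_lim)+
        then have "eventually (\<lambda>n. A n < x) sequentially" "eventually (\<lambda>n. x < B n) sequentially"
          using x order_tendstoD by fastforce+
        then have ev: "eventually (\<lambda>n. x \<in> {A n..B n}) sequentially"
          by eventually_elim auto
        \<comment> \<open>The value \<open>r n x\<close> is a value of \<open>p\<close> in a window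
          that shrinks to \<open>x\<close>, so continuity of \<open>p\<close> at \<open>x\<close>
          gives pointwise convergence of the weights.\<close>
        define y where "y n = (SOME y. y \<in> {a<..<b} \<and> x \<le> y \<and> y \<le> x + 2 * h n \<and> r n x = p y)" for n
        have y: "y n \<in> {a<..<b} \<and> x \<le> y n \<and> y n \<le> x + 2 * h n \<and> r n x = p (y n)" if "x \<in> {A n..B n}" for n
          unfolding y_def by (rule someI_ex) (use r_in[OF that] in blast)
        have "(\<lambda>n. x + 2 * h n) \<longlonglongrightarrow> x + 2 * 0"
          by (intro tendsto_intros h_lim)
        then have "y \<longlonglongrightarrow> x"
          by (intro tendsto_sandwich[of "\<lambda>n. x" y sequentially "\<lambda>n. x + 2 * h n"])
            (use y ev in \<open>auto elim!: eventually_mono\<close>)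
        moreover have "isCont p x"
          using p_cont x by (auto simp: continuous_on_eq_continuous_at)
        ultimately have "(\<lambda>n. p (y n)) \<longlonglongrightarrow> p x"
          by (rule isCont_tendsto_compose[rotated])
        then have "(\<lambda>n. p (y n) * g x) \<longlonglongrightarrow> p x * g x"
          by (intro tendsto_intros)
        then show ?thesis
          by (rule Lim_transform_eventually) (use ev y in \<open>auto elim!: eventually_mono\<close>)
      qed
    qed
    also have "(\<lambda>n. integral {a<..<b} (\<lambda>x. if x \<in> {A n..B n} then r n x * g x else 0)) = (\<lambda>n. integral {A n..B n} (\<lambda>x. r n x * g x))"
      using sub by (subst integral_restrict_Int) (simp add: Int_absorb2)
    finally show ?thesis .
  qed
  have main: "(pi / (b - a))^2 * (integral {A n..B n} (\<lambda>x. r n x * (f x)^2) * integral {A n..B n} (r n) - (integral {A n..B n} (\<lambda>x. r n x * f x))^2)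
    \<le> integral {A n..B n} (\<lambda>x. r n x * (f' x)^2) * integral {A n..B n} (r n)" for n
  proof (rule weighted_variance_smooth)
    \<comment> \<open>The shortened interval leaves room for the limiting constant
      \<open>pi / (b - a)\<close> itself, although the smooth version demands a strict
      inequality.\<close>
    show "pi / (b - a) * (B n - A n) < pi"
    proof -
      have "pi * (B n - A n) < pi * (b - a)"
        using AB[of n] by (intro mult_strict_left_mono) auto
      then show ?thesis using ab by (simp add: field_simps)
    qed
    show "(r n has_real_derivative r' n x) (at x within {A n..B n})"
      "(r' n has_real_derivative r'' n x) (at x within {A n..B n})" "r'' n x \<le> 0"
      if "x \<in> {A n..B n}" for x
      using r[of x n] r'[of x n] r''[of x n] that
      by (auto simp: A_def B_def intro: has_field_derivative_at_within)
    show "0 < r n x" if "x \<in> {A n..B n}" for x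
      using r_in[OF that] p_pos by force
    show "(f has_real_derivative f' x) (at x within {A n..B n})" if "x \<in> {A n..B n}" for x
      using that sub[of n] by (intro DERIV_subset[OF f]) auto
    show "continuous_on {A n..B n} f'"
      using f'_cont sub(2) by (rule continuous_on_subset)
  qed (use AB[of n] ab in auto)
  have "(pi / (b - a))^2 * (integral {a<..<b} (\<lambda>x. p x * (f x)^2) * integral {a<..<b} p - (integral {a<..<b} (\<lambda>x. p x * f x))^2)
    \<le> integral {a<..<b} (\<lambda>x. p x * (f' x)^2) * integral {a<..<b} p"
  proof (rule LIMSEQ_le)
    have 1: "(\<lambda>n. integral {A n..B n} (r n)) \<longlonglongrightarrow> integral {a<..<b} p"
      using lim[of "\<lambda>x. 1"] by simp
    show "(\<lambda>n. (pi / (b - a))^2 * (integral {A n..B n} (\<lambda>x. r n x * (f x)^2) * integral {A n..B n} (r n) - (integral {A n..B n} (\<lambda>x. r n x * f x))^2))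
      \<longlonglongrightarrow> (pi / (b - a))^2 * (integral {a<..<b} (\<lambda>x. p x * (f x)^2) * integral {a<..<b} p - (integral {a<..<b} (\<lambda>x. p x * f x))^2)"
      by (intro tendsto_intros lim 1 continuous_intros f_cont)
    show "(\<lambda>n. integral {A n..B n} (\<lambda>x. r n x * (f' x)^2) * integral {A n..B n} (r n))
      \<longlonglongrightarrow> integral {a<..<b} (\<lambda>x. p x * (f' x)^2) * integral {a<..<b} p"
      by (intro tendsto_intros lim 1 continuous_intros f'_cont)
  qed (use main in auto)
  then show ?thesis
    using ab by (simp add: field_simps)
qed

section \<open>Needle decomposition in the plane\<close>

lemma set_integrable_bounded_continuous:
  fixes f :: "'a::euclidean_space \<Rightarrow> 'b::euclidean_space"
  assumes "K \<in> sets borel" "bounded K" "continuous_on UNIV f"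
  shows "set_integrable lborel K f"
proof -
  obtain R where R: "K \<subseteq> cball 0 R"
    using assms(2) by (auto simp: bounded_iff subset_iff dist_norm)
  have "set_integrable lborel (cball 0 R) f"
    unfolding set_integrable_def
    by (rule borel_integrable_compact) (auto intro: continuous_on_subset[OF assms(3)])
  then show ?thesis
    by (rule set_integrable_subset) (use assms R in auto)
qed

lemma AE_lborel_not_hyperplane:
  fixes n :: "'a::euclidean_space"
  assumes "n \<noteq> 0"
  shows "AE x in lborel. n \<bullet> x \<noteq> c"
proof -
  have "{x. n \<bullet> x = c} \<in> null_sets lebesgue"
    using negligible_hyperplane[of n c] assms by (simp add: negligible_iff_null_sets)
  then have "{x. n \<bullet> x = c} \<in> null_sets lborel"
    by (auto simp: null_sets_def)
  then show ?thesis
    by (auto simp: AE_iff_null_sets dest!: AE_not_in)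
qed

lemma set_integral_split_hyperplane:
  fixes n :: "'a::euclidean_space" and f :: "'a \<Rightarrow> real"
  assumes n: "n \<noteq> 0" and K: "K \<in> sets borel" and f: "set_integrable lborel K f"
  shows "(LBINT x:K. f x) = (LBINT x:K \<inter> {x. n \<bullet> x > c}. f x) + (LBINT x:K \<inter> {x. n \<bullet> x < c}. f x)"
proof -
  have 1: "set_integrable lborel (K \<inter> {x. n \<bullet> x > c}) f" "set_integrable lborel (K \<inter> {x. n \<bullet> x < c}) f"
    using K by (auto intro!: set_integrable_subset[OF f])
  have 2: "set_integrable lborel (K \<inter> {x. n \<bullet> x > c} \<union> K \<inter> {x. n \<bullet> x < c}) f"
    using 1 K by (intro set_integrable_Un) auto
  have "(LBINT x:K. f x) = (LINT x:(K \<inter> {x. n \<bullet> x > c}) \<union> (K \<inter> {x. n \<bullet> x < c})|lborel. f x)"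
    unfolding set_lebesgue_integral_def
  proof (rule integral_cong_AE)
    show "AE x in lborel. indicat_real K x *\<^sub>R f x =
      indicat_real (K \<inter> {x. c < n \<bullet> x} \<union> K \<inter> {x. n \<bullet> x < c}) x *\<^sub>R f x"
      using AE_lborel_not_hyperplane[OF n, of c] by eventually_elim (auto simp: indicator_def)
  qed (use f 2 in \<open>simp_all only: set_integrable_def borel_measurable_integrable\<close>)
  also have "\<dots> = (LBINT x:K \<inter> {x. n \<bullet> x > c}. f x) + (LBINT x:K \<inter> {x. n \<bullet> x < c}. f x)"
    using 1 by (intro set_integral_Un) auto
  finally show ?thesis .
qed

text \<open>Rotating a half-plane about \<open>p\<close> by the angle \<open>pi\<close> turns it
  into the complementary one. As the total integral is zero, the integral over the half-plane
  changes sign on the way and vanishes for some angle. Continuity in the angle is dominated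
  convergence, the boundary line being a null set.\<close>

lemma bisecting_line:
  fixes u :: "real \<times> real \<Rightarrow> real"
  assumes K: "K \<in> sets borel" and u: "set_integrable lborel K u" and zero: "(LBINT x:K. u x) = 0"
  obtains n where "n \<noteq> 0" "(LBINT x:K \<inter> {x. n \<bullet> x > n \<bullet> p}. u x) = 0"
proof -
  define N where "N \<theta> = (cos \<theta>, sin \<theta>)" for \<theta> :: real
  define I where "I \<theta> = (LBINT x:K \<inter> {x. N \<theta> \<bullet> x > N \<theta> \<bullet> p}. u x)" for \<theta>
  have N0: "N \<theta> \<noteq> 0" for \<theta>
  proof
    assume "N \<theta> = 0"
    then have "sin \<theta> = 0" "cos \<theta> = 0" by (auto simp: N_def zero_prod_def)
    then show False using sin_cos_squared_add[of \<theta>] by simp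
  qed
  have "continuous_on {0..pi} I"
    unfolding continuous_on_sequentially
  proof (safe, unfold comp_def)
    fix t :: "nat \<Rightarrow> real" and \<theta> assume t: "t \<longlonglongrightarrow> \<theta>"
    have Nt: "(\<lambda>n. N (t n)) \<longlonglongrightarrow> N \<theta>"
      unfolding N_def by (intro tendsto_intros t)
    show "(\<lambda>n. I (t n)) \<longlonglongrightarrow> I \<theta>"
      unfolding I_def set_lebesgue_integral_def
    proof (rule integral_dominated_convergence[where w="\<lambda>x. norm (indicator K x *\<^sub>R u x)"])
      show "AE x in lborel. (\<lambda>n. indicator (K \<inter> {x. N (t n) \<bullet> p < N (t n) \<bullet> x}) x *\<^sub>R u x)
        \<longlonglongrightarrow> indicator (K \<inter> {x. N \<theta> \<bullet> p < N \<theta> \<bullet> x}) x *\<^sub>R u x"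
        using AE_lborel_not_hyperplane[OF N0[of \<theta>], of "N \<theta> \<bullet> p"]
      proof eventually_elim
        case (elim x)
        have lim: "(\<lambda>n. N (t n) \<bullet> x - N (t n) \<bullet> p) \<longlonglongrightarrow> N \<theta> \<bullet> x - N \<theta> \<bullet> p"
          by (intro tendsto_intros Nt)
        \<comment> \<open>Off the limiting line the strict inequality is stable under small
          rotations, so the indicators are eventually constant.\<close>
        have "eventually (\<lambda>n. (N (t n) \<bullet> p < N (t n) \<bullet> x) = (N \<theta> \<bullet> p < N \<theta> \<bullet> x)) sequentially"
        proof (cases "N \<theta> \<bullet> p < N \<theta> \<bullet> x")
          case True
          then show ?thesis using order_tendstoD(1)[OF lim, of 0] by (auto elim!: eventually_mono)
        next
          case False
          then show ?thesis using order_tendstoD(2)[OF lim, of 0] elim by (auto elim!: eventually_mono)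
        qed
        then show ?case
          by (intro tendsto_eventually) (auto simp: indicator_def elim!: eventually_mono)
      qed
      have meas: "(\<lambda>x. indicator (K \<inter> {x. n \<bullet> p < n \<bullet> x}) x *\<^sub>R u x) \<in> borel_measurable lborel" for n
        using set_integrable_subset[OF u, of "K \<inter> {x. n \<bullet> p < n \<bullet> x}"] K by (simp add: set_integrable_def)
      show "(\<lambda>x. indicator (K \<inter> {x. N \<theta> \<bullet> p < N \<theta> \<bullet> x}) x *\<^sub>R u x) \<in> borel_measurable lborel"
        "\<And>i. (\<lambda>x. indicator (K \<inter> {x. N (t i) \<bullet> p < N (t i) \<bullet> x}) x *\<^sub>R u x) \<in> borel_measurable lborel"
        by (rule meas)+
      show "integrable lborel (\<lambda>x. norm (indicator K x *\<^sub>R u x))"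
        using u by (simp add: set_integrable_def)
      show "AE x in lborel. norm (indicator (K \<inter> {x. N (t i) \<bullet> p < N (t i) \<bullet> x}) x *\<^sub>R u x) \<le> norm (indicator K x *\<^sub>R u x)" for i
        by (auto simp: indicator_def)
    qed
  qed
  moreover have "I 0 + I pi = 0"
  proof -
    have "N pi = - N 0" by (simp add: N_def)
    then have "{x. N pi \<bullet> x > N pi \<bullet> p} = {x. N 0 \<bullet> x < N 0 \<bullet> p}" by auto
    then show ?thesis
      using set_integral_split_hyperplane[OF N0[of 0] K u, of "N 0 \<bullet> p"] zero by (simp add: I_def)
  qed
  ultimately have "\<exists>\<theta>. 0 \<le> \<theta> \<and> \<theta> \<le> pi \<and> I \<theta> = 0"
    by (cases "I 0 \<le> 0") (auto intro: IVT' IVT2')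
  then obtain \<theta> where "I \<theta> = 0" by blast
  then show thesis
    using that[OF N0[of \<theta>]] by (simp add: I_def)
qed

text \<open>Each cut passes through one point of \<open>P\<close> and keeps an open side, which
  therefore misses that point; later cuts only shrink the set. The integrals of \<open>w\<close>
  over the two sides add up to a nonnegative number, so one side can always be kept.\<close>

lemma avoid_finite_set:
  fixes u w :: "real \<times> real \<Rightarrow> real"
  assumes "finite P" and u: "continuous_on UNIV u" and w: "continuous_on UNIV w"
    and K: "open K" "convex K" "bounded K" "K \<noteq> {}"
    and zero: "(LBINT x:K. u x) = 0" and nonneg: "0 \<le> (LBINT x:K. w x)"
  obtains K' where "K' \<subseteq> K" "open K'" "convex K'" "K' \<noteq> {}" "K' \<inter> P = {}"
    "(LBINT x:K'. u x) = 0" "0 \<le> (LBINT x:K'. w x)"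
proof -
  have "\<exists>K'\<subseteq>K. open K' \<and> convex K' \<and> K' \<noteq> {} \<and> K' \<inter> P = {} \<and>
    (LBINT x:K'. u x) = 0 \<and> 0 \<le> (LBINT x:K'. w x)"
    using \<open>finite P\<close>
  proof induction
    case empty
    then show ?case using assms by (intro exI[of _ K]) auto
  next
    case (insert p P)
    from insert.IH obtain L where L: "L \<subseteq> K" "open L" "convex L" "L \<noteq> {}" "L \<inter> P = {}"
      "(LBINT x:L. u x) = 0" "0 \<le> (LBINT x:L. w x)" by blast
    show ?case
    proof (cases "p \<in> L")
      case False
      with L show ?thesis by (intro exI[of _ L]) auto
    next
      case True
      have bL: "bounded L" using K L bounded_subset by blast
      have iu: "set_integrable lborel L u" and iw: "set_integrable lborel L w"
        using L bL u w by (auto intro!: set_integrable_bounded_continuous)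
      obtain n where n: "n \<noteq> 0" "(LBINT x:L \<inter> {x. n \<bullet> x > n \<bullet> p}. u x) = 0"
        by (rule bisecting_line[OF _ iu L(6), of p]) (use L(2) in auto)
      let ?A = "L \<inter> {x. n \<bullet> x > n \<bullet> p}" and ?B = "L \<inter> {x. n \<bullet> x < n \<bullet> p}"
      have uB: "(LBINT x:?B. u x) = 0"
        using set_integral_split_hyperplane[OF n(1) _ iu, of "n \<bullet> p"] L n(2) by simp
      have pos: "0 \<le> (LBINT x:?A. w x) \<or> 0 \<le> (LBINT x:?B. w x)"
        using set_integral_split_hyperplane[OF n(1) _ iw, of "n \<bullet> p"] L by auto
      obtain e where e: "e > 0" "ball p e \<subseteq> L"
        using L(2) True openE by blast
      have "p + (e / 2 / norm n) *\<^sub>R n \<in> L" "p - (e / 2 / norm n) *\<^sub>R n \<in> L"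
        using e(1) n(1) by (intro subsetD[OF e(2)]; simp add: dist_norm)+
      moreover have "0 < (e / 2 / norm n) * (n \<bullet> n)"
        using e(1) n(1) by simp
      ultimately have "p + (e / 2 / norm n) *\<^sub>R n \<in> ?A" "p - (e / 2 / norm n) *\<^sub>R n \<in> ?B"
        by (simp_all add: inner_add_right inner_diff_right)
      then have A0: "?A \<noteq> {}" and B0: "?B \<noteq> {}" by blast+
      have A: "open ?A" "convex ?A" and B: "open ?B" "convex ?B"
        using L by (simp_all add: open_Int convex_Int open_halfspace_gt open_halfspace_lt convex_halfspace_gt convex_halfspace_lt)
      have P: "?A \<inter> insert p P = {}" "?B \<inter> insert p P = {}"
        using L(5) by auto
      have sub: "?A \<subseteq> K" "?B \<subseteq> K" using L(1) by auto
      from pos show ?thesis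
      proof
        assume "0 \<le> (LBINT x:?A. w x)"
        with A A0 P sub n(2) show ?thesis by (intro exI[of _ ?A]) simp
      next
        assume "0 \<le> (LBINT x:?B. w x)"
        with B B0 P sub uB show ?thesis by (intro exI[of _ ?B]) simp
      qed
    qed
  qed
  then show thesis using that by blast
qed

section \<open>Thin convex sets and the lengths of their sections\<close>

lemma open_convex_real_eq_interval:
  fixes S :: "real set"
  assumes "open S" "convex S" "bounded S" "S \<noteq> {}"
  obtains a b where "a < b" "S = {a<..<b}"
proof -
  have bdd: "bdd_above S" "bdd_below S"
    using assms(3) by (auto intro: bounded_imp_bdd_above bounded_imp_bdd_below)
  have "S = {Inf S<..<Sup S}"
  proof safe
    fix x assume x: "x \<in> S"
    then obtain e where e: "e > 0" "ball x e \<subseteq> S" using assms(1) openE by blast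
    then have "x - e / 2 \<in> S" "x + e / 2 \<in> S" by (auto simp: dist_real_def subset_iff)
    then have "Inf S \<le> x - e / 2" "x + e / 2 \<le> Sup S"
      using bdd by (auto intro: cInf_lower cSup_upper)
    then show "x \<in> {Inf S<..<Sup S}" using e(1) by auto
  next
    fix x assume "x \<in> {Inf S<..<Sup S}"
    then obtain y z where "y \<in> S" "z \<in> S" "y < x" "x < z"
      using bdd assms(4) by (auto simp: cInf_less_iff less_cSup_iff)
    then show "x \<in> S"
      using assms(2) by (meson convex_contains_segment closed_segment_eq_real_ivl atLeastAtMost_iff less_imp_le
          is_interval_convex_1 mem_is_interval_1_I)
  qed
  moreover from this have "Inf S < Sup S" using assms(4) by (metis greaterThanLessThan_empty_iff not_le)
  ultimately show thesis using that by blast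
qed

text \<open>
  If \<open>c\<close> were far from the line through \<open>p\<close> and \<open>q\<close>, the triangle \<open>pqc\<close> would contain a ball
  around its centroid.
\<close>

lemma thin_if_no_ball:
  fixes K :: "(real \<times> real) set" and p q c :: "real \<times> real"
  assumes K: "open K" "convex K" and r: "0 < r" and no_ball: "\<And>m. \<not> ball m r \<subseteq> K"
    and pqc: "p \<in> closure K" "q \<in> closure K" "c \<in> closure K"
    and less: "fst p < fst q" and mid: "fst p \<le> fst c" "fst c \<le> fst q"
    and tall: "\<bar>snd c - snd p\<bar> \<le> fst q - fst p" and slope: "\<bar>s\<bar> \<le> 1"
    and q: "snd q = snd p + s * (fst q - fst p)"
  shows "\<bar>snd c - (snd p + s * (fst c - fst p))\<bar> \<le> 18 * r"
proof (rule ccontr)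
  define L where "L = fst q - fst p"
  define h where "h = snd c - (snd p + s * (fst c - fst p))"
  assume "\<not> ?thesis"
  then have h: "18 * r < \<bar>h\<bar>" by (simp add: h_def)
  have L: "0 < L" using less by (simp add: L_def)
  have s_le: "\<bar>s * (fst c - fst p)\<bar> \<le> 1 * L"
    unfolding abs_mult using slope mid by (intro mult_mono) (auto simp: L_def)
  have "h = (snd c - snd p) - s * (fst c - fst p)" by (simp add: h_def)
  then have "\<bar>h\<bar> \<le> \<bar>snd c - snd p\<bar> + \<bar>s * (fst c - fst p)\<bar>" using abs_triangle_ineq4 by metis
  also have "\<dots> \<le> L + 1 * L" using tall s_le by (intro add_mono) (auto simp: L_def)
  finally have "\<bar>h\<bar> \<le> 2 * L" by simp
  then have rL: "9 * r < L" using h by linarith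
  \<comment> \<open>A displacement \<open>v\<close> from the centroid changes the barycentric
    weights \<open>1 / 3\<close> of \<open>q\<close> and \<open>c\<close> by \<open>b\<close> and
    \<open>e\<close>. A height above \<open>18 * r\<close> forces
    \<open>\<bar>e\<bar> \<le> 1 / 9\<close> and \<open>\<bar>b\<bar> \<le> 2 / 9\<close>, whose sum
    \<open>1 / 3\<close> is just small enough to keep the weight of \<open>p\<close>
    nonnegative.\<close>
  define m where "m = (1 / 3) *\<^sub>R (p + q + c)"
  have "ball m r \<subseteq> closure K"
  proof
    fix z assume z: "z \<in> ball m r"
    define v where "v = z - m"
    have "norm v < r" using z by (simp add: v_def dist_norm norm_minus_commute)
    then have v: "\<bar>fst v\<bar> < r" "\<bar>snd v\<bar> < r"
      using norm_fst_le[of "fst v" "snd v"] norm_snd_le[of "snd v" "fst v"] by auto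
    have "\<bar>s * fst v\<bar> \<le> 1 * \<bar>fst v\<bar>" unfolding abs_mult using slope by (intro mult_right_mono) auto
    then have "\<bar>snd v - s * fst v\<bar> \<le> 2 * r" using v by linarith
    define y where "y = snd v - s * fst v"
    have y: "\<bar>y\<bar> \<le> 2 * r" using \<open>\<bar>snd v - s * fst v\<bar> \<le> 2 * r\<close> by (simp add: y_def)
    define e where "e = y / h"
    define y' where "y' = e * (fst c - fst p)"
    define b where "b = (fst v - y') / L"
    have h0: "h \<noteq> 0" using h r by auto
    have e: "\<bar>e\<bar> \<le> 1 / 9"
    proof -
      have "9 * \<bar>y\<bar> \<le> \<bar>h\<bar>" using y h by linarith
      then show ?thesis using h0 by (simp add: e_def abs_divide field_simps)
    qed
    moreover have "\<bar>b\<bar> \<le> 2 / 9"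
    proof -
      have "\<bar>y'\<bar> \<le> 1 / 9 * L"
        unfolding abs_mult y'_def using e mid by (intro mult_mono) (auto simp: L_def)
      moreover have "\<bar>fst v\<bar> \<le> 1 / 9 * L" using v(1) rL by simp
      ultimately have "\<bar>fst v\<bar> + \<bar>y'\<bar> \<le> 1 / 9 * L + 1 / 9 * L" by (rule add_mono[rotated])
      then have "9 * \<bar>fst v - y'\<bar> \<le> 2 * L"
        using order_trans[OF abs_triangle_ineq4[of "fst v" y']] by fastforce
      then show ?thesis using L by (simp add: b_def abs_divide field_simps)
    qed
    ultimately have nn: "0 \<le> 1 / 3 - b - e" "0 \<le> 1 / 3 + b" "0 \<le> 1 / 3 + e" by linarith+
    have "z = m + v" by (simp add: v_def)
    also have "\<dots> = (1 / 3 - b - e) *\<^sub>R p + (1 / 3 + b) *\<^sub>R q + (1 / 3 + e) *\<^sub>R c"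
    proof (rule prod_eqI)
      have bL: "b * (fst q - fst p) = fst v - e * (fst c - fst p)"
        using L by (simp add: b_def L_def y'_def)
      then show "fst (m + v) = fst ((1 / 3 - b - e) *\<^sub>R p + (1 / 3 + b) *\<^sub>R q + (1 / 3 + e) *\<^sub>R c)"
        by (simp add: m_def algebra_simps)
      have eh: "e * h = snd v - s * fst v" using h0 by (simp add: e_def y_def)
      have "b * (snd q - snd p) + e * (snd c - snd p) = s * (b * (fst q - fst p)) + e * (h + s * (fst c - fst p))"
        by (simp add: q h_def algebra_simps)
      also have "\<dots> = snd v"
        unfolding bL using eh by (simp add: algebra_simps)
      finally show "snd (m + v) = snd ((1 / 3 - b - e) *\<^sub>R p + (1 / 3 + b) *\<^sub>R q + (1 / 3 + e) *\<^sub>R c)"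
        by (simp add: m_def algebra_simps)
    qed
    finally have z_eq: "z = (1 / 3 - b - e) *\<^sub>R p + (1 / 3 + b) *\<^sub>R q + (1 / 3 + e) *\<^sub>R c" .
    have "z \<in> convex hull {p, q, c}"
      unfolding convex_hull_3 z_eq using nn by force
    also have "\<dots> \<subseteq> closure K"
      using pqc K by (intro hull_minimal convex_closure) auto
    finally show "z \<in> closure K" .
  qed
  \<comment> \<open>An open convex set is the interior of its closure, so a ball found in the
    closure already lies in \<open>K\<close>.\<close>
  then have "ball m r \<subseteq> interior (closure K)"
    by (intro interior_maximal) auto
  also have "\<dots> = K"
    using K by (simp add: convex_interior_closure interior_open)
  finally show False using no_ball by blast
qed

definition section_length :: "(real \<times> real) set \<Rightarrow> real \<Rightarrow> real" where
  "section_length K x = measure lborel {y. (x, y) \<in> K}"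

lemma section_interval:
  fixes K :: "(real \<times> real) set"
  assumes "open K" "convex K" "bounded K" "(x, y) \<in> K"
  obtains a b where "a < b" "{y. (x, y) \<in> K} = {a<..<b}"
proof (rule open_convex_real_eq_interval)
  show "open {y. (x, y) \<in> K}"
    using open_vimage[OF assms(1), of "Pair x"] by (simp add: vimage_def continuous_intros)
  show "convex {y. (x, y) \<in> K}"
  proof (rule convexI)
    fix y z u v :: real assume "y \<in> {y. (x, y) \<in> K}" "z \<in> {y. (x, y) \<in> K}" "0 \<le> u" "0 \<le> v" "u + v = 1"
    moreover have "u * x + v * x = x" using \<open>u + v = 1\<close> by (metis distrib_right mult_1)
    ultimately show "u *\<^sub>R y + v *\<^sub>R z \<in> {y. (x, y) \<in> K}"
      using convexD[OF assms(2), of "(x, y)" "(x, z)" u v] by simp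
  qed
  have "{y. (x, y) \<in> K} \<subseteq> snd ` K" by force
  then show "bounded {y. (x, y) \<in> K}"
    using assms(3) bounded_snd bounded_subset by blast
qed (use assms in auto)

lemma section_length_pos:
  assumes "open K" "convex K" "bounded K" "(x, y) \<in> K"
  shows "0 < section_length K x"
  by (rule section_interval[OF assms]) (simp add: section_length_def)

text \<open>Brunn-Minkowski in dimension one: the section over a convex combination of abscissae
  contains the Minkowski combination of the two sections, and the lengths of intervals combine
  linearly.\<close>

lemma section_length_concave:
  fixes K :: "(real \<times> real) set"
  assumes K: "open K" "convex K" "bounded K" and S: "convex S" "\<And>x. x \<in> S \<Longrightarrow> \<exists>y. (x, y) \<in> K"
  shows "concave_on S (section_length K)"
  unfolding concave_on_iff
proof (intro conjI ballI allI impI S)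
  fix x x' u v :: real assume x: "x \<in> S" "x' \<in> S" and uv: "0 \<le> u" "0 \<le> v" "u + v = 1"
  obtain a b where ab: "a < b" "{y. (x, y) \<in> K} = {a<..<b}" using section_interval[OF K] S(2)[OF x(1)] by metis
  obtain a' b' where ab': "a' < b'" "{y. (x', y) \<in> K} = {a'<..<b'}" using section_interval[OF K] S(2)[OF x(2)] by metis
  have "u * x + v * x' \<in> S"
    using convexD[OF S(1) x uv] by simp
  then obtain c d where cd: "c < d" "{y. (u * x + v * x', y) \<in> K} = {c<..<d}" using section_interval[OF K] S(2) by metis
  have len: "0 < u * (b - a) + v * (b' - a')"
    using uv ab(1) ab'(1) by (metis add_nonneg_nonneg add_0 add_pos_nonneg add_nonneg_pos diff_gt_0_iff_gt less_eq_real_def mult_nonneg_nonneg mult_pos_pos zero_neq_one)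
  have "{u * a + v * a'<..<u * b + v * b'} \<subseteq> {c<..<d}"
  proof
    fix y assume y: "y \<in> {u * a + v * a'<..<u * b + v * b'}"
    \<comment> \<open>\<open>s\<close> is the relative position of \<open>y\<close> in the combined
      interval; the points at the same relative position in the two sections combine to
      \<open>y\<close>.\<close>
    define s where "s = (y - (u * a + v * a')) / (u * (b - a) + v * (b' - a'))"
    have s: "0 < s" "s < 1" using y len by (auto simp: s_def field_simps)
    have "s * (u * (b - a) + v * (b' - a')) = y - (u * a + v * a')"
      using len by (simp add: s_def)
    then have y_eq: "y = u * (a + s * (b - a)) + v * (a' + s * (b' - a'))"
      by (simp add: algebra_simps)
    have "s * (b - a) < 1 * (b - a)" "s * (b' - a') < 1 * (b' - a')"
      using s ab(1) ab'(1) by (intro mult_strict_right_mono; simp)+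
    moreover have "0 < s * (b - a)" "0 < s * (b' - a')" using s ab(1) ab'(1) by simp_all
    ultimately have "a + s * (b - a) \<in> {y. (x, y) \<in> K}" "a' + s * (b' - a') \<in> {y. (x', y) \<in> K}"
      unfolding ab ab' by auto
    then have "u *\<^sub>R (x, a + s * (b - a)) + v *\<^sub>R (x', a' + s * (b' - a')) \<in> K"
      using uv by (intro convexD[OF K(2)]) auto
    then have "y \<in> {y. (u * x + v * x', y) \<in> K}" unfolding y_eq by simp
    then show "y \<in> {c<..<d}" unfolding cd .
  qed
  then have "measure lborel {u * a + v * a'<..<u * b + v * b'} \<le> measure lborel {c<..<d}"
    by (intro measure_mono_fmeasurable fmeasurableI emeasure_bounded_finite) auto
  moreover have "u * a + v * a' \<le> u * b + v * b'" using len by (simp add: algebra_simps)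
  ultimately show "u * section_length K x + v * section_length K x' \<le> section_length K (u *\<^sub>R x + v *\<^sub>R x')"
    using ab(1) ab'(1) cd(1) by (simp add: section_length_def ab(2) ab'(2) cd(2) algebra_simps)
qed

lemma section_length_le:
  assumes "open K" "convex K" "bounded K" "K \<subseteq> cball 0 R" "(x, y) \<in> K"
  shows "section_length K x \<le> 2 * R"
proof -
  have "0 \<le> R" using assms(4,5) by (metis cball_empty empty_iff not_le subsetD)
  have "{y. (x, y) \<in> K} \<subseteq> {-R..R}"
  proof safe
    fix y assume "(x, y) \<in> K"
    then have "norm (x, y) \<le> R" using assms(4) by auto
    then have "\<bar>y\<bar> \<le> R" using norm_snd_le[of y x] by simp
    then show "y \<in> {-R..R}" by auto
  qed
  then have "measure lborel {y. (x, y) \<in> K} \<le> measure lborel {-R..R}"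
    using section_interval[OF assms(1,2,3,5)]
    by (intro measure_mono_fmeasurable fmeasurableI emeasure_bounded_finite; simp) (metis borel_open open_greaterThanLessThan)
  then show ?thesis using \<open>0 \<le> R\<close> by (simp add: section_length_def)
qed

text \<open>Fubini for a function of the abscissa. Empty sections have length 0, so any interval
  containing the projection of \<open>K\<close> will do.\<close>

lemma integral_fst_section_length:
  fixes K :: "(real \<times> real) set" and h :: "real \<Rightarrow> real"
  assumes K: "open K" "bounded K" and S: "\<And>x y. (x, y) \<in> K \<Longrightarrow> x \<in> {a<..<b}"
    and h: "continuous_on UNIV h"
  shows "(LBINT z:K. h (fst z)) = integral {a<..<b} (\<lambda>x. section_length K x * h x)"
proof -
  have int: "set_integrable lborel K (\<lambda>z. h (fst z))"
    by (intro set_integrable_bounded_continuous continuous_on_compose2[OF h] continuous_intros) (use K in auto)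
  then have int2: "integrable (lborel \<Otimes>\<^sub>M lborel) (\<lambda>z. indicator K z *\<^sub>R h (fst z))"
    unfolding set_integrable_def lborel_prod .
  have eq: "(LBINT y. indicator K (x, y) *\<^sub>R h (fst (x, y))) = indicator {a<..<b} x *\<^sub>R (section_length K x * h x)" for x
  proof -
    have "(LBINT y. indicator K (x, y) *\<^sub>R h (fst (x, y))) = (LBINT y. indicator {y. (x, y) \<in> K} y * h x)"
      by (intro Bochner_Integration.integral_cong) (auto simp: indicator_def)
    also have "\<dots> = section_length K x * h x"
      by (simp add: section_length_def)
    also have "\<dots> = indicator {a<..<b} x *\<^sub>R (section_length K x * h x)"
    proof (cases "x \<in> {a<..<b}")
      case False
      then have "{y. (x, y) \<in> K} = {}" using S by blast
      then show ?thesis by (simp add: section_length_def)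
    qed simp
    finally show ?thesis .
  qed
  have "(LBINT z:K. h (fst z)) = (LBINT x. LBINT y. indicator K (x, y) *\<^sub>R h (fst (x, y)))"
    unfolding set_lebesgue_integral_def
    by (subst lborel_prod[symmetric], subst lborel_pair.integral_fst'[OF int2]) simp
  also have "\<dots> = (LBINT x:{a<..<b}. section_length K x * h x)"
    unfolding eq set_lebesgue_integral_def ..
  also have "\<dots> = integral {a<..<b} (\<lambda>x. section_length K x * h x)"
  proof (rule set_borel_integral_eq_integral)
    show "set_integrable lborel {a<..<b} (\<lambda>x. section_length K x * h x)"
      using lborel_pair.integrable_fst'[OF int2] unfolding eq set_integrable_def .
  qed
  finally show ?thesis .
qed

section \<open>Comparison of a thin needle with an interval\<close>

lemma LINT_scaled_bound:
  fixes f :: "'a::euclidean_space \<Rightarrow> real"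
  assumes K: "open K" "bounded K" and f: "continuous_on UNIV f" and g: "continuous_on UNIV g"
    and le: "\<And>x. x \<in> K \<Longrightarrow> f x \<le> g x + e"
  shows "(LBINT x:K. f x) \<le> (LBINT x:K. g x) + e * (LBINT x:K. 1)"
proof -
  have i: "set_integrable lborel K f" "set_integrable lborel K g" "set_integrable lborel K (\<lambda>x. e * 1 :: real)"
    using K by (auto intro!: set_integrable_bounded_continuous f g continuous_intros)
  have "(LBINT x:K. f x) \<le> (LBINT x:K. g x + e * 1)"
    using le i by (intro set_integral_mono set_integral_add) auto
  also have "\<dots> = (LBINT x:K. g x) + (LBINT x:K. e * 1)"
    using i by (intro set_integral_add) auto
  also have "(LBINT x:K. e * 1) = e * (LBINT x:K. 1)" by (rule set_integral_mult_right)
  finally show ?thesis .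
qed

lemma LINT_one_pos:
  fixes K :: "'a::euclidean_space set"
  assumes "open K" "bounded K" "K \<noteq> {}"
  shows "0 < (LBINT x:K. (1::real))"
proof -
  have "measure lborel K \<noteq> 0"
    using open_not_negligible[OF assms(1,3)] assms
    by (simp add: negligible_iff_measure0 bounded_set_imp_lmeasurable)
  then have "0 < measure lborel K"
    by (simp add: zero_less_measure_iff)
  then show ?thesis
    by (simp add: set_lebesgue_integral_def)
qed

text \<open>
  The points \<open>p\<close> and \<open>q\<close> are a leftmost and a rightmost point; the last condition makes the
  slope of the line through them at most 1.
\<close>

definition needle :: "real \<Rightarrow> real \<Rightarrow> real \<Rightarrow> (real \<times> real) set \<Rightarrow> real \<times> real \<Rightarrow> real \<times> real \<Rightarrow> bool" where
  "needle R d r K p q \<longleftrightarrow> open K \<and> convex K \<and> K \<subseteq> cball 0 R \<and> (\<forall>x\<in>K. \<forall>y\<in>K. dist x y \<le> d) \<and>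
    (\<forall>m. \<not> ball m r \<subseteq> K) \<and> p \<in> closure K \<and> q \<in> closure K \<and> fst p < fst q \<and>
    (\<forall>c\<in>K. fst p < fst c) \<and> (\<forall>c\<in>K. fst c < fst q) \<and>
    (\<forall>a\<in>closure K. \<forall>b\<in>closure K. \<bar>snd a - snd b\<bar> \<le> fst q - fst p)"

text \<open>The radius \<open>r\<close> is obtained from \<open>d\<close>, \<open>e\<close> and the
  moduli of continuity of \<open>u\<close>, its square and the squared gradient on the ball of
  radius \<open>R\<close>. It does not depend on \<open>K\<close>, so it can be fixed before any
  needle is constructed.\<close>

lemma thin_needle_estimate:
  fixes u :: "real \<times> real \<Rightarrow> real" and Du :: "real \<times> real \<Rightarrow> real \<times> real"
  assumes u: "\<And>x. (u has_derivative (\<lambda>h. Du x \<bullet> h)) (at x)" and Du: "continuous_on UNIV Du"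
    and e: "0 < e"
  obtains r where "0 < r"
    "\<And>K p q. needle R d r K p q \<Longrightarrow> (LBINT x:K. u x) = 0 \<Longrightarrow>
      (LBINT x:K. (u x)^2) < (d / pi)^2 * (LBINT x:K. (norm (Du x))^2) + e * (LBINT x:K. 1)"
proof -
  have u_cont: "continuous_on UNIV u"
    by (intro continuous_at_imp_continuous_on ballI has_derivative_continuous[OF u])
  define C where "C = (d / pi)^2"
  have C: "0 \<le> C" by (simp add: C_def)
  \<comment> \<open>Three errors relative to the area will be collected: \<open>w\<close> from
    replacing \<open>u^2\<close>, \<open>C * w\<close> from replacing the squared gradient, and
    \<open>w^2\<close> from the mean of \<open>f\<close>. Both bounds on \<open>w\<close> together
    keep their sum below \<open>e\<close>.\<close>
  define w where "w = min 1 (e / (C + 3))"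
  have w: "0 < w" "w \<le> 1" "w * (C + 3) \<le> e"
  proof -
    have "w \<le> e / (C + 3)" by (simp add: w_def)
    then show "w * (C + 3) \<le> e" using C by (simp add: pos_le_divide_eq)
  qed (use e C in \<open>auto simp: w_def\<close>)
  have "w^2 \<le> w" using w by (simp add: power2_eq_square mult_left_le)
  moreover have "C * w + 3 * w \<le> e" using w(3) by (simp add: algebra_simps)
  ultimately have we: "w + C * w + w^2 < e" using w(1) by linarith
  have unif: "\<exists>r>0. \<forall>x\<in>cball 0 R. \<forall>y\<in>cball 0 R. dist x y < r \<longrightarrow> dist (g x) (g y) < w"
    if "continuous_on UNIV g" for g :: "real \<times> real \<Rightarrow> real"
  proof -
    have "uniformly_continuous_on (cball 0 R) g"
      by (intro compact_uniformly_continuous continuous_on_subset[OF that]) auto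
    then show ?thesis using w(1) by (fastforce simp: uniformly_continuous_on_def dist_commute)
  qed
  obtain r1 where r1: "r1 > 0" "\<And>x y. x \<in> cball 0 R \<Longrightarrow> y \<in> cball 0 R \<Longrightarrow> dist x y < r1 \<Longrightarrow> \<bar>u x - u y\<bar> < w"
    using unif[OF u_cont] unfolding dist_real_def by blast
  have u2_cont: "continuous_on UNIV (\<lambda>x. (u x)^2)" and Du2_cont: "continuous_on UNIV (\<lambda>x. (norm (Du x))^2)"
    by (intro continuous_intros u_cont Du)+
  obtain r2 where r2: "r2 > 0" "\<And>x y. x \<in> cball 0 R \<Longrightarrow> y \<in> cball 0 R \<Longrightarrow> dist x y < r2 \<Longrightarrow> \<bar>(u x)^2 - (u y)^2\<bar> < w"
    using unif[OF u2_cont] unfolding dist_real_def by blast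
  obtain r3 where r3: "r3 > 0" "\<And>x y. x \<in> cball 0 R \<Longrightarrow> y \<in> cball 0 R \<Longrightarrow> dist x y < r3 \<Longrightarrow> \<bar>(norm (Du x))^2 - (norm (Du y))^2\<bar> < w"
    using unif[OF Du2_cont] unfolding dist_real_def by blast
  \<comment> \<open>Division by 19 makes the deviation \<open>18 * r\<close> from the chord strictly
    smaller than each of the three moduli.\<close>
  define r where "r = min r1 (min r2 r3) / 19"
  have r: "0 < r" "18 * r < r1" "18 * r < r2" "18 * r < r3"
    using r1(1) r2(1) r3(1) by (auto simp: r_def min_def)
  show thesis
  proof (rule that[OF r(1)])
    fix K p q
    assume needle: "needle R d r K p q" and zero: "(LBINT x:K. u x) = 0"
    then have K: "open K" "convex K" "K \<subseteq> cball 0 R" and diam: "\<And>x y. x \<in> K \<Longrightarrow> y \<in> K \<Longrightarrow> dist x y \<le> d"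
      and no_ball: "\<And>m. \<not> ball m r \<subseteq> K" and pq: "p \<in> closure K" "q \<in> closure K" "fst p < fst q"
      and ends: "\<And>c. c \<in> K \<Longrightarrow> fst p < fst c \<and> fst c < fst q"
      and tall: "\<And>a b. a \<in> closure K \<Longrightarrow> b \<in> closure K \<Longrightarrow> \<bar>snd a - snd b\<bar> \<le> fst q - fst p"
      unfolding needle_def by blast+
    have bK: "bounded K" using K(3) bounded_subset bounded_cball by blast
    have clK: "closure K \<subseteq> cball 0 R" using K(3) by (intro closure_minimal) auto
    have neK: "K \<noteq> {}" using pq(1) by auto
    define L where "L = fst q - fst p"
    define s where "s = (snd q - snd p) / L"
    have L: "0 < L" using pq(3) by (simp add: L_def)
    have s: "\<bar>s\<bar> \<le> 1" "snd q = snd p + s * (fst q - fst p)"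
      using tall[OF pq(2,1)] L by (auto simp: s_def L_def[symmetric] abs_divide)
    \<comment> \<open>The left side is the squared length of the chord from \<open>p\<close> to
      \<open>q\<close>. Since the chord is parametrized by its abscissa, the factor
      \<open>1 + s^2\<close> comes back in \<open>f'_le\<close>; with the squared width
      \<open>L^2\<close> from the interval inequality it costs \<open>d^2\<close> and nothing
      more.\<close>
    have len: "L^2 * (1 + s^2) \<le> d^2"
    proof -
      have "dist p q \<le> d"
      proof (rule field_le_epsilon)
        fix t :: real assume t: "0 < t"
        obtain x y where "x \<in> K" "dist x p < t / 2" "y \<in> K" "dist y q < t / 2"
          using pq(1,2) t unfolding closure_approachable by (meson half_gt_zero)
        then show "dist p q \<le> d + t"
          using diam[of x y] dist_triangle[of p q x] dist_triangle[of x q y] by (auto simp: dist_commute)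
      qed
      have "L^2 * (1 + s^2) = (fst q - fst p)^2 + (snd q - snd p)^2"
        using L by (simp add: s_def L_def[symmetric] power_divide field_simps)
      also have "\<dots> = (dist p q)^2"
        by (simp add: dist_prod_def dist_real_def power2_commute)
      also have "\<dots> \<le> d^2" using \<open>dist p q \<le> d\<close> by (intro power_mono) auto
      finally show ?thesis .
    qed
    define l where "l x = (x, snd p + s * (x - fst p))" for x
    have l_in: "l x \<in> cball 0 R" if "x \<in> {fst p..fst q}" for x
    proof -
      define t where "t = (x - fst p) / L"
      have t: "0 \<le> t" "t \<le> 1" "t * L = x - fst p" using that L by (auto simp: t_def L_def)
      have "l x = (1 - t) *\<^sub>R p + t *\<^sub>R q"
      proof (rule prod_eqI)
        have "s * (x - fst p) = t * (snd q - snd p)"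
          unfolding t(3)[symmetric] using s(2) by (simp add: L_def)
        then show "snd (l x) = snd ((1 - t) *\<^sub>R p + t *\<^sub>R q)"
          by (simp add: l_def algebra_simps)
      qed (use t(3) in \<open>simp add: l_def L_def algebra_simps\<close>)
      also have "\<dots> \<in> closure K"
        using pq K t by (intro convexD_alt convex_closure) auto
      finally show ?thesis using clK by auto
    qed
    have near: "dist z (l (fst z)) \<le> 18 * r" if z: "z \<in> K" for z
    proof -
      have "\<bar>snd z - (snd p + s * (fst z - fst p))\<bar> \<le> 18 * r"
        using z ends[OF z] closure_subset[of K] pq tall[of z p]
        by (intro thin_if_no_ball[OF K(1,2) r(1) no_ball _ _ _ _ _ _ _ s(1,2)]) auto
      then show ?thesis
        by (cases z) (simp add: l_def dist_prod_def dist_real_def)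
    qed
    have in1: "z \<in> cball 0 R" and in2: "l (fst z) \<in> cball 0 R" if "z \<in> K" for z
      using that K(3) ends[OF that] l_in[of "fst z"] by auto
    have l_cont: "continuous_on UNIV l" unfolding l_def by (intro continuous_intros)
    have l_cont2: "continuous_on UNIV (\<lambda>z. l (fst z))" unfolding l_def by (intro continuous_intros)
    define f where "f x = u (l x)" for x
    define f' where "f' x = Du (l x) \<bullet> (1, s)" for x
    have f_cont: "continuous_on UNIV f" unfolding f_def
      by (intro continuous_on_compose2[OF u_cont] l_cont) auto
    have Dul_cont: "continuous_on UNIV (\<lambda>x. Du (l x))"
      by (intro continuous_on_compose2[OF Du] l_cont) auto
    have f'_cont: "continuous_on UNIV f'" unfolding f'_def
      by (intro continuous_intros Dul_cont)
    have f_deriv: "(f has_real_derivative f' x) (at x)" for x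
    proof -
      have "(l has_derivative (\<lambda>h. h *\<^sub>R (1, s))) (at x)"
        unfolding l_def by (auto intro!: derivative_eq_intros simp: algebra_simps)
      then have "((\<lambda>x. u (l x)) has_derivative (\<lambda>h. Du (l x) \<bullet> (h *\<^sub>R (1, s)))) (at x)"
        by (rule has_derivative_compose[OF _ u])
      then show ?thesis
        by (simp only: has_field_derivative_def f_def[abs_def] f'_def inner_scaleR_right mult_commute_abs)
    qed
    have f'_le: "(f' x)^2 \<le> (1 + s^2) * (norm (Du (l x)))^2" for x
    proof -
      have "(f' x)^2 \<le> (Du (l x) \<bullet> Du (l x)) * ((1, s) \<bullet> (1::real, s))"
        unfolding f'_def by (rule Cauchy_Schwarz_ineq)
      also have "(1, s) \<bullet> (1::real, s) = 1 + s^2" by (simp add: power2_eq_square)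
      finally show ?thesis by (simp only: power2_norm_eq_inner mult.commute)
    qed
    define S where "S = {fst p<..<fst q}"
    define V where "V = (LBINT x:K. (1::real))"
    have V: "0 < V" unfolding V_def using K bK neK by (intro LINT_one_pos)
    have K_in_S: "x \<in> S" if "(x, y) \<in> K" for x y using ends[OF that] by (auto simp: S_def)
    \<comment> \<open>\<open>p\<close> and \<open>q\<close> are only known to lie in the closure, so
      the abscissa \<open>x\<close> is enclosed between points of \<open>K\<close> close to them and
      reached on the segment that joins these points.\<close>
    have S_in_K: "\<exists>y. (x, y) \<in> K" if "x \<in> S" for x
    proof -
      have "\<exists>y\<in>K. dist y p < x - fst p"
        using closure_approachable[THEN iffD1, OF pq(1), rule_format, of "x - fst p"] that by (simp add: S_def)
      then obtain z1 where z1: "z1 \<in> K" "dist z1 p < x - fst p" by blast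
      have "\<exists>y\<in>K. dist y q < fst q - x"
        using closure_approachable[THEN iffD1, OF pq(2), rule_format, of "fst q - x"] that by (simp add: S_def)
      then obtain z2 where z2: "z2 \<in> K" "dist z2 q < fst q - x" by blast
      have lt: "fst z1 < x" "x < fst z2"
        using z1(2) z2(2) dist_fst_le[of z1 p] dist_fst_le[of z2 q] by (auto simp: dist_real_def)
      define t where "t = (x - fst z1) / (fst z2 - fst z1)"
      have t: "0 \<le> t" "t \<le> 1" "t * (fst z2 - fst z1) = x - fst z1" using lt by (auto simp: t_def)
      have "(1 - t) *\<^sub>R z1 + t *\<^sub>R z2 \<in> K"
        using z1 z2 t by (intro convexD_alt K) auto
      moreover have "fst ((1 - t) *\<^sub>R z1 + t *\<^sub>R z2) = x" using t(3) by (simp add: algebra_simps)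
      ultimately show ?thesis by (metis prod.collapse)
    qed
    have fubini: "integral S (\<lambda>x. section_length K x * g x) = (LBINT z:K. g (fst z))"
      if "continuous_on UNIV g" for g
      using integral_fst_section_length[OF K(1) bK _ that, of "fst p" "fst q"] K_in_S by (simp add: S_def)
    have pos: "0 < section_length K x" "section_length K x \<le> 2 * R" if "x \<in> S" for x
      using S_in_K[OF that] section_length_pos[OF K(1,2) bK] section_length_le[OF K(1,2) bK K(3)] by blast+
    have var: "integral S (\<lambda>x. section_length K x * (f x)^2) * integral S (section_length K) - (integral S (\<lambda>x. section_length K x * f x))^2
      \<le> ((fst q - fst p) / pi)^2 * (integral S (\<lambda>x. section_length K x * (f' x)^2) * integral S (section_length K))"
      unfolding S_def
    proof (rule weighted_variance_concave[OF pq(3) _ pos(1)[unfolded S_def] pos(2)[unfolded S_def]])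
      show "concave_on {fst p<..<fst q} (section_length K)"
        using S_in_K by (intro section_length_concave[OF K(1,2) bK]) (auto simp: S_def)
      show "continuous_on {fst p..fst q} f'" using f'_cont continuous_on_subset by blast
      show "(f has_real_derivative f' x) (at x within {fst p..fst q})" for x
        using f_deriv by (rule has_field_derivative_at_within)
    qed
    define A where "A = (LBINT z:K. (f (fst z))^2)"
    define I where "I = (LBINT z:K. f (fst z))"
    define B where "B = (LBINT z:K. (f' (fst z))^2)"
    define G where "G = (LBINT z:K. (norm (Du z))^2)"
    have var': "A * V - I^2 \<le> (L / pi)^2 * (B * V)"
      using var fubini[of "\<lambda>x. 1"] fubini[of f] fubini[of "\<lambda>x. (f x)^2"] fubini[of "\<lambda>x. (f' x)^2"] f_cont f'_cont
      by (simp add: A_def I_def B_def V_def L_def continuous_intros)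
    have cont: "continuous_on UNIV (\<lambda>z::real \<times> real. f (fst z))" "continuous_on UNIV (\<lambda>z::real \<times> real. f' (fst z))"
      "continuous_on UNIV (\<lambda>z::real \<times> real. Du (l (fst z)))"
      by (intro continuous_on_compose2[OF f_cont] continuous_on_compose2[OF f'_cont] continuous_on_compose2[OF Dul_cont] continuous_intros; simp)+
    have dist_l: "dist (l (fst z)) z \<le> 18 * r" if "z \<in> K" for z
      using near[OF that] by (simp only: dist_commute)
    have d1: "\<bar>f (fst z) - u z\<bar> < w" if "z \<in> K" for z
      unfolding f_def using dist_l[OF that] r(2) by (intro r1(2) in1 in2 that) linarith
    have d2: "\<bar>(f (fst z))^2 - (u z)^2\<bar> < w" if "z \<in> K" for z
      unfolding f_def using dist_l[OF that] r(3) by (intro r2(2) in1 in2 that) linarith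
    have d3: "\<bar>(norm (Du (l (fst z))))^2 - (norm (Du z))^2\<bar> < w" if "z \<in> K" for z
      using dist_l[OF that] r(4) by (intro r3(2) in1 in2 that) linarith
    have I1: "I \<le> (LBINT z:K. u z) + w * V" unfolding I_def V_def
    proof (intro LINT_scaled_bound K(1) bK cont u_cont)
      show "f (fst z) \<le> u z + w" if "z \<in> K" for z using d1[OF that] by linarith
    qed
    have I2: "(LBINT z:K. u z) \<le> I + w * V" unfolding I_def V_def
    proof (intro LINT_scaled_bound K(1) bK cont u_cont)
      show "u z \<le> f (fst z) + w" if "z \<in> K" for z using d1[OF that] by linarith
    qed
    \<comment> \<open>The restriction to the chord has lost the mean-zero property, but its integral
      is at most \<open>w\<close> times the area; this is where the variance form of the interval
      inequality pays off.\<close>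
    have I: "\<bar>I\<bar> \<le> w * V" using I1 I2 zero by linarith
    have A: "(LBINT z:K. (u z)^2) \<le> A + w * V" unfolding A_def V_def
    proof (intro LINT_scaled_bound K(1) bK cont u_cont continuous_intros)
      show "(u z)^2 \<le> (f (fst z))^2 + w" if "z \<in> K" for z using d2[OF that] by linarith
    qed
    have B: "B \<le> (1 + s^2) * (G + w * V)"
    proof -
      have "B \<le> (LBINT z:K. (1 + s^2) * (norm (Du (l (fst z))))^2) + 0 * (LBINT z:K. 1)"
        unfolding B_def using f'_le
        by (intro LINT_scaled_bound K(1) bK continuous_intros cont) auto
      also have "\<dots> = (1 + s^2) * (LBINT z:K. (norm (Du (l (fst z))))^2)" by simp
      also have "\<dots> \<le> (1 + s^2) * (G + w * V)"
      proof (rule mult_left_mono)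
        show "(LBINT z:K. (norm (Du (l (fst z))))^2) \<le> G + w * V"
          unfolding G_def V_def
        proof (intro LINT_scaled_bound K(1) bK continuous_intros cont Du)
          show "(norm (Du (l (fst z))))^2 \<le> (norm (Du z))^2 + w" if "z \<in> K" for z
            using d3[OF that] by linarith
        qed
      qed simp
      finally show ?thesis .
    qed
    have G: "0 \<le> G" unfolding G_def set_lebesgue_integral_def by (intro Bochner_Integration.integral_nonneg) simp
    have "A * V \<le> I^2 + (L / pi)^2 * (B * V)" using var' by simp
    also have "\<dots> \<le> (w * V)^2 + (L / pi)^2 * ((1 + s^2) * (G + w * V) * V)"
      using I B V by (intro add_mono mult_left_mono mult_right_mono) (auto simp: abs_le_square_iff[symmetric])
    also have "(L / pi)^2 * ((1 + s^2) * (G + w * V) * V) = (L^2 * (1 + s^2)) * ((G + w * V) * V / pi^2)"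
      by (simp add: power_divide)
    also have "\<dots> \<le> d^2 * ((G + w * V) * V / pi^2)"
      using len G w V by (intro mult_right_mono) auto
    also have "\<dots> = C * (G + w * V) * V" by (simp add: C_def power_divide)
    finally have "A * V \<le> (w^2 * V + C * (G + w * V)) * V" by (simp add: power2_eq_square algebra_simps)
    then have "A \<le> w^2 * V + C * (G + w * V)" using V by (rule mult_right_le_imp_le)
    then have "(LBINT z:K. (u z)^2) \<le> C * G + (w + C * w + w^2) * V"
      using A by (simp add: algebra_simps)
    also have "\<dots> < C * G + e * V" using we V by (intro add_strict_left_mono mult_strict_right_mono)
    finally show "(LBINT x:K. (u x)^2) < (d / pi)^2 * (LBINT x:K. (norm (Du x))^2) + e * (LBINT x:K. 1)"
      by (simp add: C_def G_def V_def)
  qed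
qed

section \<open>Exchange of the coordinates and the planar inequality\<close>

lemma bounded_linear_swap: "bounded_linear prod.swap"
  unfolding prod.swap_def[abs_def] by (intro bounded_linear_Pair bounded_linear_fst bounded_linear_snd)

lemma norm_swap: "norm (prod.swap x) = norm x"
  by (simp add: norm_prod_def add.commute)

lemma dist_swap: "dist (prod.swap x) (prod.swap y) = dist x y"
  by (simp add: dist_prod_def add.commute)

lemma lborel_distr_swap:
  "distr lborel lborel prod.swap = (lborel :: ('a::euclidean_space \<times> 'b::euclidean_space) measure)"
proof -
  have "distr (lborel \<Otimes>\<^sub>M lborel) (lborel \<Otimes>\<^sub>M lborel) (\<lambda>(x, y). (y, x)) = (lborel \<Otimes>\<^sub>M lborel :: ('a \<times> 'b) measure)"
    by (rule lborel_pair.distr_pair_swap[symmetric])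
  then show ?thesis
    by (simp add: lborel_prod prod.swap_def[abs_def] case_prod_beta')
qed

lemma LINT_swap:
  fixes f :: "'a::euclidean_space \<times> 'b::euclidean_space \<Rightarrow> real"
  assumes "K \<in> sets borel" "continuous_on UNIV f"
  shows "(LBINT x:prod.swap ` K. f (prod.swap x)) = (LBINT x:K. f x)"
proof -
  have [measurable]: "f \<in> borel_measurable borel" "K \<in> sets borel"
    using assms by (auto intro: borel_measurable_continuous_onI)
  have sw: "prod.swap \<in> measurable lborel lborel"
    by (simp add: borel_measurable_continuous_onI continuous_on_swap)
  have "(LBINT x:K. f x) = (LINT x|distr lborel lborel prod.swap. indicator K x *\<^sub>R f x)"
    unfolding set_lebesgue_integral_def lborel_distr_swap ..
  also have "\<dots> = (LBINT x. indicator K (prod.swap x) *\<^sub>R f (prod.swap x))"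
    by (rule integral_distr[OF sw]) simp
  also have "\<dots> = (LBINT x:prod.swap ` K. f (prod.swap x))"
    unfolding set_lebesgue_integral_def
    by (intro Bochner_Integration.integral_cong) (auto simp: indicator_def image_iff)
  finally show ?thesis ..
qed

lemma closure_swap_image:
  fixes K :: "('a::euclidean_space \<times> 'b::euclidean_space) set"
  shows "closure (prod.swap ` K) = prod.swap ` closure K"
  by (rule closure_injective_linear_image[symmetric])
    (simp_all add: bounded_linear.linear bounded_linear_swap)

theorem payne_weinberger_plane:
  fixes u :: "real \<times> real \<Rightarrow> real" and Du :: "real \<times> real \<Rightarrow> real \<times> real"
  assumes K: "open K" "convex K" "bounded K"
    and diam: "\<And>x y. x \<in> K \<Longrightarrow> y \<in> K \<Longrightarrow> dist x y \<le> d"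
    and u: "\<And>x. (u has_derivative (\<lambda>h. Du x \<bullet> h)) (at x)" and Du: "continuous_on UNIV Du"
    and zero: "(LBINT x:K. u x) = 0"
  shows "(LBINT x:K. (u x)^2) \<le> (d / pi)^2 * (LBINT x:K. (norm (Du x))^2)"
proof (rule ccontr)
  assume neg: "\<not> ?thesis"
  then have ne: "K \<noteq> {}" by (auto simp: set_lebesgue_integral_def)
  have u_cont: "continuous_on UNIV u"
    by (intro continuous_at_imp_continuous_on ballI has_derivative_continuous[OF u])
  define V where "V = (LBINT x:K. (1::real))"
  have V: "0 < V" unfolding V_def using K ne by (intro LINT_one_pos)
  \<comment> \<open>\<open>e\<close> is the mean excess of the counterexample, so the function
    \<open>w\<close> below has integral zero over \<open>K\<close>. Nonnegativity of this integral
    is what the bisections preserve.\<close>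
  define e where "e = ((LBINT x:K. (u x)^2) - (d / pi)^2 * (LBINT x:K. (norm (Du x))^2)) / V"
  have e: "0 < e" using neg V by (simp add: e_def)
  define w where "w x = (u x)^2 - (d / pi)^2 * (norm (Du x))^2 - e" for x
  have w_cont: "continuous_on UNIV w" unfolding w_def by (intro continuous_intros u_cont Du)
  have w_int: "(LBINT x:S. w x) = (LBINT x:S. (u x)^2) - (d / pi)^2 * (LBINT x:S. (norm (Du x))^2) - e * (LBINT x:S. 1)"
    if "open S" "bounded S" for S
  proof -
    have 1: "set_integrable lborel S (\<lambda>x. (u x)^2)" "set_integrable lborel S (\<lambda>x. (d / pi)^2 * (norm (Du x))^2)"
      "set_integrable lborel S (\<lambda>x. e * 1)"
      using that by (auto intro!: set_integrable_bounded_continuous continuous_intros u_cont Du)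
    have "(LBINT x:S. w x) = (LBINT x:S. (u x)^2 - (d / pi)^2 * (norm (Du x))^2 - e * 1)"
      by (simp add: w_def)
    also have "\<dots> = (LBINT x:S. (u x)^2) - (LBINT x:S. (d / pi)^2 * (norm (Du x))^2) - (LBINT x:S. e * 1)"
      using 1 by (simp only: set_integral_diff)
    also have "\<dots> = (LBINT x:S. (u x)^2) - (d / pi)^2 * (LBINT x:S. (norm (Du x))^2) - e * (LBINT x:S. 1)"
      by (simp only: set_integral_mult_right)
    finally show ?thesis .
  qed
  have w0: "0 \<le> (LBINT x:K. w x)"
    unfolding w_int[OF K(1,3)] using V by (simp add: e_def V_def)
  obtain R where R: "K \<subseteq> cball 0 R"
    using K(3) by (auto simp: bounded_iff subset_iff)
  obtain r1 where r1: "0 < r1"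
    "\<And>K p q. needle R d r1 K p q \<Longrightarrow> (LBINT x:K. u x) = 0 \<Longrightarrow>
      (LBINT x:K. (u x)^2) < (d / pi)^2 * (LBINT x:K. (norm (Du x))^2) + e * (LBINT x:K. 1)"
    using thin_needle_estimate[OF u Du e, of R d] by blast
  \<comment> \<open>The final piece may be elongated in either coordinate direction, and this is
    known only after the radius has been fixed. The estimate is therefore prepared for the reflected
    function as well, and the smaller of the two radii is used.\<close>
  define u' where "u' x = u (prod.swap x)" for x
  define Du' where "Du' x = prod.swap (Du (prod.swap x))" for x
  have u': "(u' has_derivative (\<lambda>h. Du' x \<bullet> h)) (at x)" for x
  proof -
    have "(prod.swap has_derivative prod.swap) (at x)"
      by (rule bounded_linear_imp_has_derivative) (rule bounded_linear_swap)
    then have "((\<lambda>x. u (prod.swap x)) has_derivative (\<lambda>h. Du (prod.swap x) \<bullet> prod.swap h)) (at x)"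
      by (rule has_derivative_compose[OF _ u])
    moreover have "Du (prod.swap x) \<bullet> prod.swap h = Du' x \<bullet> h" for h
      by (simp add: Du'_def inner_prod_def)
    ultimately show ?thesis unfolding u'_def by simp
  qed
  have Du': "continuous_on UNIV Du'"
    unfolding Du'_def by (intro continuous_on_swap continuous_on_compose2[OF continuous_on_swap] continuous_on_compose2[OF Du]) auto
  obtain r2 where r2: "0 < r2"
    "\<And>K p q. needle R d r2 K p q \<Longrightarrow> (LBINT x:K. u' x) = 0 \<Longrightarrow>
      (LBINT x:K. (u' x)^2) < (d / pi)^2 * (LBINT x:K. (norm (Du' x))^2) + e * (LBINT x:K. 1)"
    using thin_needle_estimate[OF u' Du' e, of R d] by blast
  define r where "r = min r1 r2"
  have r: "0 < r" "r \<le> r1" "r \<le> r2" using r1(1) r2(1) by (auto simp: r_def)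
  \<comment> \<open>A ball of radius \<open>r\<close> inside the final piece would have its centre
    in \<open>cball 0 R\<close>, hence would contain a point of this net.\<close>
  obtain P :: "(real \<times> real) set" where P: "finite P" "cball 0 R \<subseteq> (\<Union>p\<in>P. ball p r)"
    using compact_eq_totally_bounded[THEN iffD1, OF compact_cball[of 0 R]] r(1) by blast
  obtain L where L: "L \<subseteq> K" "open L" "convex L" "L \<noteq> {}" "L \<inter> P = {}"
    "(LBINT x:L. u x) = 0" "0 \<le> (LBINT x:L. w x)"
    using avoid_finite_set[OF P(1) u_cont w_cont K(1,2,3) ne zero w0] by blast
  have bL: "bounded L" using L(1) K(3) bounded_subset by blast
  have LR: "L \<subseteq> cball 0 R" using L(1) R by blast
  have no_ball: "\<not> ball m r \<subseteq> L" for m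
  proof
    assume m: "ball m r \<subseteq> L"
    moreover have "m \<in> ball m r" using r(1) by simp
    ultimately have "m \<in> cball 0 R" using LR by blast
    then obtain p where "p \<in> P" "dist p m < r" using P(2) by auto
    then have "p \<in> L" using m by (auto simp: dist_commute)
    then show False using \<open>p \<in> P\<close> L(5) by blast
  qed
  have no_ball1: "\<not> ball m r1 \<subseteq> L" and no_ball2: "\<not> ball m r2 \<subseteq> L" for m
    using no_ball[of m] subset_ball[OF r(2), of m] subset_ball[OF r(3), of m] by blast+
  have cl: "compact (closure L)" "closure L \<noteq> {}" using bL L(4) by auto
  \<comment> \<open>The sign of the integral of \<open>w\<close> that survived the bisections,
    rewritten as the exact opposite of the strict needle estimate.\<close>
  have large: "e * (LBINT x:L. 1) + (d / pi)^2 * (LBINT x:L. (norm (Du x))^2) \<le> (LBINT x:L. (u x)^2)"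
    using L(7) w_int[OF L(2) bL] by simp
  obtain p where p: "p \<in> closure L" "\<And>x. x \<in> closure L \<Longrightarrow> fst p \<le> fst x"
    using continuous_attains_inf[OF cl, of fst] continuous_on_fst continuous_on_id by blast
  obtain q where q: "q \<in> closure L" "\<And>x. x \<in> closure L \<Longrightarrow> fst x \<le> fst q"
    using continuous_attains_sup[OF cl, of fst] continuous_on_fst continuous_on_id by blast
  obtain p' where p': "p' \<in> closure L" "\<And>x. x \<in> closure L \<Longrightarrow> snd p' \<le> snd x"
    using continuous_attains_inf[OF cl, of snd] continuous_on_snd continuous_on_id by blast
  obtain q' where q': "q' \<in> closure L" "\<And>x. x \<in> closure L \<Longrightarrow> snd x \<le> snd q'"
    using continuous_attains_sup[OF cl, of snd] continuous_on_snd continuous_on_id by blast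
  have strict: "fst p < fst c" "fst c < fst q" "snd p' < snd c" "snd c < snd q'" if c: "c \<in> L" for c
  proof -
    obtain t where t: "0 < t" "ball c t \<subseteq> L" using L(2) c openE by blast
    have in_cl: "c + h \<in> closure L" if "norm h < t" for h
      using that t(2) closure_subset[of L] by (intro subsetD[OF order_trans[OF t(2)], of "closure L"]) (auto simp: dist_norm)
    note * = in_cl[of "(t / 2, 0)"] in_cl[of "(- t / 2, 0)"] in_cl[of "(0, t / 2)"] in_cl[of "(0, - t / 2)"]
    show "fst p < fst c" "fst c < fst q" "snd p' < snd c" "snd c < snd q'"
      using p(2)[OF *(2)] q(2)[OF *(1)] p'(2)[OF *(4)] q'(2)[OF *(3)] t(1) by (simp_all add: norm_Pair)
  qed
  have diamL: "dist x y \<le> d" if "x \<in> L" "y \<in> L" for x y using that diam L(1) by blast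
  obtain c where c: "c \<in> L" using L(4) by blast
  show False
  proof (cases "snd q' - snd p' \<le> fst q - fst p")
    case True
    have tall: "\<bar>snd a - snd b\<bar> \<le> fst q - fst p" if "a \<in> closure L" "b \<in> closure L" for a b
      using that p'(2)[of a] p'(2)[of b] q'(2)[of a] q'(2)[of b] True by (auto simp: abs_le_iff)
    have "(LBINT x:L. (u x)^2) < (d / pi)^2 * (LBINT x:L. (norm (Du x))^2) + e * (LBINT x:L. 1)"
    proof (rule r1(2)[OF _ L(6)])
      show "needle R d r1 L p q"
        unfolding needle_def
        by (intro conjI ballI allI L(2,3) LR diamL no_ball1 p(1) q(1) strict(1,2) tall
            less_trans[OF strict(1)[OF c] strict(2)[OF c]])
    qed
    then show False using large by simp
  next
    case False
    \<comment> \<open>The piece is taller than wide; after the swap its lowest point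
      \<open>p'\<close> and highest point \<open>q'\<close> become the leftmost and the rightmost
      one.\<close>
    let ?L = "prod.swap ` L"
    have tall: "\<bar>snd a - snd b\<bar> \<le> fst (prod.swap q') - fst (prod.swap p')" if "a \<in> closure ?L" "b \<in> closure ?L" for a b
      using that p(2)[of "prod.swap a"] p(2)[of "prod.swap b"] q(2)[of "prod.swap a"] q(2)[of "prod.swap b"] False
      by (auto simp: abs_le_iff closure_swap_image)
    have u'_int: "(LBINT x:?L. h (u' x)) = (LBINT x:L. h (u x))" if "continuous_on UNIV h" for h :: "real \<Rightarrow> real"
      unfolding u'_def using L(2) that
      by (intro LINT_swap[of L "\<lambda>x. h (u x)"] continuous_on_compose2[OF that u_cont]) auto
    have norm_Du': "norm (Du' x) = norm (Du (prod.swap x))" for x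
      by (simp add: Du'_def norm_prod_def add.commute)
    have "(LBINT x:?L. (u' x)^2) < (d / pi)^2 * (LBINT x:?L. (norm (Du' x))^2) + e * (LBINT x:?L. 1)"
    proof (rule r2(2))
      show "needle R d r2 ?L (prod.swap p') (prod.swap q')"
        unfolding needle_def
      proof (intro conjI ballI allI)
        show "open ?L" by (rule open_surjective_linear_image) (simp_all add: L bounded_linear.linear bounded_linear_swap)
        show "convex ?L" by (rule convex_linear_image) (simp_all add: L bounded_linear.linear bounded_linear_swap)
        show "?L \<subseteq> cball 0 R" using LR by (force simp: norm_swap simp del: swap_simp)
        show "dist x y \<le> d" if "x \<in> ?L" "y \<in> ?L" for x y
          using that diamL by (auto simp: dist_swap simp del: swap_simp)
        show "\<not> ball m r2 \<subseteq> ?L" for m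
        proof
          assume "ball m r2 \<subseteq> ?L"
          have "ball (prod.swap m) r2 \<subseteq> L"
          proof
            fix z assume "z \<in> ball (prod.swap m) r2"
            then have "prod.swap z \<in> ball m r2" using dist_swap[of m "prod.swap z"] by simp
            then have "prod.swap z \<in> ?L" using \<open>ball m r2 \<subseteq> ?L\<close> by blast
            then show "z \<in> L" by (simp add: inj_image_mem_iff)
          qed
          then show False using no_ball2 by blast
        qed
        show "prod.swap p' \<in> closure ?L" "prod.swap q' \<in> closure ?L"
          using p'(1) q'(1) by (auto simp: closure_swap_image)
        show "fst (prod.swap p') < fst (prod.swap q')" using strict[OF c] by simp
        show "fst (prod.swap p') < fst c" "fst c < fst (prod.swap q')" if "c \<in> ?L" for c
          using that strict by auto
        show "\<bar>snd a - snd b\<bar> \<le> fst (prod.swap q') - fst (prod.swap p')" if "a \<in> closure ?L" "b \<in> closure ?L" for a b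
          by (rule tall[OF that])
      qed
      show "(LBINT x:?L. u' x) = 0" using u'_int[of "\<lambda>x. x"] L(6) by simp
    qed
    also have "(LBINT x:?L. (norm (Du' x))^2) = (LBINT x:L. (norm (Du x))^2)"
      unfolding norm_Du' using L(2)
      by (intro LINT_swap[of L "\<lambda>x. (norm (Du x))^2"] continuous_intros Du) auto
    also have "(LBINT x:?L. 1) = (LBINT x:L. (1::real))"
      using L(2) by (intro LINT_swap[of L "\<lambda>x. 1"]) auto
    finally show False using large u'_int[of "\<lambda>x. x^2"] by (simp add: continuous_intros)
  qed
qed

section \<open>Smooth approximation of weakly differentiable functions\<close>

definition flat :: "real poly \<Rightarrow> real \<Rightarrow> real" where
  "flat P t = (if t \<le> 0 then 0 else poly P (1 / t) * exp (- (1 / t)))"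

lemma poly_times_exp_minus_tendsto_0: "((\<lambda>x. poly P x * exp (- x)) \<longlongrightarrow> 0) (at_top :: real filter)"
proof -
  have "((\<lambda>x. \<Sum>i\<le>degree P. coeff P i * (x ^ i / exp x)) \<longlongrightarrow> (\<Sum>i\<le>degree P. coeff P i * 0)) (at_top :: real filter)"
    by (intro tendsto_sum tendsto_mult tendsto_const tendsto_power_div_exp_0)
  moreover have "(\<lambda>x. \<Sum>i\<le>degree P. coeff P i * (x ^ i / exp x)) = (\<lambda>x::real. poly P x * exp (- x))"
    unfolding poly_altdef sum_distrib_right fun_eq_iff
    by (intro allI sum.cong) (simp_all add: exp_minus divide_inverse)
  ultimately show ?thesis by simp
qed

text \<open>For positive \<open>t\<close>, the chain rule brings out \<open>1 / t^2\<close> times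
  \<open>P - pderiv P\<close>, evaluated at \<open>1 / t\<close>; this is the polynomial on the
  right. Being closed under differentiation, the family reduces smoothness of every order to this
  single derivative.\<close>

lemma flat_has_derivative:
  "(flat P has_real_derivative flat ([:0, 0, 1:] * (P - pderiv P)) t) (at t)"
proof -
  consider "t < 0" | "t = 0" | "t > 0" by linarith
  then show ?thesis
  proof cases
    case 1
    have "eventually (\<lambda>x. x \<in> {..<0}) (nhds t)"
      using 1 by (intro eventually_nhds_in_open) auto
    then have "eventually (\<lambda>x. flat P x = 0) (nhds t)"
      by eventually_elim (simp add: flat_def)
    then have "(flat P has_real_derivative 0) (at t)"
      by (subst DERIV_cong_ev[where g="\<lambda>_. 0"]) auto
    then show ?thesis using 1 by (simp add: flat_def)
  next
    case 2
    \<comment> \<open>With \<open>x = 1 / h\<close> the difference quotient at 0 from the right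
      becomes \<open>x * poly P x * exp (- x)\<close>, whence \<open>pCons 0 P\<close>; from the
      left it vanishes.\<close>
    have "((\<lambda>h. flat P h / h) \<longlongrightarrow> 0) (at_right 0)"
    proof (subst filterlim_at_right_to_top)
      have "eventually (\<lambda>x::real. poly (pCons 0 P) x * exp (- x) = flat P (inverse x) / inverse x) at_top"
        using eventually_gt_at_top[of 0] by eventually_elim (simp add: flat_def divide_inverse mult_ac)
      then show "((\<lambda>x. flat P (inverse x) / inverse x) \<longlongrightarrow> 0) at_top"
        by (rule Lim_transform_eventually[OF poly_times_exp_minus_tendsto_0])
    qed
    moreover have "((\<lambda>h. flat P h / h) \<longlongrightarrow> 0) (at_left 0)"
      by (rule tendsto_eventually) (auto simp: eventually_at_filter flat_def)
    ultimately have "((\<lambda>h. flat P h / h) \<longlongrightarrow> 0) (at 0)"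
      by (simp add: filterlim_at_split)
    then show ?thesis using 2 by (simp add: has_field_derivative_iff flat_def)
  next
    case 3
    have "((\<lambda>t. poly P (1 / t) * exp (- (1 / t))) has_real_derivative
      poly P (1 / t) * (exp (- (1 / t)) * (1 / t^2)) + (poly (pderiv P) (1 / t) * (- (1 / t^2))) * exp (- (1 / t))) (at t)"
    proof -
      have inv: "((\<lambda>t. 1 / t) has_real_derivative - (1 / t^2)) (at t)"
        using 3 by (auto intro!: derivative_eq_intros simp: power2_eq_square)
      have 1: "((\<lambda>t. poly P (1 / t)) has_real_derivative poly (pderiv P) (1 / t) * - (1 / t^2)) (at t)"
        by (rule DERIV_chain2[OF poly_DERIV inv])
      have 2: "((\<lambda>t. exp (- (1 / t))) has_real_derivative exp (- (1 / t)) * (1 / t^2)) (at t)"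
        using DERIV_chain2[OF DERIV_exp DERIV_minus[OF inv]] by simp
      show ?thesis by (rule DERIV_cong[OF DERIV_mult[OF 1 2]]) simp
    qed
    also have "poly P (1 / t) * (exp (- (1 / t)) * (1 / t^2)) + (poly (pderiv P) (1 / t) * (- (1 / t^2))) * exp (- (1 / t))
      = flat ([:0, 0, 1:] * (P - pderiv P)) t"
      using 3 by (simp add: flat_def power2_eq_square divide_inverse algebra_simps)
    finally have D: "((\<lambda>t. poly P (1 / t) * exp (- (1 / t))) has_real_derivative flat ([:0, 0, 1:] * (P - pderiv P)) t) (at t)" .
    have "eventually (\<lambda>x. x \<in> {0<..}) (nhds t)"
      using 3 by (intro eventually_nhds_in_open) auto
    then have "eventually (\<lambda>x. flat P x = poly P (1 / x) * exp (- (1 / x))) (nhds t)"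
      by eventually_elim (simp add: flat_def)
    then show ?thesis
      using D by (subst DERIV_cong_ev[OF refl _ refl]) auto
  qed
qed

text \<open>A class of functions that contains the bump functions and is closed under directional derivatives.\<close>

inductive bump_algebra :: "'a::euclidean_space \<Rightarrow> real \<Rightarrow> ('a \<Rightarrow> real) \<Rightarrow> bool" for z e where
  bump_algebra_flat: "bump_algebra z e (\<lambda>x. flat P (e - (norm (x - z))^2))"
| bump_algebra_const: "bump_algebra z e (\<lambda>x. c)"
| bump_algebra_inner: "bump_algebra z e (\<lambda>x. x \<bullet> v)"
| bump_algebra_add: "bump_algebra z e f \<Longrightarrow> bump_algebra z e g \<Longrightarrow> bump_algebra z e (\<lambda>x. f x + g x)"
| bump_algebra_mult: "bump_algebra z e f \<Longrightarrow> bump_algebra z e g \<Longrightarrow> bump_algebra z e (\<lambda>x. f x * g x)"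

lemma flat_ball_has_derivative:
  fixes x z :: "'a::euclidean_space"
  shows "((\<lambda>x. flat P (e - (norm (x - z))^2)) has_derivative
    (\<lambda>h. flat ([:0, 0, 1:] * (P - pderiv P)) (e - (norm (x - z))^2) * (- 2 * ((x - z) \<bullet> h)))) (at x)"
proof -
  have 1: "((\<lambda>x. e - (norm (x - z))^2) has_derivative (\<lambda>h. - 2 * ((x - z) \<bullet> h))) (at x)"
    unfolding power2_norm_eq_inner by (auto intro!: derivative_eq_intros simp: inner_commute)
  show ?thesis
    using has_derivative_compose[OF 1 flat_has_derivative[of P, unfolded has_field_derivative_def]] by simp
qed

lemma bump_algebra_derivative:
  assumes "bump_algebra z e f"
  shows "\<exists>f'. (\<forall>x. (f has_derivative f' x) (at x)) \<and> (\<forall>v. bump_algebra z e (\<lambda>x. f' x v))"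
  using assms
proof induction
  case (bump_algebra_flat P)
  have "bump_algebra z e (\<lambda>x. flat ([:0, 0, 1:] * (P - pderiv P)) (e - (norm (x - z))^2) * ((- 2) * (x \<bullet> v + (- (z \<bullet> v)))))" for v
    by (intro bump_algebra.intros)
  then show ?case
    using flat_ball_has_derivative[of P e z]
    by (intro exI[of _ "\<lambda>x v. flat ([:0, 0, 1:] * (P - pderiv P)) (e - (norm (x - z))^2) * (- 2 * ((x - z) \<bullet> v))"])
      (auto simp: inner_diff_left)
next
  case (bump_algebra_const c)
  then show ?case by (intro exI[of _ "\<lambda>x v. 0"]) (auto intro: bump_algebra.intros)
next
  case (bump_algebra_inner v)
  then show ?case
    by (intro exI[of _ "\<lambda>x h. h \<bullet> v"]) (auto intro!: bump_algebra.intros derivative_eq_intros)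
next
  case (bump_algebra_add f g)
  then obtain f' g' where "\<And>x. (f has_derivative f' x) (at x)" "\<And>v. bump_algebra z e (\<lambda>x. f' x v)"
    "\<And>x. (g has_derivative g' x) (at x)" "\<And>v. bump_algebra z e (\<lambda>x. g' x v)" by blast
  then show ?case
    by (intro exI[of _ "\<lambda>x h. f' x h + g' x h"]) (auto intro!: bump_algebra.intros has_derivative_add)
next
  case (bump_algebra_mult f g)
  then obtain f' g' where "\<And>x. (f has_derivative f' x) (at x)" "\<And>v. bump_algebra z e (\<lambda>x. f' x v)"
    "\<And>x. (g has_derivative g' x) (at x)" "\<And>v. bump_algebra z e (\<lambda>x. g' x v)" by blast
  with bump_algebra_mult.hyps show ?case
    by (intro exI[of _ "\<lambda>x h. f x * g' x h + f' x h * g x"]) (auto intro!: bump_algebra.intros has_derivative_mult)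
qed

lemma bump_algebra_C_k:
  assumes "bump_algebra z e f"
  shows "C_k n f"
  using assms
proof (induction n arbitrary: f)
  case 0
  then obtain f' where "\<And>x. (f has_derivative f' x) (at x)" using bump_algebra_derivative by blast
  then show ?case
    by (auto intro!: continuous_at_imp_continuous_on has_derivative_continuous)
next
  case (Suc n)
  then obtain f' where f': "\<And>x. (f has_derivative f' x) (at x)" "\<And>v. bump_algebra z e (\<lambda>x. f' x v)"
    using bump_algebra_derivative by blast
  then have "frechet_derivative f (at x) = f' x" for x
    using frechet_derivative_at by metis
  moreover have "f differentiable_on UNIV"
    using f'(1) by (auto simp: differentiable_on_def differentiable_def)
  ultimately show ?case using Suc.IH f'(2) by simp
qed

lemma continuous_compact_support_bounded:
  fixes f :: "'a::euclidean_space \<Rightarrow> 'b::real_normed_vector"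
  assumes f: "continuous_on UNIV f" and 0: "\<And>x. r < norm x \<Longrightarrow> f x = 0"
  obtains B where "0 \<le> B" "\<And>x. norm (f x) \<le> B"
proof -
  have "compact (f ` cball 0 r)"
    by (intro compact_continuous_image continuous_on_subset[OF f]) auto
  then obtain B where B: "\<forall>y\<in>f ` cball 0 r. norm y \<le> B"
    by (auto dest!: compact_imp_bounded simp: bounded_iff)
  have "norm (f x) \<le> max 0 B" for x
    using B 0[of x] by (cases "norm x \<le> r") (auto simp: le_max_iff_disj)
  then show thesis by (intro that[of "max 0 B"]) auto
qed

lemma continuous_compact_support_uniformly_continuous:
  fixes f :: "'a::euclidean_space \<Rightarrow> 'b::real_normed_vector"
  assumes f: "continuous_on UNIV f" and 0: "\<And>x. r < norm x \<Longrightarrow> f x = 0"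
  shows "uniformly_continuous_on UNIV f"
  unfolding uniformly_continuous_on_def
proof safe
  fix e :: real assume e: "0 < e"
  have "uniformly_continuous_on (cball 0 (r + 1)) f"
    by (intro compact_uniformly_continuous continuous_on_subset[OF f]) auto
  then obtain d where d: "d > 0" "\<And>x y. x \<in> cball 0 (r + 1) \<Longrightarrow> y \<in> cball 0 (r + 1) \<Longrightarrow> dist y x < d \<Longrightarrow> dist (f y) (f x) < e"
    using e unfolding uniformly_continuous_on_def by metis
  show "\<exists>d>0. \<forall>x\<in>UNIV. \<forall>y\<in>UNIV. dist y x < d \<longrightarrow> dist (f y) (f x) < e"
  proof (intro exI[of _ "min d 1"] conjI ballI impI)
    fix x y :: 'a assume xy: "dist y x < min d 1"
    show "dist (f y) (f x) < e"
    proof (cases "norm x \<le> r \<or> norm y \<le> r")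
      case True
      have "norm y \<le> norm x + dist y x" "norm x \<le> norm y + dist y x"
        using norm_triangle_sub[of y x] norm_triangle_sub[of x y] by (auto simp: dist_norm norm_minus_commute)
      with True xy have "x \<in> cball 0 (r + 1)" "y \<in> cball 0 (r + 1)" by auto
      then show ?thesis using d(2) xy by simp
    next
      case False
      then show ?thesis using 0[of x] 0[of y] e by simp
    qed
  qed (use d(1) in simp)
qed

lemma integrable_continuous_compact_support:
  fixes f :: "'a::euclidean_space \<Rightarrow> 'b::euclidean_space"
  assumes f: "continuous_on UNIV f" and 0: "\<And>x. r < norm x \<Longrightarrow> f x = 0"
  shows "integrable lborel f"
proof -
  have "integrable lborel (\<lambda>x. indicator (cball 0 r) x *\<^sub>R f x)"
    by (intro borel_integrable_compact continuous_on_subset[OF f]) auto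
  moreover have "(\<lambda>x. indicator (cball 0 r) x *\<^sub>R f x) = f"
    using 0 by (auto simp: fun_eq_iff indicator_def)
  ultimately show ?thesis by simp
qed

text \<open>The last property connects mollification with weak gradients: the reflected translate of
  the kernel is itself a test function as soon as its window fits into \<open>\<Omega>\<close>, so
  the defining identity of the weak gradient applies to it.\<close>

lemma mollifier_exists:
  fixes e :: real
  assumes e: "0 < e"
  obtains \<kappa> :: "'a::euclidean_space \<Rightarrow> real" and D\<kappa> :: "'a \<Rightarrow> 'a" where
    "\<And>x. 0 \<le> \<kappa> x" "\<And>x. e \<le> norm x \<Longrightarrow> \<kappa> x = 0" "\<And>x. e \<le> norm x \<Longrightarrow> D\<kappa> x = 0"
    "integrable lborel \<kappa>" "(LBINT x. \<kappa> x) = 1"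
    "\<And>x. (\<kappa> has_derivative (\<lambda>h. D\<kappa> x \<bullet> h)) (at x)" "continuous_on UNIV D\<kappa>"
    "\<And>z \<Omega>. cball z e \<subseteq> \<Omega> \<Longrightarrow> (\<lambda>y. \<kappa> (z - y)) \<in> test_functions \<Omega>"
proof -
  define k where "k x = flat 1 (e^2 - (norm (x - 0))^2)" for x :: 'a
  define Q where "Q = [:0, 0, 1:] * ((1::real poly) - pderiv 1)"
  have kd: "(k has_derivative (\<lambda>h. flat Q (e^2 - (norm (x - 0))^2) * (- 2 * ((x - 0) \<bullet> h)))) (at x)" for x
    unfolding k_def Q_def by (rule flat_ball_has_derivative)
  have k_cont: "continuous_on UNIV k"
    by (intro continuous_at_imp_continuous_on ballI has_derivative_continuous[OF kd])
  have k0: "k x = 0" if "e \<le> norm x" for x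
    using that e power_mono[OF that, of 2] by (simp add: k_def flat_def)
  have k_pos: "0 < k x" if "norm x < e" for x
    using that e power_strict_mono[OF that, of 2] by (simp add: k_def flat_def)
  have k_nonneg: "0 \<le> k x" for x using k0[of x] k_pos[of x] by (cases "norm x < e") auto
  have k_int: "integrable lborel k"
    by (rule integrable_continuous_compact_support[OF k_cont, of e]) (use k0 in auto)
  define Z where "Z = (LBINT x. k x)"
  have "Z \<noteq> 0"
  proof
    assume "Z = 0"
    then have "AE x in lborel. k x = 0"
      using integral_nonneg_eq_0_iff_AE[OF k_int] k_nonneg by (simp add: Z_def)
    then have "AE x in lborel. x \<notin> ball (0::'a) e"
      by (rule eventually_mono) (use k_pos in force)
    then have "ball (0::'a) e \<in> null_sets lborel"
      by (simp add: AE_iff_null_sets)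
    then have "negligible (ball (0::'a) e)"
      by (simp add: negligible_iff_null_sets null_sets_completionI)
    then show False using open_not_negligible[of "ball (0::'a) e"] e by simp
  qed
  then have Z: "0 < Z" using k_nonneg by (simp add: Z_def less_le integral_nonneg)
  show thesis
  proof (rule that[of "\<lambda>x. k x / Z" "\<lambda>x. (- 2 * flat Q (e^2 - (norm x)^2) / Z) *\<^sub>R x"])
    show "((\<lambda>x. k x / Z) has_derivative (\<lambda>h. ((- 2 * flat Q (e^2 - (norm x)^2) / Z) *\<^sub>R x) \<bullet> h)) (at x)" for x
      using has_derivative_divide'[OF kd[of x] has_derivative_const[of Z] ] Z
      by (auto intro!: derivative_eq_intros kd simp: field_simps)
    have "continuous_on UNIV (\<lambda>x::'a. flat Q (e^2 - (norm (x - 0))^2))"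
      by (intro continuous_at_imp_continuous_on ballI has_derivative_continuous[OF flat_ball_has_derivative])
    then show "continuous_on UNIV (\<lambda>x::'a. (- 2 * flat Q (e^2 - (norm x)^2) / Z) *\<^sub>R x)"
      using Z by (intro continuous_intros) auto
    show "(- 2 * flat Q (e^2 - (norm x)^2) / Z) *\<^sub>R x = 0" if "e \<le> norm x" for x :: 'a
      using that e power_mono[OF that, of 2] by (simp add: flat_def)
    show "(LBINT x. k x / Z) = 1" using Z by (simp add: Z_def)
    show "(\<lambda>y. k (z - y) / Z) \<in> test_functions \<Omega>" if "cball z e \<subseteq> \<Omega>" for z \<Omega>
    proof -
      have "bump_algebra z (e^2) (\<lambda>y. flat 1 (e^2 - (norm (y - z))^2) * (1 / Z))"
        by (intro bump_algebra.intros)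
      then have "C_k n (\<lambda>y. k (z - y) / Z)" for n
        using bump_algebra_C_k by (force simp: k_def norm_minus_commute)
      moreover have "{y. k (z - y) / Z \<noteq> 0} \<subseteq> cball z e"
        using k0 by (force simp: dist_norm)
      then have "closure {y. k (z - y) / Z \<noteq> 0} \<subseteq> cball z e"
        by (intro closure_minimal) auto
      moreover from this have "compact (closure {y. k (z - y) / Z \<noteq> 0})"
        by (metis bounded_cball bounded_subset closed_closure compact_eq_bounded_closed)
      ultimately show ?thesis using that by (auto simp: test_functions_def)
    qed
  qed (use k0 k_nonneg Z k_int in auto)
qed

section \<open>Inequalities for square-integrable functions\<close>

lemma integrable_mult_L2:
  fixes f g :: "'a \<Rightarrow> real"
  assumes [measurable]: "f \<in> borel_measurable M" "g \<in> borel_measurable M"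
    and "integrable M (\<lambda>x. (f x)^2)" "integrable M (\<lambda>x. (g x)^2)"
  shows "integrable M (\<lambda>x. f x * g x)"
proof (rule Bochner_Integration.integrable_bound)
  show "integrable M (\<lambda>x. (f x)^2 + (g x)^2)" using assms by simp
  show "AE x in M. norm (f x * g x) \<le> norm ((f x)^2 + (g x)^2)"
  proof (intro AE_I2)
    fix x
    have "0 \<le> (\<bar>f x\<bar> - \<bar>g x\<bar>)^2 + \<bar>f x * g x\<bar> * 0" by simp
    then have "2 * \<bar>f x * g x\<bar> \<le> (f x)^2 + (g x)^2"
      by (simp add: power2_eq_square abs_mult algebra_simps)
    then show "norm (f x * g x) \<le> norm ((f x)^2 + (g x)^2)" by simp
  qed
qed measurable

lemma integrable_bounded_support_L2:
  fixes \<Phi> :: "'a::euclidean_space \<Rightarrow> real"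
  assumes \<Omega>: "open \<Omega>" "bounded \<Omega>" and \<Phi>[measurable]: "\<Phi> \<in> borel_measurable borel"
    and \<Phi>2: "integrable lborel (\<lambda>x. (\<Phi> x)^2)" and \<Phi>0: "\<And>x. x \<notin> \<Omega> \<Longrightarrow> \<Phi> x = 0"
  shows "integrable lborel \<Phi>"
proof -
  have "integrable lborel (\<lambda>x. \<Phi> x * indicator \<Omega> x)"
  proof (rule integrable_mult_L2)
    have "(\<lambda>x. (indicator \<Omega> x)^2 :: real) = indicator \<Omega>" by (auto simp: indicator_def)
    then show "integrable lborel (\<lambda>x. (indicator \<Omega> x)^2 :: real)"
      using \<Omega> emeasure_bounded_finite[of \<Omega>] by (simp add: less_top)
  qed (use \<Omega> \<Phi>2 in auto)
  moreover have "(\<lambda>x. \<Phi> x * indicator \<Omega> x) = \<Phi>"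
    using \<Phi>0 by (auto simp: fun_eq_iff indicator_def)
  ultimately show ?thesis by simp
qed

lemma Cauchy_Schwarz_integral:
  fixes f g :: "'a \<Rightarrow> real"
  assumes meas [measurable]: "f \<in> borel_measurable M" "g \<in> borel_measurable M"
    and f2: "integrable M (\<lambda>x. (f x)^2)" and g2: "integrable M (\<lambda>x. (g x)^2)"
  shows "\<bar>LINT x|M. f x * g x\<bar> \<le> sqrt (LINT x|M. (f x)^2) * sqrt (LINT x|M. (g x)^2)"
proof -
  define A where "A = (LINT x|M. (f x)^2)"
  define B where "B = (LINT x|M. (g x)^2)"
  define I where "I = (LINT x|M. f x * g x)"
  have fg: "integrable M (\<lambda>x. f x * g x)" by (rule integrable_mult_L2) fact+
  have AB: "0 \<le> A" "0 \<le> B" by (simp_all add: A_def B_def)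
  have "I^2 \<le> A * B"
  proof (cases "B = 0")
    case True
    then have "AE x in M. (g x)^2 = 0"
      using integral_nonneg_eq_0_iff_AE[OF g2] by (simp add: B_def)
    then have "AE x in M. f x * g x = 0" by (rule eventually_mono) auto
    then have "I = (LINT x|M. 0)"
      unfolding I_def by (intro integral_cong_AE) auto
    then show ?thesis using AB by simp
  next
    case False
    \<comment> \<open>The integrand is the residual of the projection of \<open>f\<close> onto
      \<open>g\<close>, scaled by \<open>B\<close> to avoid a quotient.\<close>
    have "0 \<le> (LINT x|M. (B * f x - I * g x)^2)" by simp
    also have "(\<lambda>x. (B * f x - I * g x)^2) = (\<lambda>x. B^2 * (f x)^2 - 2 * B * I * (f x * g x) + I^2 * (g x)^2)"
      by (simp add: fun_eq_iff power2_eq_square algebra_simps)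
    also have "(LINT x|M. B^2 * (f x)^2 - 2 * B * I * (f x * g x) + I^2 * (g x)^2) = B^2 * A - 2 * B * I * I + I^2 * B"
      using f2 g2 fg by (simp add: A_def B_def I_def)
    also have "\<dots> = B * (A * B - I^2)" by (simp add: power2_eq_square algebra_simps)
    finally show ?thesis using False AB by (simp add: zero_le_mult_iff)
  qed
  then have "sqrt (I^2) \<le> sqrt (A * B)" by (rule real_sqrt_le_mono)
  then show ?thesis by (simp add: A_def B_def I_def real_sqrt_mult)
qed

text \<open>The variance with respect to the probability density \<open>k\<close> is nonnegative. It
  is used both for the reflected mollifier and for the normalized indicator of a domain.\<close>

lemma weighted_Jensen_square:
  fixes k h :: "'a \<Rightarrow> real"
  assumes k: "\<And>x. 0 \<le> k x" "integrable M k" "(LINT x|M. k x) = 1"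
    and h[measurable]: "h \<in> borel_measurable M" and kh2: "integrable M (\<lambda>x. k x * (h x)^2)"
  shows "integrable M (\<lambda>x. k x * h x)" "(LINT x|M. k x * h x)^2 \<le> (LINT x|M. k x * (h x)^2)"
proof -
  have [measurable]: "k \<in> borel_measurable M" using k(2) by simp
  show kh: "integrable M (\<lambda>x. k x * h x)"
  proof (rule Bochner_Integration.integrable_bound)
    show "integrable M (\<lambda>x. k x + k x * (h x)^2)" using k kh2 by simp
    show "AE x in M. norm (k x * h x) \<le> norm (k x + k x * (h x)^2)"
    proof (intro AE_I2)
      fix x
      have "0 \<le> (\<bar>h x\<bar> - 1)^2 + \<bar>h x\<bar>" by simp
      then have "\<bar>h x\<bar> \<le> 1 + (h x)^2" by (simp add: power2_eq_square algebra_simps)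
      then have "k x * \<bar>h x\<bar> \<le> k x * (1 + (h x)^2)" using k(1) by (intro mult_left_mono) auto
      then show "norm (k x * h x) \<le> norm (k x + k x * (h x)^2)"
        using k(1)[of x] by (simp add: abs_mult algebra_simps)
    qed
  qed measurable
  define m where "m = (LINT x|M. k x * h x)"
  have "0 \<le> (LINT x|M. k x * (h x - m)^2)" using k(1) by simp
  also have "(\<lambda>x. k x * (h x - m)^2) = (\<lambda>x. k x * (h x)^2 - 2 * m * (k x * h x) + m^2 * k x)"
    by (simp add: fun_eq_iff power2_eq_square algebra_simps)
  also have "(LINT x|M. k x * (h x)^2 - 2 * m * (k x * h x) + m^2 * k x) = (LINT x|M. k x * (h x)^2) - 2 * m * m + m^2"
    using k kh2 kh by (simp add: m_def)
  finally show "(LINT x|M. k x * h x)^2 \<le> (LINT x|M. k x * (h x)^2)"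
    by (simp add: m_def power2_eq_square)
qed

lemma nn_integral_affine:
  fixes f :: "'a::euclidean_space \<Rightarrow> ennreal" and t :: real
  assumes [measurable]: "f \<in> borel_measurable borel" and t: "0 < t"
  shows "(\<integral>\<^sup>+x. f (a + t *\<^sub>R x) \<partial>lborel) = ennreal (1 / t ^ DIM('a)) * (\<integral>\<^sup>+x. f x \<partial>lborel)"
proof -
  have "(\<integral>\<^sup>+x. f x \<partial>lborel) = ennreal (t ^ DIM('a)) * (\<integral>\<^sup>+x. f (a + t *\<^sub>R x) \<partial>lborel)"
    using t by (subst lborel_affine[of t a]) (simp_all add: nn_integral_density nn_integral_distr nn_integral_cmult)
  then have "ennreal (1 / t ^ DIM('a)) * (\<integral>\<^sup>+x. f x \<partial>lborel) = ennreal (1 / t ^ DIM('a) * t ^ DIM('a)) * (\<integral>\<^sup>+x. f (a + t *\<^sub>R x) \<partial>lborel)"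
    using t by (subst ennreal_mult) (simp_all add: mult.assoc)
  then show ?thesis using t by simp
qed

text \<open>
  Contracting by \<open>t\<close> towards \<open>c\<close> before averaging keeps the averaging window inside a convex
  set with centre \<open>c\<close>, so no extension of the function beyond the set is needed.
\<close>

definition contracted_average :: "('a::euclidean_space \<Rightarrow> real) \<Rightarrow> 'a \<Rightarrow> real \<Rightarrow> ('a \<Rightarrow> real) \<Rightarrow> 'a \<Rightarrow> real" where
  "contracted_average \<kappa> c t h x = (LBINT y. \<kappa> (c + t *\<^sub>R (x - c) - y) * h y)"

locale mollifier =
  fixes \<kappa> :: "'a::euclidean_space \<Rightarrow> real" and D\<kappa> :: "'a \<Rightarrow> 'a" and e :: real
  assumes \<kappa>_nonneg: "0 \<le> \<kappa> x" and \<kappa>_0: "e \<le> norm x \<Longrightarrow> \<kappa> x = 0" and D\<kappa>_0: "e \<le> norm x \<Longrightarrow> D\<kappa> x = 0"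
    and \<kappa>_int: "integrable lborel \<kappa>" and \<kappa>_1: "(LBINT x. \<kappa> x) = 1"
    and \<kappa>_deriv: "(\<kappa> has_derivative (\<lambda>h. D\<kappa> x \<bullet> h)) (at x)" and D\<kappa>_cont: "continuous_on UNIV D\<kappa>"
begin

lemma \<kappa>_cont: "continuous_on UNIV \<kappa>"
  by (intro continuous_at_imp_continuous_on ballI has_derivative_continuous[OF \<kappa>_deriv])

lemma \<kappa>_measurable [measurable]: "\<kappa> \<in> borel_measurable borel" "D\<kappa> \<in> borel_measurable borel"
  by (intro borel_measurable_continuous_onI \<kappa>_cont D\<kappa>_cont)+

lemma \<kappa>_bounded: obtains B where "0 \<le> B" "\<And>x. \<bar>\<kappa> x\<bar> \<le> B"
  using continuous_compact_support_bounded[OF \<kappa>_cont, of e] \<kappa>_0 by auto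

lemma D\<kappa>_bounded: obtains B where "0 \<le> B" "\<And>x. norm (D\<kappa> x) \<le> B"
  using continuous_compact_support_bounded[OF D\<kappa>_cont, of e] D\<kappa>_0 by auto

lemma D\<kappa>_unif: "uniformly_continuous_on UNIV D\<kappa>"
  using continuous_compact_support_uniformly_continuous[OF D\<kappa>_cont, of e] D\<kappa>_0 by auto

lemma D\<kappa>_unif':
  assumes "0 < a"
  shows "\<exists>d>0. \<forall>x y. dist y x < d \<longrightarrow> dist (D\<kappa> y) (D\<kappa> x) < a"
  using D\<kappa>_unif assms by (simp add: uniformly_continuous_on_def)

lemma nn_integral_\<kappa>: "(\<integral>\<^sup>+x. \<kappa> x \<partial>lborel) = 1"
  using nn_integral_eq_integral[OF \<kappa>_int] \<kappa>_nonneg \<kappa>_1 by simp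

lemma \<kappa>_reflect:
  "integrable lborel (\<lambda>y. \<kappa> (z - y))" "(LBINT y. \<kappa> (z - y)) = 1"
proof -
  have "(\<integral>\<^sup>+y. \<kappa> (z - y) \<partial>lborel) = 1"
  proof -
    have "(\<integral>\<^sup>+x. \<kappa> x \<partial>lborel) = (\<integral>\<^sup>+y. \<kappa> (z - y) \<partial>lborel)"
      by (subst lborel_affine[of "-1" z]) (simp_all add: nn_integral_density nn_integral_distr)
    then show ?thesis by (simp add: nn_integral_\<kappa>)
  qed
  then show "integrable lborel (\<lambda>y. \<kappa> (z - y))" "(LBINT y. \<kappa> (z - y)) = 1"
    using \<kappa>_nonneg by (auto intro!: integrableI_nonneg simp: integral_eq_nn_integral)
qed

lemma \<kappa>_mult_integrable:
  fixes h :: "'a \<Rightarrow> real"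
  assumes h: "integrable lborel h"
  shows "integrable lborel (\<lambda>y. \<kappa> (z - y) * h y)"
proof -
  have [measurable]: "h \<in> borel_measurable borel" using h by simp
  obtain B where B: "0 \<le> B" "\<And>x. \<bar>\<kappa> x\<bar> \<le> B" by (rule \<kappa>_bounded) blast
  show ?thesis
    by (rule Bochner_Integration.integrable_bound[of _ "\<lambda>y. B * h y"])
      (use B h in \<open>auto simp: abs_mult intro!: mult_right_mono\<close>)
qed

lemma D\<kappa>_scaleR_integrable:
  fixes h :: "'a \<Rightarrow> real"
  assumes h: "integrable lborel h"
  shows "integrable lborel (\<lambda>y. h y *\<^sub>R D\<kappa> (z - y))"
proof -
  have [measurable]: "h \<in> borel_measurable borel" using h by simp
  obtain B where B: "0 \<le> B" "\<And>x. norm (D\<kappa> x) \<le> B" by (rule D\<kappa>_bounded) blast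
  show ?thesis
    by (rule Bochner_Integration.integrable_bound[of _ "\<lambda>y. h y * B"])
      (use B h in \<open>auto simp: abs_mult intro!: mult_left_mono\<close>)
qed

text \<open>The mean value theorem and the uniform continuity of \<open>D\<kappa>\<close> bound the
  Taylor remainder of \<open>\<kappa>\<close> by a small multiple of \<open>norm v\<close>,
  uniformly in the base point. Integrability of \<open>h\<close> is then enough to differentiate
  under the integral.\<close>

lemma convolution_has_derivative:
  fixes h :: "'a \<Rightarrow> real"
  assumes h: "integrable lborel h"
  shows "((\<lambda>z. LBINT y. \<kappa> (z - y) * h y) has_derivative (\<lambda>v. (LBINT y. h y *\<^sub>R D\<kappa> (z - y)) \<bullet> v)) (at z)"
  unfolding has_derivative_at_alt
proof (intro conjI allI impI bounded_linear_inner_right)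
  have [measurable]: "h \<in> borel_measurable borel" using h by simp
  fix e' :: real assume e': "0 < e'"
  define H where "H = (LBINT y. \<bar>h y\<bar>)"
  have H: "0 \<le> H" by (simp add: H_def)
  \<comment> \<open>\<open>H + 1\<close> instead of \<open>H\<close> avoids a zero denominator when
    \<open>h\<close> vanishes almost everywhere.\<close>
  have "0 < e' / (H + 1)" using e' H by simp
  then obtain d where d: "d > 0" "\<And>x y. dist y x < d \<Longrightarrow> dist (D\<kappa> y) (D\<kappa> x) < e' / (H + 1)"
    using D\<kappa>_unif' by blast
  have pointwise: "\<bar>\<kappa> (w + v) - \<kappa> w - D\<kappa> w \<bullet> v\<bar> \<le> e' / (H + 1) * norm v" if v: "norm v < d" for w v
  proof -
    have D: "((\<lambda>s. \<kappa> (w + s *\<^sub>R v)) has_real_derivative D\<kappa> (w + s *\<^sub>R v) \<bullet> v) (at s)" for s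
    proof -
      have "((\<lambda>s. w + s *\<^sub>R v) has_derivative (\<lambda>h. h *\<^sub>R v)) (at s)"
        by (auto intro!: derivative_eq_intros)
      from has_derivative_compose[OF this \<kappa>_deriv] show ?thesis
        by (simp add: has_field_derivative_def mult_commute_abs)
    qed
    have "\<exists>s. 0 < s \<and> s < 1 \<and> \<kappa> (w + 1 *\<^sub>R v) - \<kappa> (w + 0 *\<^sub>R v) = (1 - 0) * (D\<kappa> (w + s *\<^sub>R v) \<bullet> v)"
      by (rule MVT2[of 0 1 "\<lambda>s. \<kappa> (w + s *\<^sub>R v)"]) (use D in simp_all)
    then obtain s where s: "0 < s" "s < 1" "\<kappa> (w + v) - \<kappa> w = D\<kappa> (w + s *\<^sub>R v) \<bullet> v"
      by (simp only: scaleR_one scaleR_zero_left add_0_right diff_zero mult_1) blast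
    have "\<bar>\<kappa> (w + v) - \<kappa> w - D\<kappa> w \<bullet> v\<bar> = \<bar>(D\<kappa> (w + s *\<^sub>R v) - D\<kappa> w) \<bullet> v\<bar>"
      by (simp add: s(3) inner_diff_left)
    also have "\<dots> \<le> norm (D\<kappa> (w + s *\<^sub>R v) - D\<kappa> w) * norm v"
      by (rule Cauchy_Schwarz_ineq2)
    also have "\<dots> \<le> e' / (H + 1) * norm v"
    proof (rule mult_right_mono)
      have "s * norm v \<le> 1 * norm v" using s by (intro mult_right_mono) auto
      then have "dist (w + s *\<^sub>R v) w < d" using v s by (simp add: dist_norm)
      then show "norm (D\<kappa> (w + s *\<^sub>R v) - D\<kappa> w) \<le> e' / (H + 1)"
        using d(2) by (simp add: dist_norm less_imp_le)
    qed simp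
    finally show ?thesis .
  qed
  show "\<exists>d>0. \<forall>y. norm (y - z) < d \<longrightarrow>
      norm ((LBINT ya. \<kappa> (y - ya) * h ya) - (LBINT y. \<kappa> (z - y) * h y) -
        (LBINT y. h y *\<^sub>R D\<kappa> (z - y)) \<bullet> (y - z)) \<le> e' * norm (y - z)"
  proof (intro exI[of _ d] conjI allI impI d(1))
    fix z' assume z': "norm (z' - z) < d"
    have i1: "integrable lborel (\<lambda>y. \<kappa> (z' - y) * h y)" "integrable lborel (\<lambda>y. \<kappa> (z - y) * h y)"
      "integrable lborel (\<lambda>y. (h y *\<^sub>R D\<kappa> (z - y)) \<bullet> (z' - z))"
      by (intro \<kappa>_mult_integrable h integrable_inner_left D\<kappa>_scaleR_integrable)+
    have "(LBINT ya. \<kappa> (z' - ya) * h ya) - (LBINT y. \<kappa> (z - y) * h y) -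
        (LBINT y. h y *\<^sub>R D\<kappa> (z - y)) \<bullet> (z' - z)
      = (LBINT y. \<kappa> (z' - y) * h y - \<kappa> (z - y) * h y - (h y *\<^sub>R D\<kappa> (z - y)) \<bullet> (z' - z))"
      using i1 D\<kappa>_scaleR_integrable[OF h] by (simp add: Bochner_Integration.integral_diff integral_inner_left[symmetric])
    also have "norm \<dots> \<le> (LBINT y. (e' / (H + 1) * norm (z' - z)) * \<bar>h y\<bar>)"
    proof (rule order_trans[OF integral_norm_bound integral_mono])
      show "norm (\<kappa> (z' - y) * h y - \<kappa> (z - y) * h y - (h y *\<^sub>R D\<kappa> (z - y)) \<bullet> (z' - z)) \<le> (e' / (H + 1) * norm (z' - z)) * \<bar>h y\<bar>" for y
      proof -
        have "\<kappa> (z' - y) * h y - \<kappa> (z - y) * h y - (h y *\<^sub>R D\<kappa> (z - y)) \<bullet> (z' - z)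
          = (\<kappa> ((z - y) + (z' - z)) - \<kappa> (z - y) - D\<kappa> (z - y) \<bullet> (z' - z)) * h y"
          by (simp add: algebra_simps)
        then show ?thesis
          using pointwise[OF z', of "z - y"] by (simp only: real_norm_def abs_mult mult_right_mono abs_ge_zero)
      qed
    qed (use i1 h in auto)
    also have "\<dots> = e' * norm (z' - z) * (H / (H + 1))" by (simp add: H_def)
    also have "\<dots> \<le> e' * norm (z' - z) * 1"
      using H e' by (intro mult_left_mono) auto
    finally show "norm ((LBINT ya. \<kappa> (z' - ya) * h ya) - (LBINT y. \<kappa> (z - y) * h y) -
        (LBINT y. h y *\<^sub>R D\<kappa> (z - y)) \<bullet> (z' - z)) \<le> e' * norm (z' - z)" by simp
  qed
qed

lemma convolution_derivative_continuous:
  fixes h :: "'a \<Rightarrow> real"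
  assumes h: "integrable lborel h"
  shows "continuous_on UNIV (\<lambda>z. LBINT y. h y *\<^sub>R D\<kappa> (z - y))"
  unfolding continuous_on_iff
proof (intro ballI allI impI)
  fix z :: 'a and e' :: real assume e': "0 < e'"
  define H where "H = (LBINT y. \<bar>h y\<bar>)"
  have H: "0 \<le> H" by (simp add: H_def)
  have "0 < e' / (H + 1)" using e' H by simp
  then obtain d where d: "d > 0" "\<And>x y. dist y x < d \<Longrightarrow> dist (D\<kappa> y) (D\<kappa> x) < e' / (H + 1)"
    using D\<kappa>_unif' by blast
  show "\<exists>d>0. \<forall>x'\<in>UNIV. dist x' z < d \<longrightarrow> dist (LBINT y. h y *\<^sub>R D\<kappa> (x' - y)) (LBINT y. h y *\<^sub>R D\<kappa> (z - y)) < e'"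
  proof (intro exI[of _ d] conjI ballI impI d(1))
    fix z' assume z': "dist z' z < d"
    have "(LBINT y. h y *\<^sub>R D\<kappa> (z' - y)) - (LBINT y. h y *\<^sub>R D\<kappa> (z - y))
      = (LBINT y. h y *\<^sub>R D\<kappa> (z' - y) - h y *\<^sub>R D\<kappa> (z - y))"
      using D\<kappa>_scaleR_integrable[OF h] by (simp add: Bochner_Integration.integral_diff)
    also have "norm \<dots> \<le> (LBINT y. (e' / (H + 1)) * \<bar>h y\<bar>)"
    proof (rule order_trans[OF integral_norm_bound integral_mono])
      show "norm (h y *\<^sub>R D\<kappa> (z' - y) - h y *\<^sub>R D\<kappa> (z - y)) \<le> (e' / (H + 1)) * \<bar>h y\<bar>" for y
      proof -
        have "dist (D\<kappa> (z' - y)) (D\<kappa> (z - y)) < e' / (H + 1)"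
          using z' by (intro d(2)) (simp add: dist_norm)
        then have "norm (D\<kappa> (z' - y) - D\<kappa> (z - y)) * \<bar>h y\<bar> \<le> (e' / (H + 1)) * \<bar>h y\<bar>"
          by (intro mult_right_mono) (simp_all add: dist_norm)
        then show ?thesis by (simp add: scaleR_diff_right[symmetric] mult.commute)
      qed
    qed (use D\<kappa>_scaleR_integrable[OF h] h in auto)
    also have "\<dots> = e' * (H / (H + 1))" by (simp add: H_def)
    also have "\<dots> < e' * 1"
      using H e' by (intro mult_strict_left_mono) auto
    finally show "dist (LBINT y. h y *\<^sub>R D\<kappa> (z' - y)) (LBINT y. h y *\<^sub>R D\<kappa> (z - y)) < e'"
      by (simp add: dist_norm)
  qed
qed

text \<open>Jensen's inequality moves the square inside the average, Tonelli exchanges the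
  integrals, and the affine substitution in \<open>x\<close> contributes
  \<open>1 / t ^ DIM('a)\<close>. Nonnegative integrals are used because integrability is itself
  part of the claim.\<close>

lemma contracted_average_L2:
  fixes h :: "'a \<Rightarrow> real"
  assumes t: "0 < t" and h[measurable]: "h \<in> borel_measurable borel" and h2: "integrable lborel (\<lambda>x. (h x)^2)"
  shows "contracted_average \<kappa> c t h \<in> borel_measurable borel"
    and "integrable lborel (\<lambda>x. (contracted_average \<kappa> c t h x)^2)"
    and "(LBINT x. (contracted_average \<kappa> c t h x)^2) \<le> 1 / t ^ DIM('a) * (LBINT x. (h x)^2)"
    and "\<And>z. integrable lborel (\<lambda>y. \<kappa> (z - y) * h y)"
proof -
  have ih2: "integrable lborel (\<lambda>y. \<kappa> (z - y) * (h y)^2)" for z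
    by (rule \<kappa>_mult_integrable[OF h2])
  show "integrable lborel (\<lambda>y. \<kappa> (z - y) * h y)" for z
    by (rule weighted_Jensen_square(1)[OF _ \<kappa>_reflect]) (use \<kappa>_nonneg ih2 in auto)
  show meas [measurable]: "contracted_average \<kappa> c t h \<in> borel_measurable borel"
    unfolding contracted_average_def by measurable
  have le: "(contracted_average \<kappa> c t h x)^2 \<le> (LBINT y. \<kappa> (c + t *\<^sub>R (x - c) - y) * (h y)^2)" for x
    unfolding contracted_average_def
    by (rule weighted_Jensen_square(2)[OF _ \<kappa>_reflect]) (use \<kappa>_nonneg ih2 in auto)
  have "(\<integral>\<^sup>+x. (contracted_average \<kappa> c t h x)^2 \<partial>lborel)
    \<le> (\<integral>\<^sup>+x. (\<integral>\<^sup>+y. \<kappa> (c + t *\<^sub>R (x - c) - y) * (h y)^2 \<partial>lborel) \<partial>lborel)"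
  proof (rule nn_integral_mono)
    fix x
    have "ennreal ((contracted_average \<kappa> c t h x)^2) \<le> ennreal (LBINT y. \<kappa> (c + t *\<^sub>R (x - c) - y) * (h y)^2)"
      by (rule ennreal_leI[OF le])
    also have "\<dots> = (\<integral>\<^sup>+y. \<kappa> (c + t *\<^sub>R (x - c) - y) * (h y)^2 \<partial>lborel)"
      using \<kappa>_nonneg by (intro nn_integral_eq_integral[symmetric] ih2) auto
    finally show "ennreal ((contracted_average \<kappa> c t h x)^2) \<le> (\<integral>\<^sup>+y. \<kappa> (c + t *\<^sub>R (x - c) - y) * (h y)^2 \<partial>lborel)" .
  qed
  also have "\<dots> = (\<integral>\<^sup>+y. (\<integral>\<^sup>+x. \<kappa> (c + t *\<^sub>R (x - c) - y) * (h y)^2 \<partial>lborel) \<partial>lborel)"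
    by (rule lborel_pair.Fubini') measurable
  also have "\<dots> = (\<integral>\<^sup>+y. ennreal (1 / t ^ DIM('a)) * ennreal ((h y)^2) \<partial>lborel)"
  proof (rule nn_integral_cong)
    fix y :: 'a
    have "(\<integral>\<^sup>+x. \<kappa> (c + t *\<^sub>R (x - c) - y) * (h y)^2 \<partial>lborel) = (\<integral>\<^sup>+x. ennreal (\<kappa> ((c - t *\<^sub>R c - y) + t *\<^sub>R x)) * ennreal ((h y)^2) \<partial>lborel)"
      by (intro nn_integral_cong) (simp add: algebra_simps ennreal_mult'[symmetric])
    also have "\<dots> = ennreal (1 / t ^ DIM('a)) * ennreal ((h y)^2)"
      using nn_integral_affine[of "\<lambda>x. ennreal (\<kappa> x)" t "c - t *\<^sub>R c - y"] t
      by (simp add: nn_integral_multc nn_integral_\<kappa>)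
    finally show "(\<integral>\<^sup>+x. \<kappa> (c + t *\<^sub>R (x - c) - y) * (h y)^2 \<partial>lborel) = ennreal (1 / t ^ DIM('a)) * ennreal ((h y)^2)" .
  qed
  also have "\<dots> = ennreal (1 / t ^ DIM('a)) * ennreal (LBINT y. (h y)^2)"
    using nn_integral_eq_integral[OF h2] by (simp add: nn_integral_cmult)
  also have "\<dots> = ennreal (1 / t ^ DIM('a) * (LBINT y. (h y)^2))"
    using t by (intro ennreal_mult[symmetric]) auto
  finally have nn: "(\<integral>\<^sup>+x. (contracted_average \<kappa> c t h x)^2 \<partial>lborel) \<le> ennreal (1 / t ^ DIM('a) * (LBINT y. (h y)^2))" .
  show i: "integrable lborel (\<lambda>x. (contracted_average \<kappa> c t h x)^2)"
    by (rule integrableI_nonneg) (use nn in \<open>auto simp: less_top[symmetric] top_unique\<close>)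
  show "(LBINT x. (contracted_average \<kappa> c t h x)^2) \<le> 1 / t ^ DIM('a) * (LBINT x. (h x)^2)"
    using nn nn_integral_eq_integral[OF i] t by simp
qed

end

text \<open>Truncating \<open>\<Phi>\<close> at a high level costs little by dominated convergence.
  The truncated function is an almost everywhere limit of continuous functions; truncating these at
  the same level makes a constant on the bounded set \<open>\<Omega>\<close> a dominating
  function.\<close>

lemma L2_approx_continuous:
  fixes \<Phi> :: "'a::euclidean_space \<Rightarrow> real"
  assumes \<Omega>: "open \<Omega>" "bounded \<Omega>" and \<Phi>[measurable]: "\<Phi> \<in> borel_measurable borel"
    and \<Phi>2: "integrable lborel (\<lambda>x. (\<Phi> x)^2)" and \<Phi>0: "\<And>x. x \<notin> \<Omega> \<Longrightarrow> \<Phi> x = 0" and d: "0 < d"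
  obtains \<theta> where "continuous_on UNIV \<theta>" "integrable lborel (\<lambda>x. (\<Phi> x - indicator \<Omega> x * \<theta> x)^2)"
    "(LBINT x. (\<Phi> x - indicator \<Omega> x * \<theta> x)^2) < d"
proof -
  define cl where "cl n x = max (- real n) (min (real n) x)" for n x
  have cl_le: "\<bar>cl n x\<bar> \<le> real n" "\<bar>x - cl n x\<bar> \<le> \<bar>x\<bar>" "cl n 0 = 0" for n x
    by (auto simp: cl_def)
  have [measurable]: "\<Omega> \<in> sets borel" using \<Omega> by simp
  have cl_cont: "continuous_on UNIV (cl n)" for n unfolding cl_def by (intro continuous_intros)
  then have [measurable]: "cl n \<in> borel_measurable borel" for n by (rule borel_measurable_continuous_onI)
  have "(\<lambda>n. LBINT x. (\<Phi> x - cl n (\<Phi> x))^2) \<longlonglongrightarrow> (LBINT x::'a. 0)"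
  proof (rule integral_dominated_convergence[where w="\<lambda>x. (\<Phi> x)^2"])
    show "AE x in lborel. (\<lambda>n. (\<Phi> x - cl n (\<Phi> x))^2) \<longlonglongrightarrow> 0"
    proof (intro AE_I2 tendsto_eventually)
      fix x
      show "eventually (\<lambda>n. (\<Phi> x - cl n (\<Phi> x))^2 = 0) sequentially"
        using eventually_ge_at_top[of "nat \<lceil>\<bar>\<Phi> x\<bar>\<rceil>"]
        by eventually_elim (auto simp: cl_def nat_le_iff ceiling_le_iff)
    qed
    show "AE x in lborel. norm ((\<Phi> x - cl n (\<Phi> x))^2) \<le> (\<Phi> x)^2" for n
      using cl_le(2) by (auto simp: abs_le_square_iff)
  qed (use \<Phi>2 in auto)
  then have "eventually (\<lambda>n. (LBINT x. (\<Phi> x - cl n (\<Phi> x))^2) < d / 4) sequentially"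
    using d by (intro order_tendstoD(2)[of _ 0]) auto
  then obtain n where n: "(LBINT x. (\<Phi> x - cl n (\<Phi> x))^2) < d / 4"
    by (auto simp: eventually_sequentially)
  have "(\<lambda>x. cl n (\<Phi> x)) measurable_on UNIV"
    by (intro lebesgue_measurable_imp_measurable_on measurable_completion) auto
  then obtain N g where N: "negligible N" and g: "\<And>k. continuous_on UNIV (g k)"
    and lim: "\<And>x. x \<notin> N \<Longrightarrow> (\<lambda>k. g k x) \<longlonglongrightarrow> cl n (\<Phi> x)"
    by (auto simp: measurable_on_def)
  have gc: "continuous_on UNIV (\<lambda>x. cl n (g k x))" for k
    by (intro continuous_on_compose2[OF cl_cont g]) auto
  have [measurable]: "g k \<in> borel_measurable borel" for k using g by (rule borel_measurable_continuous_onI)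
  have i1: "integrable lborel (indicator \<Omega> :: 'a \<Rightarrow> real)"
    using \<Omega> emeasure_bounded_finite[of \<Omega>] by (intro integrable_real_indicator) (auto simp: less_top)
  have "AE x in lebesgue. x \<notin> N"
    using N by (auto simp: negligible_iff_null_sets intro: AE_not_in)
  then have AEN: "AE x in lborel. x \<notin> N" by (simp add: AE_completion_iff)
  have dom: "\<bar>(cl n a - cl n b)^2\<bar> \<le> (2 * real n)^2" for a b
  proof -
    have "\<bar>cl n a - cl n b\<bar> \<le> \<bar>2 * real n\<bar>"
      using cl_le(1)[of n a] cl_le(1)[of n b] by linarith
    then show ?thesis by (simp only: abs_le_square_iff abs_power2)
  qed
  have "(\<lambda>k. LBINT x. indicator \<Omega> x * (cl n (\<Phi> x) - cl n (g k x))^2) \<longlonglongrightarrow> (LBINT x::'a. 0)"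
  proof (rule integral_dominated_convergence[where w="\<lambda>x::'a. indicator \<Omega> x * (2 * real n)^2"])
    show "AE x in lborel. (\<lambda>k. indicator \<Omega> x * (cl n (\<Phi> x) - cl n (g k x))^2) \<longlonglongrightarrow> 0"
      using AEN
    proof eventually_elim
      case (elim x)
      have "(\<lambda>k. cl n (g k x)) \<longlonglongrightarrow> cl n (cl n (\<Phi> x))"
        unfolding cl_def[of n "g _ x"] cl_def[of n "cl n (\<Phi> x)"] by (intro tendsto_intros lim elim)
      moreover have "cl n (cl n (\<Phi> x)) = cl n (\<Phi> x)" by (auto simp: cl_def)
      ultimately have "(\<lambda>k. indicator \<Omega> x * (cl n (\<Phi> x) - cl n (g k x))^2) \<longlonglongrightarrow> indicator \<Omega> x * (cl n (\<Phi> x) - cl n (\<Phi> x))^2"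
        by (intro tendsto_intros) auto
      then show ?case by simp
    qed
    show "AE x in lborel. norm (indicator \<Omega> x * (cl n (\<Phi> x) - cl n (g k x))^2) \<le> indicator \<Omega> x * (2 * real n)^2" for k
      using dom by (auto simp: indicator_def)
  qed (use i1 in auto)
  then have "eventually (\<lambda>k. (LBINT x. indicator \<Omega> x * (cl n (\<Phi> x) - cl n (g k x))^2) < d / 4) sequentially"
    using d by (intro order_tendstoD(2)[of _ 0]) auto
  then obtain k where k: "(LBINT x. indicator \<Omega> x * (cl n (\<Phi> x) - cl n (g k x))^2) < d / 4"
    by (auto simp: eventually_sequentially)
  have i2: "integrable lborel (\<lambda>x. indicator \<Omega> x * (cl n (\<Phi> x) - cl n (g k x))^2)"
  proof (rule Bochner_Integration.integrable_bound)
    show "integrable lborel (\<lambda>x::'a. indicator \<Omega> x * (2 * real n)^2)"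
      using i1 by (rule integrable_mult_left)
    show "AE x in lborel. norm (indicator \<Omega> x * (cl n (\<Phi> x) - cl n (g k x))^2) \<le> norm (indicator \<Omega> x * (2 * real n)^2)"
      using dom by (auto simp: indicator_def)
  qed measurable
  have i3: "integrable lborel (\<lambda>x. (\<Phi> x - cl n (\<Phi> x))^2)"
    by (rule Bochner_Integration.integrable_bound[OF \<Phi>2]) (use cl_le(2) in \<open>auto simp: abs_le_square_iff\<close>)
  have le: "(\<Phi> x - indicator \<Omega> x * cl n (g k x))^2 \<le> 2 * (\<Phi> x - cl n (\<Phi> x))^2 + 2 * (indicator \<Omega> x * (cl n (\<Phi> x) - cl n (g k x))^2)" for x
  proof (cases "x \<in> \<Omega>")
    case True
    have "(a + b)^2 \<le> 2 * a^2 + 2 * b^2" for a b :: real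
      using zero_le_power2[of "a - b"] by (simp add: power2_eq_square algebra_simps)
    from this[of "\<Phi> x - cl n (\<Phi> x)" "cl n (\<Phi> x) - cl n (g k x)"] True show ?thesis by simp
  qed (simp add: \<Phi>0 cl_le(3))
  have i4: "integrable lborel (\<lambda>x. (\<Phi> x - indicator \<Omega> x * cl n (g k x))^2)"
    by (rule Bochner_Integration.integrable_bound[of _ "\<lambda>x. 2 * (\<Phi> x - cl n (\<Phi> x))^2 + 2 * (indicator \<Omega> x * (cl n (\<Phi> x) - cl n (g k x))^2)"])
      (use i2 i3 le in \<open>auto simp: abs_of_nonneg add_nonneg_nonneg\<close>)
  have "(LBINT x. (\<Phi> x - indicator \<Omega> x * cl n (g k x))^2)
    \<le> (LBINT x. 2 * (\<Phi> x - cl n (\<Phi> x))^2 + 2 * (indicator \<Omega> x * (cl n (\<Phi> x) - cl n (g k x))^2))"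
    using i2 i3 i4 le by (intro integral_mono) auto
  also have "\<dots> = 2 * (LBINT x. (\<Phi> x - cl n (\<Phi> x))^2) + 2 * (LBINT x. indicator \<Omega> x * (cl n (\<Phi> x) - cl n (g k x))^2)"
    using i2 i3 by simp
  also have "\<dots> < d" using n k by simp
  finally show thesis using that[OF gc i4] by blast
qed

text \<open>The conclusion is cut to the needs of the duality argument: a pairing with
  \<open>\<Phi>\<close> and an energy bound, not convergence of gradients. The factor
  \<open>1 + \<delta>\<close> leaves room for the Jacobian of the contraction.\<close>

lemma smooth_approximation:
  fixes \<Phi> :: "'a::euclidean_space \<Rightarrow> real" and G :: "'a \<Rightarrow> 'a"
  assumes \<Omega>: "open \<Omega>" "convex \<Omega>" "bounded \<Omega>" "\<Omega> \<noteq> {}"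
    and \<Phi>[measurable]: "\<Phi> \<in> borel_measurable borel" and \<Phi>2: "integrable lborel (\<lambda>x. (\<Phi> x)^2)"
    and \<Phi>0: "\<And>x. x \<notin> \<Omega> \<Longrightarrow> \<Phi> x = 0"
    and G[measurable]: "G \<in> borel_measurable borel" and G2: "integrable lborel (\<lambda>x. (norm (G x))^2)"
    and weak: "\<And>\<psi> b. \<psi> \<in> test_functions \<Omega> \<Longrightarrow> b \<in> Basis \<Longrightarrow>
      (LBINT x. \<Phi> x * frechet_derivative \<psi> (at x) b) = - (LBINT x. (G x \<bullet> b) * \<psi> x)"
    and \<delta>: "0 < \<delta>"
  obtains u Du where "\<And>x. (u has_derivative (\<lambda>h. Du x \<bullet> h)) (at x)" "continuous_on UNIV Du"
    "\<bar>(LBINT x. \<Phi> x * u x) - (LBINT x. (\<Phi> x)^2)\<bar> < \<delta>"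
    "(LBINT x:\<Omega>. (norm (Du x))^2) \<le> (1 + \<delta>) * (LBINT x. (norm (G x))^2)"
proof -
  obtain c where c: "c \<in> \<Omega>" using \<Omega>(4) by blast
  obtain \<rho> where \<rho>: "\<rho> > 0" "ball c \<rho> \<subseteq> \<Omega>" using \<Omega>(1) c openE by blast
  obtain D where D: "\<And>x. x \<in> \<Omega> \<Longrightarrow> norm (x - c) \<le> D"
    using \<Omega>(3) unfolding bounded_any_center[of \<Omega> c] by (auto simp: dist_norm norm_minus_commute)
  have D0: "0 \<le> D" using D[OF c] by simp
  have [measurable]: "\<Omega> \<in> sets borel" using \<Omega> by simp
  have emO: "emeasure lborel \<Omega> < \<infinity>" using \<Omega> by (intro emeasure_bounded_finite)
  then have iO: "integrable lborel (indicator \<Omega> :: 'a \<Rightarrow> real)"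
    by (intro integrable_real_indicator) auto
  define V where "V = measure lborel \<Omega>"
  define A where "A = sqrt (LBINT x. (\<Phi> x)^2)"
  have A: "0 \<le> A" by (simp add: A_def)
  \<comment> \<open>The pairing error will be bounded by
    \<open>A * (2 * \<eta>) + A * \<eta> + A * \<eta>\<close>, whence the 4; the summand 1 covers
    \<open>A = 0\<close>.\<close>
  define \<eta> where "\<eta> = \<delta> / (4 * A + 1)"
  have \<eta>: "0 < \<eta>" "4 * A * \<eta> < \<delta>" using \<delta> A by (auto simp: \<eta>_def field_simps)
  obtain \<theta> where \<theta>: "continuous_on UNIV \<theta>" "integrable lborel (\<lambda>x. (\<Phi> x - indicator \<Omega> x * \<theta> x)^2)"
    "(LBINT x. (\<Phi> x - indicator \<Omega> x * \<theta> x)^2) < \<eta>^2"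
    using L2_approx_continuous[OF \<Omega>(1,3) \<Phi> \<Phi>2 \<Phi>0, of "\<eta>^2"] \<eta> by auto
  have [measurable]: "\<theta> \<in> borel_measurable borel" using \<theta>(1) by (rule borel_measurable_continuous_onI)
  define \<theta>1 where "\<theta>1 x = indicator \<Omega> x * \<theta> x" for x
  have \<theta>1m [measurable]: "\<theta>1 \<in> borel_measurable borel" unfolding \<theta>1_def by measurable
  define \<omega> where "\<omega> = \<eta> / (sqrt V + 1)"
  have V0: "0 \<le> V" by (simp add: V_def)
  have \<omega>: "0 < \<omega>" "\<omega> * sqrt V \<le> \<eta>" using \<eta>(1) V0 by (auto simp: \<omega>_def field_simps add_pos_nonneg)
  have "uniformly_continuous_on (closure \<Omega>) \<theta>"
    using \<Omega>(3) by (intro compact_uniformly_continuous continuous_on_subset[OF \<theta>(1)]) auto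
  then obtain d where d: "d > 0" "\<And>x y. x \<in> closure \<Omega> \<Longrightarrow> y \<in> closure \<Omega> \<Longrightarrow> dist y x < d \<Longrightarrow> dist (\<theta> y) (\<theta> x) < \<omega>"
    unfolding uniformly_continuous_on_def using \<omega>(1) by metis
  \<comment> \<open>Three demands on \<open>t\<close> near 1: the Jacobian stays below
    \<open>1 + \<delta>\<close> for the energy, below 4 so that the averages at most double a norm,
    and averaging displaces points by less than the modulus \<open>d\<close> of
    \<open>\<theta>\<close>.\<close>
  have "((\<lambda>t::real. 1 / t ^ DIM('a)) \<longlongrightarrow> 1 / 1 ^ DIM('a)) (at_left 1)"
    by (intro tendsto_intros) auto
  then have e1: "eventually (\<lambda>t::real. 1 / t ^ DIM('a) < min 4 (1 + \<delta>)) (at_left 1)"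
    by (rule order_tendstoD) (use \<delta> in auto)
  have "((\<lambda>t::real. (1 - t) * (\<rho> + D)) \<longlongrightarrow> (1 - 1) * (\<rho> + D)) (at_left 1)"
    by (intro tendsto_intros)
  then have e2: "eventually (\<lambda>t::real. (1 - t) * (\<rho> + D) < d) (at_left 1)"
    by (rule order_tendstoD) (use d(1) in auto)
  have e3: "eventually (\<lambda>t::real. t \<in> {0<..<1}) (at_left 1)"
    by (rule eventually_at_left_real) simp
  have "eventually (\<lambda>t::real. 1 / t ^ DIM('a) < min 4 (1 + \<delta>) \<and> (1 - t) * (\<rho> + D) < d \<and> t \<in> {0<..<1}) (at_left 1)"
    using e1 e2 e3 by eventually_elim simp
  then obtain t :: real where t: "1 / t ^ DIM('a) < min 4 (1 + \<delta>)" "(1 - t) * (\<rho> + D) < d" "0 < t" "t < 1"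
    using eventually_happens'[OF trivial_limit_at_left_real] by fastforce
  define e where "e = (1 - t) * \<rho> / 2"
  have e: "0 < e" "e < (1 - t) * \<rho>" using t \<rho>(1) by (auto simp: e_def)
  obtain \<kappa> :: "'a \<Rightarrow> real" and D\<kappa> where k: "\<And>x. 0 \<le> \<kappa> x" "\<And>x. e \<le> norm x \<Longrightarrow> \<kappa> x = 0" "\<And>x. e \<le> norm x \<Longrightarrow> D\<kappa> x = 0"
    "integrable lborel \<kappa>" "(LBINT x. \<kappa> x) = 1"
    "\<And>x. (\<kappa> has_derivative (\<lambda>h. D\<kappa> x \<bullet> h)) (at x)" "continuous_on UNIV D\<kappa>"
    "\<And>z \<Omega>. cball z e \<subseteq> \<Omega> \<Longrightarrow> (\<lambda>y. \<kappa> (z - y)) \<in> test_functions \<Omega>"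
    by (rule mollifier_exists[OF e(1)]) blast
  interpret mollifier \<kappa> D\<kappa> e
    by unfold_locales (use k in auto)
  define \<tau> where "\<tau> x = c + t *\<^sub>R (x - c)" for x :: 'a
  \<comment> \<open>Each point of the window is the combination, with weights \<open>t\<close> and
    \<open>1 - t\<close>, of \<open>x\<close> and a point of \<open>ball c \<rho>\<close>; this is
    the reason for taking \<open>e\<close> below \<open>(1 - t) * \<rho>\<close>.\<close>
  have window: "cball (\<tau> x) e \<subseteq> \<Omega>" if x: "x \<in> \<Omega>" for x
  proof
    fix y assume y: "y \<in> cball (\<tau> x) e"
    define w where "w = (1 / (1 - t)) *\<^sub>R (y - \<tau> x)"
    have "norm (y - \<tau> x) \<le> e" using y by (simp add: dist_norm norm_minus_commute)
    moreover have "norm w = norm (y - \<tau> x) / (1 - t)" using t by (simp add: w_def)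
    ultimately have "norm w < \<rho>" using t(4) e(2) by (simp add: pos_divide_less_eq mult.commute)
    then have "c + w \<in> \<Omega>" using \<rho>(2) by (auto simp: dist_norm)
    then have "(1 - t) *\<^sub>R (c + w) + t *\<^sub>R x \<in> \<Omega>"
      using \<Omega>(2) x t by (intro convexD) auto
    also have "(1 - t) *\<^sub>R (c + w) + t *\<^sub>R x = y"
    proof -
      have "(1 - t) *\<^sub>R w = y - \<tau> x" using t(4) by (simp add: w_def)
      then show ?thesis by (simp add: scaleR_add_right) (simp add: \<tau>_def algebra_simps)
    qed
    finally show "y \<in> \<Omega>" .
  qed
  have \<tau>_near: "dist (\<tau> x) x \<le> (1 - t) * D" if "x \<in> \<Omega>" for x
  proof -
    have "\<tau> x - x = (1 - t) *\<^sub>R (c - x)" by (simp add: \<tau>_def algebra_simps)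
    then show ?thesis using t D[OF that] by (simp add: dist_norm norm_minus_commute mult_left_mono)
  qed
  have \<Phi>1: "integrable lborel \<Phi>" by (rule integrable_bounded_support_L2[OF \<Omega>(1,3) \<Phi> \<Phi>2 \<Phi>0])
  define u where "u = contracted_average \<kappa> c t \<Phi>"
  define Du where "Du x = t *\<^sub>R (LBINT y. \<Phi> y *\<^sub>R D\<kappa> (\<tau> x - y))" for x
  have u_deriv: "(u has_derivative (\<lambda>h. Du x \<bullet> h)) (at x)" for x
  proof -
    have "(\<tau> has_derivative (\<lambda>h. t *\<^sub>R h)) (at x)"
      unfolding \<tau>_def by (auto intro!: derivative_eq_intros)
    then have "((\<lambda>x. LBINT y. \<kappa> (\<tau> x - y) * \<Phi> y) has_derivative
      (\<lambda>h. (LBINT y. \<Phi> y *\<^sub>R D\<kappa> (\<tau> x - y)) \<bullet> (t *\<^sub>R h))) (at x)"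
      by (rule has_derivative_compose[OF _ convolution_has_derivative[OF \<Phi>1]])
    moreover have "u = (\<lambda>x. LBINT y. \<kappa> (\<tau> x - y) * \<Phi> y)"
      by (simp add: u_def contracted_average_def \<tau>_def fun_eq_iff)
    ultimately show ?thesis by (simp add: Du_def)
  qed
  have Du_cont: "continuous_on UNIV Du"
  proof -
    have "continuous_on UNIV \<tau>" unfolding \<tau>_def by (intro continuous_intros)
    then show ?thesis unfolding Du_def
      by (intro continuous_intros continuous_on_compose2[OF convolution_derivative_continuous[OF \<Phi>1]]) auto
  qed
  define gn where "gn x = norm (G x)" for x
  have gn [measurable]: "gn \<in> borel_measurable borel" unfolding gn_def by measurable
  have gn2: "integrable lborel (\<lambda>x. (gn x)^2)" using G2 by (simp add: gn_def)
  have \<kappa>G: "integrable lborel (\<lambda>y. \<kappa> (z - y) *\<^sub>R G y)" for z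
    by (rule Bochner_Integration.integrable_bound[OF contracted_average_L2(4)[OF t(3) gn gn2, of z]])
      (auto simp: gn_def)
  \<comment> \<open>The derivative falls on the kernel, and the weak gradient moves it onto
    \<open>\<Phi>\<close>. The sign from the reflected kernel cancels the sign from the integration
    by parts.\<close>
  have Du_eq: "Du x = t *\<^sub>R (LBINT y. \<kappa> (\<tau> x - y) *\<^sub>R G y)" if x: "x \<in> \<Omega>" for x
  proof (rule euclidean_eqI)
    fix b :: 'a assume b: "b \<in> Basis"
    have fd: "frechet_derivative (\<lambda>y. \<kappa> (\<tau> x - y)) (at y) b = - (D\<kappa> (\<tau> x - y) \<bullet> b)" for y
    proof -
      have "((\<lambda>y. \<tau> x - y) has_derivative (\<lambda>h. - h)) (at y)" by (auto intro!: derivative_eq_intros)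
      from has_derivative_compose[OF this \<kappa>_deriv]
      have "((\<lambda>y. \<kappa> (\<tau> x - y)) has_derivative (\<lambda>h. D\<kappa> (\<tau> x - y) \<bullet> (- h))) (at y)" .
      from frechet_derivative_at[OF this] show ?thesis by (metis inner_minus_right)
    qed
    have "Du x \<bullet> b = t * - (LBINT y. \<Phi> y * frechet_derivative (\<lambda>y. \<kappa> (\<tau> x - y)) (at y) b)"
      using D\<kappa>_scaleR_integrable[OF \<Phi>1, of "\<tau> x"] by (simp add: Du_def fd integral_inner_left[symmetric])
    also have "(LBINT y. \<Phi> y * frechet_derivative (\<lambda>y. \<kappa> (\<tau> x - y)) (at y) b) = - (LBINT y. (G y \<bullet> b) * \<kappa> (\<tau> x - y))"
      using weak[OF k(8)[OF window[OF x]] b] .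
    also have "t * - (- (LBINT y. (G y \<bullet> b) * \<kappa> (\<tau> x - y))) = (t *\<^sub>R (LBINT y. \<kappa> (\<tau> x - y) *\<^sub>R G y)) \<bullet> b"
      using \<kappa>G[of "\<tau> x"] by (simp add: integral_inner_left[symmetric] mult.commute)
    finally show "Du x \<bullet> b = (t *\<^sub>R (LBINT y. \<kappa> (\<tau> x - y) *\<^sub>R G y)) \<bullet> b" .
  qed
  have Du_le: "(norm (Du x))^2 \<le> (contracted_average \<kappa> c t gn x)^2" if x: "x \<in> \<Omega>" for x
  proof (rule power_mono)
    have "norm (Du x) \<le> 1 * norm (LBINT y. \<kappa> (\<tau> x - y) *\<^sub>R G y)"
      unfolding Du_eq[OF x] using t by (simp add: mult_left_le_one_le)
    also have "\<dots> \<le> 1 * (LBINT y. norm (\<kappa> (\<tau> x - y) *\<^sub>R G y))"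
      by (intro mult_left_mono integral_norm_bound) simp
    also have "\<dots> = contracted_average \<kappa> c t gn x"
      by (simp add: contracted_average_def \<tau>_def gn_def \<kappa>_nonneg)
    finally show "norm (Du x) \<le> contracted_average \<kappa> c t gn x" .
  qed simp
  have Du_int: "(LBINT x:\<Omega>. (norm (Du x))^2) \<le> (1 + \<delta>) * (LBINT x. (norm (G x))^2)"
  proof -
    have [measurable]: "Du \<in> borel_measurable borel" using Du_cont by (rule borel_measurable_continuous_onI)
    have le: "indicator \<Omega> x *\<^sub>R (norm (Du x))^2 \<le> (contracted_average \<kappa> c t gn x)^2" for x
      using Du_le[of x] by (cases "x \<in> \<Omega>") auto
    have i: "integrable lborel (\<lambda>x. (contracted_average \<kappa> c t gn x)^2)"
      by (rule contracted_average_L2(2)[OF t(3) gn gn2])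
    have "(LBINT x:\<Omega>. (norm (Du x))^2) \<le> (LBINT x. (contracted_average \<kappa> c t gn x)^2)"
      unfolding set_lebesgue_integral_def
    proof (rule integral_mono[OF _ i le])
      show "integrable lborel (\<lambda>x. indicator \<Omega> x *\<^sub>R (norm (Du x))^2)"
        by (rule Bochner_Integration.integrable_bound[OF i]) (use le in \<open>auto simp: abs_mult\<close>)
    qed
    also have "\<dots> \<le> 1 / t ^ DIM('a) * (LBINT x. (gn x)^2)"
      by (rule contracted_average_L2(3)[OF t(3) gn gn2])
    also have "\<dots> \<le> (1 + \<delta>) * (LBINT x. (gn x)^2)"
      using t(1) by (intro mult_right_mono) auto
    finally show ?thesis by (simp add: gn_def)
  qed
  define R where "R x = \<Phi> x - \<theta>1 x" for x
  have R [measurable]: "R \<in> borel_measurable borel" unfolding R_def by measurable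
  have R2: "integrable lborel (\<lambda>x. (R x)^2)" "(LBINT x. (R x)^2) < \<eta>^2"
    using \<theta>(2,3) by (auto simp: R_def \<theta>1_def)
  define MR where "MR = contracted_average \<kappa> c t R"
  note MR = contracted_average_L2[OF t(3) R R2(1), of c, folded MR_def]
  have sR: "sqrt (LBINT x. (R x)^2) \<le> \<eta>"
    using R2(2) \<eta>(1) by (intro real_le_lsqrt) auto
  have sMR: "sqrt (LBINT x. (MR x)^2) \<le> 2 * \<eta>"
  proof (rule real_le_lsqrt)
    have "(LBINT x. (MR x)^2) \<le> 1 / t ^ DIM('a) * (LBINT x. (R x)^2)" by (rule MR(3))
    also have "\<dots> \<le> 4 * \<eta>^2" using t(1) R2(2) by (intro mult_mono) auto
    finally show "(LBINT x. (MR x)^2) \<le> (2 * \<eta>)^2" by simp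
  qed (use \<eta>(1) in auto)
  \<comment> \<open>On \<open>\<Omega>\<close>, \<open>u - \<Phi>\<close> equals
    \<open>MR + E - R\<close>: \<open>R\<close> is the error of the continuous approximation,
    \<open>MR\<close> the average of that error, and \<open>E\<close> the error of averaging the
    continuous part, small by uniform continuity.\<close>
  define E where "E x = indicator \<Omega> x * (u x - MR x - \<theta>1 x)" for x
  have u_meas [measurable]: "u \<in> borel_measurable borel"
    unfolding u_def by (rule contracted_average_L2(1)[OF t(3) \<Phi> \<Phi>2])
  have MR_meas [measurable]: "MR \<in> borel_measurable borel" by (rule MR(1))
  have E_meas [measurable]: "E \<in> borel_measurable borel" unfolding E_def by measurable
  have E_le: "\<bar>E x\<bar> \<le> \<omega> * indicator \<Omega> x" for x
  proof (cases "x \<in> \<Omega>")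
    case True
    have i: "integrable lborel (\<lambda>y. \<kappa> (\<tau> x - y) * \<Phi> y)" "integrable lborel (\<lambda>y. \<kappa> (\<tau> x - y) * R y)"
      by (rule contracted_average_L2(4)[OF t(3) \<Phi> \<Phi>2] contracted_average_L2(4)[OF t(3) R R2(1)])+
    have "E x = (LBINT y. \<kappa> (\<tau> x - y) * \<Phi> y) - (LBINT y. \<kappa> (\<tau> x - y) * R y) - \<theta> x * (LBINT y. \<kappa> (\<tau> x - y))"
      using True by (simp add: E_def u_def MR_def contracted_average_def \<tau>_def \<theta>1_def \<kappa>_reflect)
    also have "\<dots> = (LBINT y. \<kappa> (\<tau> x - y) * \<Phi> y - \<kappa> (\<tau> x - y) * R y - \<theta> x * \<kappa> (\<tau> x - y))"
      using i \<kappa>_reflect(1)[of "\<tau> x"] by simp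
    also have "norm \<dots> \<le> (LBINT y. \<omega> * \<kappa> (\<tau> x - y))"
    proof (rule order_trans[OF integral_norm_bound integral_mono])
      show "integrable lborel (\<lambda>y. norm (\<kappa> (\<tau> x - y) * \<Phi> y - \<kappa> (\<tau> x - y) * R y - \<theta> x * \<kappa> (\<tau> x - y)))"
        "integrable lborel (\<lambda>y. \<omega> * \<kappa> (\<tau> x - y))"
        using i \<kappa>_reflect(1)[of "\<tau> x"] by simp_all
      show "norm (\<kappa> (\<tau> x - y) * \<Phi> y - \<kappa> (\<tau> x - y) * R y - \<theta> x * \<kappa> (\<tau> x - y)) \<le> \<omega> * \<kappa> (\<tau> x - y)" for y
      proof (cases "norm (\<tau> x - y) < e")
        case near: True
        have y: "y \<in> \<Omega>" using window[OF True] near by (auto simp: dist_norm)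
        have "dist y x \<le> dist y (\<tau> x) + dist (\<tau> x) x" by (rule dist_triangle)
        also have "\<dots> \<le> (1 - t) * \<rho> + (1 - t) * D"
          using near e \<tau>_near[OF True] by (intro add_mono) (auto simp: dist_norm norm_minus_commute)
        finally have "dist y x < d" using t(2) by (simp add: algebra_simps)
        then have "\<bar>\<theta> y - \<theta> x\<bar> < \<omega>"
          using d(2)[of x y] True y closure_subset[of \<Omega>] by (auto simp: dist_real_def)
        then have "\<bar>\<theta> y - \<theta> x\<bar> * \<kappa> (\<tau> x - y) \<le> \<omega> * \<kappa> (\<tau> x - y)"
          using \<kappa>_nonneg by (intro mult_right_mono) auto
        moreover have "\<kappa> (\<tau> x - y) * \<Phi> y - \<kappa> (\<tau> x - y) * R y - \<theta> x * \<kappa> (\<tau> x - y) = (\<theta> y - \<theta> x) * \<kappa> (\<tau> x - y)"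
          using y by (simp add: R_def \<theta>1_def algebra_simps)
        ultimately show ?thesis using \<kappa>_nonneg by (simp add: abs_mult)
      qed (simp add: \<kappa>_0)
    qed
    also have "\<dots> = \<omega>" by (simp add: \<kappa>_reflect)
    finally show ?thesis using True by simp
  qed (simp add: E_def)
  have E2_le: "(E x)^2 \<le> \<omega>^2 * indicator \<Omega> x" for x
    using power_mono[OF E_le[of x], of 2] by (cases "x \<in> \<Omega>") (simp_all add: E_def)
  have iw: "integrable lborel (\<lambda>x::'a. \<omega>^2 * indicator \<Omega> x)" using iO by simp
  have E2: "integrable lborel (\<lambda>x. (E x)^2)"
    by (rule Bochner_Integration.integrable_bound[OF iw]) (use E2_le in auto)
  have sE: "sqrt (LBINT x. (E x)^2) \<le> \<eta>"
  proof -
    have "(LBINT x. (E x)^2) \<le> (LBINT x::'a. \<omega>^2 * indicator \<Omega> x)"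
      using E2 iw E2_le by (rule integral_mono)
    also have "\<dots> = \<omega>^2 * V" by (simp add: V_def)
    finally have "sqrt (LBINT x. (E x)^2) \<le> sqrt (\<omega>^2 * V)" by (rule real_sqrt_le_mono)
    also have "\<dots> = \<omega> * sqrt V" using \<omega>(1) by (simp add: real_sqrt_mult)
    finally show ?thesis using \<omega>(2) by linarith
  qed
  have split: "\<Phi> x * u x = (\<Phi> x)^2 + \<Phi> x * MR x + \<Phi> x * E x - \<Phi> x * R x" for x
    by (cases "x \<in> \<Omega>") (simp_all add: \<Phi>0 E_def R_def power2_eq_square algebra_simps)
  have im: "integrable lborel (\<lambda>x. \<Phi> x * MR x)" "integrable lborel (\<lambda>x. \<Phi> x * E x)" "integrable lborel (\<lambda>x. \<Phi> x * R x)"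
    using \<Phi>2 MR(2) E2 R2 by (auto intro!: integrable_mult_L2)
  have "(LBINT x. \<Phi> x * u x) = (LBINT x. (\<Phi> x)^2) + (LBINT x. \<Phi> x * MR x) + (LBINT x. \<Phi> x * E x) - (LBINT x. \<Phi> x * R x)"
    unfolding split using im \<Phi>2 by simp
  moreover have "\<bar>LBINT x. \<Phi> x * MR x\<bar> \<le> A * (2 * \<eta>)"
    using Cauchy_Schwarz_integral[OF _ _ \<Phi>2 MR(2)] sMR A by (force simp: A_def intro: order_trans mult_left_mono)
  moreover have "\<bar>LBINT x. \<Phi> x * E x\<bar> \<le> A * \<eta>"
    using Cauchy_Schwarz_integral[OF _ _ \<Phi>2 E2] sE A by (force simp: A_def intro: order_trans mult_left_mono)
  moreover have "\<bar>LBINT x. \<Phi> x * R x\<bar> \<le> A * \<eta>"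
    using Cauchy_Schwarz_integral[OF _ _ \<Phi>2 R2(1)] sR A by (force simp: A_def intro: order_trans mult_left_mono)
  ultimately have "\<bar>(LBINT x. \<Phi> x * u x) - (LBINT x. (\<Phi> x)^2)\<bar> \<le> A * (2 * \<eta>) + A * \<eta> + A * \<eta>"
    by linarith
  then have "\<bar>(LBINT x. \<Phi> x * u x) - (LBINT x. (\<Phi> x)^2)\<bar> < \<delta>"
    using \<eta>(2) by (simp add: algebra_simps)
  then show thesis using that[OF u_deriv Du_cont _ Du_int] by blast
qed

section \<open>A Poincare inequality on convex sets\<close>

lemma LINT_fundamental_theorem:
  fixes f :: "real \<Rightarrow> real"
  assumes "a \<le> b" and f: "\<And>x. (f has_real_derivative f' x) (at x)" and f': "continuous_on UNIV f'"
  shows "(LBINT x:{a..b}. f' x) = f b - f a"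
proof -
  have "(f' has_integral (f b - f a)) {a..b}"
    using assms by (intro fundamental_theorem_of_calculus)
      (auto simp: has_real_derivative_iff_has_vector_derivative[symmetric] intro: has_field_derivative_at_within)
  moreover have "set_integrable lborel {a..b} f'"
    by (intro set_integrable_bounded_continuous f') auto
  ultimately show ?thesis
    using set_borel_integral_eq_integral(2)[of "{a..b}" f'] by (simp add: integral_unique)
qed

lemma increment_square_le:
  fixes f :: "real \<Rightarrow> real"
  assumes "a \<le> b" and f: "\<And>x. (f has_real_derivative f' x) (at x)" and f': "continuous_on UNIV f'"
  shows "(f b - f a)^2 \<le> (b - a) * (LBINT x:{a..b}. (f' x)^2)"
proof -
  have [measurable]: "f' \<in> borel_measurable borel" using f' by (rule borel_measurable_continuous_onI)
  have 1: "set_integrable lborel {a..b} (\<lambda>x. (f' x)^2)"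
    by (intro set_integrable_bounded_continuous continuous_intros f') auto
  define F where "F x = indicator {a..b} x * f' x" for x
  have F2: "(F x)^2 = indicator {a..b} x *\<^sub>R (f' x)^2" for x
    by (simp add: F_def indicator_def)
  have I2: "(indicator {a..b} x)^2 = (indicator {a..b} x :: real)" for x :: real
    by (simp add: indicator_def)
  have "\<bar>LBINT x. F x * indicator {a..b} x\<bar> \<le> sqrt (LBINT x. (F x)^2) * sqrt (LBINT x::real. (indicator {a..b} x)^2)"
    proof (rule Cauchy_Schwarz_integral)
    show "integrable lborel (\<lambda>x. (F x)^2)" using 1 unfolding F2 set_integrable_def .
    show "integrable lborel (\<lambda>x::real. (indicator {a..b} x)^2 :: real)"
      unfolding I2 by (intro integrable_real_indicator) (simp_all add: assms(1))
  qed (simp_all add: F_def[abs_def])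
  also have "(LBINT x. F x * indicator {a..b} x) = (LBINT x:{a..b}. f' x)"
    unfolding set_lebesgue_integral_def F_def by (intro Bochner_Integration.integral_cong) (auto simp: indicator_def)
  also have "\<dots> = f b - f a" by (rule LINT_fundamental_theorem[OF assms])
  also have "(LBINT x. (F x)^2) = (LBINT x:{a..b}. (f' x)^2)"
    unfolding set_lebesgue_integral_def F2 ..
  also have "(LBINT x::real. (indicator {a..b} x)^2) = b - a"
    unfolding I2 using assms(1) by simp
  finally have "\<bar>f b - f a\<bar>^2 \<le> (sqrt (LBINT x:{a..b}. (f' x)^2) * sqrt (b - a))^2"
    by (rule power_mono) simp
  moreover have "0 \<le> (LBINT x:{a..b}. (f' x)^2)"
    unfolding set_lebesgue_integral_def by (intro Bochner_Integration.integral_nonneg) simp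
  ultimately show ?thesis using assms(1) by (simp add: power_mult_distrib mult.commute)
qed

text \<open>
  The segment from \<open>x\<close> to \<open>y\<close> is split at its midpoint, because the substitution
  \<open>z = x + t(y - x)\<close> in \<open>y\<close> has bounded Jacobian only for \<open>t\<close> away from 0.
\<close>

lemma convex_poincare_inequality:
  fixes \<Omega> :: "'a::euclidean_space set"
  assumes \<Omega>: "open \<Omega>" "convex \<Omega>" "bounded \<Omega>" "\<Omega> \<noteq> {}"
  obtains C where "0 \<le> C"
    "\<And>u Du. \<lbrakk>\<And>x. (u has_derivative (\<lambda>h. Du x \<bullet> h)) (at x); continuous_on UNIV Du\<rbrakk> \<Longrightarrow>
      (LBINT x:\<Omega>. (u x - (LBINT y:\<Omega>. u y) / (LBINT y:\<Omega>. 1))^2) \<le> C * (LBINT x:\<Omega>. (norm (Du x))^2)"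
proof -
  define D where "D = diameter \<Omega>"
  have D: "norm (y - x) \<le> D" if "x \<in> \<Omega>" "y \<in> \<Omega>" for x y
    using diameter_bounded_bound[OF \<Omega>(3) that(2,1)] by (simp add: D_def dist_norm)
  \<comment> \<open>Each half of the segment contributes \<open>2 ^ DIM('a) / 2\<close> times the
    energy after integration; \<open>D^2\<close> bounds the squared length of the segment.\<close>
  define C where "C = 2 ^ DIM('a) * D^2"
  define V where "V = (LBINT y:\<Omega>. (1::real))"
  have V: "0 < V" unfolding V_def by (rule LINT_one_pos[OF \<Omega>(1,3,4)])
  have [measurable]: "\<Omega> \<in> sets borel" using \<Omega> by simp
  have emO: "emeasure lborel \<Omega> < \<infinity>" using \<Omega> by (intro emeasure_bounded_finite)
  then have emV: "emeasure lborel \<Omega> = ennreal V"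
    by (simp add: V_def set_lebesgue_integral_def emeasure_eq_ennreal_measure less_top[symmetric])
  show thesis
  proof (rule that[of C])
    show "0 \<le> C" by (simp add: C_def)
    fix u :: "'a \<Rightarrow> real" and Du :: "'a \<Rightarrow> 'a"
    assume u: "\<And>x. (u has_derivative (\<lambda>h. Du x \<bullet> h)) (at x)" and Du: "continuous_on UNIV Du"
    have u_cont: "continuous_on UNIV u"
      by (intro continuous_at_imp_continuous_on ballI has_derivative_continuous[OF u])
    have [measurable]: "u \<in> borel_measurable borel" "Du \<in> borel_measurable borel"
      using u_cont Du by (auto intro: borel_measurable_continuous_onI)
    define H where "H z = indicator \<Omega> z * (norm (Du z))^2" for z
    have H0: "0 \<le> H z" for z by (simp add: H_def)
    have [measurable]: "H \<in> borel_measurable borel" unfolding H_def by measurable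
    define I where "I = (LBINT z:\<Omega>. (norm (Du z))^2)"
    have I0: "0 \<le> I" unfolding I_def set_lebesgue_integral_def by (intro Bochner_Integration.integral_nonneg) simp
    have H_int: "(\<integral>\<^sup>+z. H z \<partial>lborel) = ennreal I"
    proof -
      have "set_integrable lborel \<Omega> (\<lambda>z. (norm (Du z))^2)"
        using \<Omega> by (intro set_integrable_bounded_continuous continuous_intros Du) auto
      then show ?thesis
        using nn_integral_eq_integral[of lborel H] H0
        by (simp add: I_def H_def[abs_def] set_integrable_def set_lebesgue_integral_def)
    qed
    \<comment> \<open>The energy along the half of the segment nearer to \<open>y\<close>. It will
      be integrated over \<open>y\<close> with \<open>x\<close> fixed, where
      \<open>t \<ge> 1 / 2\<close> bounds the Jacobian by \<open>2 ^ DIM('a)\<close>.\<close>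
    define A where "A x y = (\<integral>\<^sup>+t. indicator {1/2..1} t * ennreal (H (x + t *\<^sub>R (y - x))) \<partial>lborel)" for x y
    have half: "ennreal ((u y - u ((1/2) *\<^sub>R (x + y)))^2) \<le> ennreal (D^2 / 2) * A x y"
      if xy: "x \<in> \<Omega>" "y \<in> \<Omega>" for x y
    proof -
      define f where "f t = u (x + t *\<^sub>R (y - x))" for t
      define f' where "f' t = Du (x + t *\<^sub>R (y - x)) \<bullet> (y - x)" for t
      have f: "(f has_real_derivative f' t) (at t)" for t
      proof -
        have "((\<lambda>t. x + t *\<^sub>R (y - x)) has_derivative (\<lambda>h. h *\<^sub>R (y - x))) (at t)"
          by (auto intro!: derivative_eq_intros)
        from has_derivative_compose[OF this u] show ?thesis
          by (simp add: f_def[abs_def] f'_def has_field_derivative_def mult_commute_abs)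
      qed
      have f'_cont: "continuous_on UNIV f'"
        unfolding f'_def by (intro continuous_intros continuous_on_compose2[OF Du]) auto
      have [measurable]: "f' \<in> borel_measurable borel" using f'_cont by (rule borel_measurable_continuous_onI)
      have f1: "f 1 = u y" by (simp add: f_def)
      have "x + (1/2) *\<^sub>R (y - x) = (1/2) *\<^sub>R (x + y)" by (simp add: algebra_simps flip: scaleR_add_left)
      then have f2: "f (1/2) = u ((1/2) *\<^sub>R (x + y))" by (simp add: f_def)
      have "(f 1 - f (1/2))^2 \<le> (1 - 1/2) * (LBINT t:{1/2..1}. (f' t)^2)"
        by (rule increment_square_le[OF _ f f'_cont]) simp
      then have "ennreal ((u y - u ((1/2) *\<^sub>R (x + y)))^2) \<le> ennreal (1/2 * (LBINT t:{1/2..1}. (f' t)^2))"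
        using f1 f2 by (intro ennreal_leI) simp
      also have "\<dots> = ennreal (1/2) * (\<integral>\<^sup>+t. ennreal (indicator {1/2..1} t *\<^sub>R (f' t)^2) \<partial>lborel)"
      proof -
        have "set_integrable lborel {1/2..1} (\<lambda>t. (f' t)^2)"
          by (intro set_integrable_bounded_continuous continuous_intros f'_cont) auto
        then have "(\<integral>\<^sup>+t. ennreal (indicator {1/2..1} t *\<^sub>R (f' t)^2) \<partial>lborel) = ennreal (LBINT t:{1/2..1}. (f' t)^2)"
          unfolding set_integrable_def set_lebesgue_integral_def by (intro nn_integral_eq_integral) auto
        then show ?thesis by (simp only: ennreal_mult'[of "1/2"] zero_le_divide_1_iff zero_le_numeral)
      qed
      also have "\<dots> \<le> ennreal (1/2) * (\<integral>\<^sup>+t. ennreal (D^2) * (indicator {1/2..1} t * ennreal (H (x + t *\<^sub>R (y - x)))) \<partial>lborel)"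
      proof (intro mult_left_mono nn_integral_mono)
        fix t :: real
        show "ennreal (indicator {1/2..1} t *\<^sub>R (f' t)^2) \<le> ennreal (D^2) * (indicator {1/2..1} t * ennreal (H (x + t *\<^sub>R (y - x))))"
        proof (cases "t \<in> {1/2..1}")
          case True
          have "(1 - t) *\<^sub>R x + t *\<^sub>R y \<in> \<Omega>" using True xy by (intro convexD_alt \<Omega>) auto
          then have in_\<Omega>: "x + t *\<^sub>R (y - x) \<in> \<Omega>" by (simp add: algebra_simps)
          have "\<bar>f' t\<bar> \<le> norm (Du (x + t *\<^sub>R (y - x))) * norm (y - x)"
            unfolding f'_def by (rule Cauchy_Schwarz_ineq2)
          also have "\<dots> \<le> norm (Du (x + t *\<^sub>R (y - x))) * D"
            using D[OF xy] by (intro mult_left_mono) auto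
          finally have "\<bar>f' t\<bar>^2 \<le> (norm (Du (x + t *\<^sub>R (y - x))) * D)^2" by (rule power_mono) simp
          then have "(f' t)^2 \<le> D^2 * H (x + t *\<^sub>R (y - x))"
            using in_\<Omega> by (simp add: H_def power_mult_distrib mult.commute)
          then show ?thesis using True H0 by (simp add: ennreal_mult[symmetric] ennreal_leI)
        qed simp
      qed simp
      also have "\<dots> = ennreal (D^2 / 2) * A x y"
      proof -
        have "ennreal (D^2 / 2) = ennreal (1/2) * ennreal (D^2)"
          using ennreal_mult'[of "1/2" "D^2"] by simp
        then show ?thesis
          unfolding A_def by (subst nn_integral_cmult) (simp_all only: mult.assoc, measurable)
      qed
      finally show ?thesis .
    qed
    have pair: "ennreal ((u x - u y)^2) \<le> ennreal (D^2) * (A x y + A y x)" if xy: "x \<in> \<Omega>" "y \<in> \<Omega>" for x y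
    proof -
      define m where "m = u ((1/2) *\<^sub>R (x + y))"
      have "(u x - u y)^2 \<le> 2 * (u y - m)^2 + 2 * (u x - m)^2"
        using zero_le_power2[of "u x + u y - 2 * m"] by (simp add: power2_eq_square algebra_simps)
      then have "ennreal ((u x - u y)^2) \<le> ennreal (2 * (u y - m)^2 + 2 * (u x - m)^2)" by (rule ennreal_leI)
      also have "\<dots> = 2 * ennreal ((u y - m)^2) + 2 * ennreal ((u x - m)^2)"
        by (simp add: ennreal_plus ennreal_mult')
      also have "\<dots> \<le> 2 * (ennreal (D^2 / 2) * A x y) + 2 * (ennreal (D^2 / 2) * A y x)"
        using half[OF xy] half[OF xy(2,1)] by (intro add_mono mult_left_mono) (auto simp: m_def add.commute)
      also have "\<dots> = ennreal (2 * (D^2 / 2)) * (A x y + A y x)"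
        by (subst ennreal_mult) (auto simp: distrib_left mult.assoc)
      finally show ?thesis by simp
    qed
    have A_meas [measurable]: "case_prod A \<in> borel_measurable (borel \<Otimes>\<^sub>M borel)"
      unfolding A_def by measurable
    have A_le: "(\<integral>\<^sup>+y. A x y \<partial>lborel) \<le> ennreal (2 ^ DIM('a) / 2 * I)" for x
    proof -
      have "(\<integral>\<^sup>+y. A x y \<partial>lborel) = (\<integral>\<^sup>+t. (\<integral>\<^sup>+y. indicator {1/2..1} t * ennreal (H (x + t *\<^sub>R (y - x))) \<partial>lborel) \<partial>lborel)"
        unfolding A_def by (rule lborel_pair.Fubini') measurable
      also have "\<dots> \<le> (\<integral>\<^sup>+t. indicator {1/2..1::real} t * ennreal (2 ^ DIM('a) * I) \<partial>lborel)"
      proof (rule nn_integral_mono)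
        fix t :: real
        show "(\<integral>\<^sup>+y. indicator {1/2..1} t * ennreal (H (x + t *\<^sub>R (y - x))) \<partial>lborel) \<le> indicator {1/2..1} t * ennreal (2 ^ DIM('a) * I)"
        proof (cases "t \<in> {1/2..1}")
          case True
          have "(\<integral>\<^sup>+y. ennreal (H (x + t *\<^sub>R (y - x))) \<partial>lborel) = (\<integral>\<^sup>+y. ennreal (H ((x - t *\<^sub>R x) + t *\<^sub>R y)) \<partial>lborel)"
            by (intro nn_integral_cong) (simp add: algebra_simps)
          also have "\<dots> = ennreal (1 / t ^ DIM('a)) * ennreal I"
            using True by (subst nn_integral_affine) (auto simp: H_int)
          also have "\<dots> \<le> ennreal (2 ^ DIM('a)) * ennreal I"
          proof (intro mult_right_mono ennreal_leI)
            have "(1 / 2) ^ DIM('a) \<le> t ^ DIM('a)" using True by (intro power_mono) auto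
            then have "1 / t ^ DIM('a) \<le> 1 / (1 / 2) ^ DIM('a)" by (intro divide_left_mono) (use True in auto)
            then show "1 / t ^ DIM('a) \<le> 2 ^ DIM('a)" by (simp add: power_divide)
          qed simp
          finally show ?thesis using True I0 by (simp add: ennreal_mult)
        qed simp
      qed
      also have "\<dots> = ennreal (2 ^ DIM('a) / 2 * I)"
      proof -
        have "ennreal (1/2) * ennreal (2 ^ DIM('a) * I) = ennreal (1/2 * (2 ^ DIM('a) * I))"
          by (rule ennreal_mult'[symmetric]) simp
        then show ?thesis by (simp add: nn_integral_multc)
      qed
      finally show ?thesis .
    qed
    define m where "m = (LBINT y:\<Omega>. u y) / V"
    \<comment> \<open>Jensen's inequality for the uniform distribution on \<open>\<Omega>\<close>:
      the deviation from the mean is controlled by differences of two values of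
      \<open>u\<close>.\<close>
    have point: "ennreal (V * (u x - m)^2) \<le> (\<integral>\<^sup>+y. indicator \<Omega> y * ennreal ((u x - u y)^2) \<partial>lborel)" for x
    proof -
      have k1: "integrable lborel (\<lambda>y. indicator \<Omega> y / V)"
        using emO by simp
      have k2: "(LBINT y. indicator \<Omega> y / V) = 1"
        using V by (simp add: V_def set_lebesgue_integral_def)
      have si: "set_integrable lborel \<Omega> (\<lambda>y. (u x - u y)^2)" "set_integrable lborel \<Omega> (\<lambda>y. u x * 1 :: real)" "set_integrable lborel \<Omega> u"
        using \<Omega> by (auto intro!: set_integrable_bounded_continuous continuous_intros u_cont)
      have k3: "integrable lborel (\<lambda>y. indicator \<Omega> y / V * (u x - u y)^2)"
        using si(1) by (simp add: set_integrable_def)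
      have "(LBINT y. indicator \<Omega> y / V * (u x - u y)) = (LBINT y:\<Omega>. u x * 1 - u y) / V"
        by (simp add: set_lebesgue_integral_def)
      also have "(LBINT y:\<Omega>. u x * 1 - u y) = u x * V - (LBINT y:\<Omega>. u y)"
        using si(2,3) unfolding V_def by (subst set_integral_diff(2)) (auto simp only: set_integral_mult_right)
      also have "\<dots> / V = u x - m" using V by (simp add: m_def diff_divide_distrib)
      finally have "(u x - m)^2 \<le> (LBINT y. indicator \<Omega> y / V * (u x - u y)^2)"
        using weighted_Jensen_square(2)[OF _ k1 k2 _ k3] V by simp
      also have "\<dots> = (LBINT y:\<Omega>. (u x - u y)^2) / V" by (simp add: set_lebesgue_integral_def)
      finally have "V * (u x - m)^2 \<le> (LBINT y:\<Omega>. (u x - u y)^2)"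
        using V by (simp add: field_simps)
      then have "ennreal (V * (u x - m)^2) \<le> ennreal (LBINT y:\<Omega>. (u x - u y)^2)" by (rule ennreal_leI)
      also have "\<dots> = (\<integral>\<^sup>+y. ennreal (indicator \<Omega> y *\<^sub>R (u x - u y)^2) \<partial>lborel)"
        using si(1) unfolding set_lebesgue_integral_def set_integrable_def
        by (intro nn_integral_eq_integral[symmetric]) auto
      also have "\<dots> = (\<integral>\<^sup>+y. indicator \<Omega> y * ennreal ((u x - u y)^2) \<partial>lborel)"
        by (intro nn_integral_cong) (auto simp: indicator_def)
      finally show ?thesis .
    qed
    have half_int: "(\<integral>\<^sup>+x. indicator \<Omega> x * (\<integral>\<^sup>+y. A x y \<partial>lborel) \<partial>lborel) \<le> ennreal (V * (2 ^ DIM('a) / 2 * I))"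
    proof -
      have "(\<integral>\<^sup>+x. indicator \<Omega> x * (\<integral>\<^sup>+y. A x y \<partial>lborel) \<partial>lborel) \<le> (\<integral>\<^sup>+x. indicator \<Omega> x * ennreal (2 ^ DIM('a) / 2 * I) \<partial>lborel)"
        by (intro nn_integral_mono mult_left_mono A_le) simp
      also have "\<dots> = ennreal (V * (2 ^ DIM('a) / 2 * I))"
        using V I0 by (simp add: nn_integral_multc emV ennreal_mult[symmetric])
      finally show ?thesis .
    qed
    have "(\<integral>\<^sup>+x. indicator \<Omega> x * ennreal (V * (u x - m)^2) \<partial>lborel)
      \<le> (\<integral>\<^sup>+x. (\<integral>\<^sup>+y. ennreal (D^2) * (indicator \<Omega> x * A x y + indicator \<Omega> y * A y x) \<partial>lborel) \<partial>lborel)"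
    proof (rule nn_integral_mono)
      fix x :: 'a
      show "indicator \<Omega> x * ennreal (V * (u x - m)^2) \<le> (\<integral>\<^sup>+y. ennreal (D^2) * (indicator \<Omega> x * A x y + indicator \<Omega> y * A y x) \<partial>lborel)"
      proof (cases "x \<in> \<Omega>")
        case True
        have "indicator \<Omega> x * ennreal (V * (u x - m)^2) \<le> (\<integral>\<^sup>+y. indicator \<Omega> y * ennreal ((u x - u y)^2) \<partial>lborel)"
          using point[of x] True by simp
        also have "\<dots> \<le> (\<integral>\<^sup>+y. ennreal (D^2) * (indicator \<Omega> x * A x y + indicator \<Omega> y * A y x) \<partial>lborel)"
        proof (rule nn_integral_mono)
          fix y
          show "indicator \<Omega> y * ennreal ((u x - u y)^2) \<le> ennreal (D^2) * (indicator \<Omega> x * A x y + indicator \<Omega> y * A y x)"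
            using pair[OF True, of y] True by (cases "y \<in> \<Omega>") auto
        qed
        finally show ?thesis .
      qed simp
    qed
    also have "\<dots> = ennreal (D^2) * ((\<integral>\<^sup>+x. (\<integral>\<^sup>+y. indicator \<Omega> x * A x y \<partial>lborel) \<partial>lborel) + (\<integral>\<^sup>+x. (\<integral>\<^sup>+y. indicator \<Omega> y * A y x \<partial>lborel) \<partial>lborel))"
      by (simp add: nn_integral_cmult nn_integral_add)
    \<comment> \<open>For the half of the segment nearer to \<open>x\<close> the good integration
      variable is \<open>x\<close>; exchanging the order of integration reduces it to the other
      half.\<close>
    also have "(\<integral>\<^sup>+x. (\<integral>\<^sup>+y. indicator \<Omega> y * A y x \<partial>lborel) \<partial>lborel) = (\<integral>\<^sup>+y. (\<integral>\<^sup>+x. indicator \<Omega> y * A y x \<partial>lborel) \<partial>lborel)"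
      by (rule lborel_pair.Fubini') measurable
    also have "(\<integral>\<^sup>+x. (\<integral>\<^sup>+y. indicator \<Omega> x * A x y \<partial>lborel) \<partial>lborel) = (\<integral>\<^sup>+x. indicator \<Omega> x * (\<integral>\<^sup>+y. A x y \<partial>lborel) \<partial>lborel)"
      by (intro nn_integral_cong nn_integral_cmult) measurable
    also have "ennreal (D^2) * ((\<integral>\<^sup>+x. indicator \<Omega> x * (\<integral>\<^sup>+y. A x y \<partial>lborel) \<partial>lborel) + (\<integral>\<^sup>+x. indicator \<Omega> x * (\<integral>\<^sup>+y. A x y \<partial>lborel) \<partial>lborel))
      \<le> ennreal (D^2) * (ennreal (V * (2 ^ DIM('a) / 2 * I)) + ennreal (V * (2 ^ DIM('a) / 2 * I)))"
      by (intro mult_left_mono add_mono half_int) simp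
    also have "\<dots> = ennreal (V * (C * I))"
      using V I0 by (simp add: ennreal_plus[symmetric] ennreal_mult[symmetric] C_def field_simps del: ennreal_plus)
    finally have nn: "(\<integral>\<^sup>+x. indicator \<Omega> x * ennreal (V * (u x - m)^2) \<partial>lborel) \<le> ennreal (V * (C * I))" .
    have si: "set_integrable lborel \<Omega> (\<lambda>x. V * (u x - m)^2)"
      using \<Omega> by (auto intro!: set_integrable_bounded_continuous continuous_intros u_cont)
    have "ennreal (LBINT x:\<Omega>. V * (u x - m)^2) = (\<integral>\<^sup>+x. ennreal (indicator \<Omega> x *\<^sub>R (V * (u x - m)^2)) \<partial>lborel)"
      using si V unfolding set_lebesgue_integral_def set_integrable_def
      by (intro nn_integral_eq_integral[symmetric]) auto
    also have "\<dots> = (\<integral>\<^sup>+x. indicator \<Omega> x * ennreal (V * (u x - m)^2) \<partial>lborel)"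
      by (intro nn_integral_cong) (auto simp: indicator_def)
    finally have "ennreal (LBINT x:\<Omega>. V * (u x - m)^2) \<le> ennreal (V * (C * I))" using nn by simp
    then have "V * (LBINT x:\<Omega>. (u x - m)^2) \<le> V * (C * I)"
      using V I0 by (subst (asm) ennreal_le_iff) (auto simp: C_def)
    then have "(LBINT x:\<Omega>. (u x - m)^2) \<le> C * I" using V by (rule mult_left_le_imp_le)
    then show "(LBINT x:\<Omega>. (u x - (LBINT y:\<Omega>. u y) / (LBINT y:\<Omega>. 1))^2) \<le> C * (LBINT x:\<Omega>. (norm (Du x))^2)"
      by (simp add: m_def V_def I_def)
  qed
qed

text \<open>The comparison function \<open>m\<close> is left open except for its orthogonality to
  \<open>\<Phi>\<close> and the estimate on smooth functions. Constants serve for the Poincare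
  constant of \<open>\<Omega>\<close>, slice means for the slab problem.\<close>

lemma poincare_by_approximation:
  fixes \<Phi> :: "'a::euclidean_space \<Rightarrow> real" and G :: "'a \<Rightarrow> 'a"
  assumes \<Omega>: "open \<Omega>" "convex \<Omega>" "bounded \<Omega>" "\<Omega> \<noteq> {}"
    and \<Phi>[measurable]: "\<Phi> \<in> borel_measurable borel" and \<Phi>2: "integrable lborel (\<lambda>x. (\<Phi> x)^2)"
    and \<Phi>0: "\<And>x. x \<notin> \<Omega> \<Longrightarrow> \<Phi> x = 0"
    and G[measurable]: "G \<in> borel_measurable borel" and G2: "integrable lborel (\<lambda>x. (norm (G x))^2)"
    and weak: "\<And>\<psi> b. \<psi> \<in> test_functions \<Omega> \<Longrightarrow> b \<in> Basis \<Longrightarrow>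
      (LBINT x. \<Phi> x * frechet_derivative \<psi> (at x) b) = - (LBINT x. (G x \<bullet> b) * \<psi> x)"
    and C: "0 \<le> C"
    and smooth: "\<And>u Du. \<lbrakk>\<And>x. (u has_derivative (\<lambda>h. Du x \<bullet> h)) (at x); continuous_on UNIV Du\<rbrakk> \<Longrightarrow>
      \<exists>m. m \<in> borel_measurable borel \<and> integrable lborel (\<lambda>x. \<Phi> x * m x) \<and> (LBINT x. \<Phi> x * m x) = 0 \<and>
        set_integrable lborel \<Omega> (\<lambda>x. (u x - m x)^2) \<and>
        (LBINT x:\<Omega>. (u x - m x)^2) \<le> C^2 * (LBINT x:\<Omega>. (norm (Du x))^2)"
  shows "sqrt (LBINT x. (\<Phi> x)^2) \<le> C * sqrt (LBINT x. (norm (G x))^2)"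
proof -
  define I where "I = (LBINT x. (\<Phi> x)^2)"
  define g where "g = (LBINT x. (norm (G x))^2)"
  have I0: "0 \<le> I" and g0: "0 \<le> g" by (simp_all add: I_def g_def)
  have [measurable]: "\<Omega> \<in> sets borel" using \<Omega> by simp
  have step: "I - \<delta> \<le> sqrt I * (C * sqrt ((1 + \<delta>) * g))" if \<delta>: "0 < \<delta>" for \<delta>
  proof -
    obtain u Du where u: "\<And>x. (u has_derivative (\<lambda>h. Du x \<bullet> h)) (at x)" "continuous_on UNIV Du"
      "\<bar>(LBINT x. \<Phi> x * u x) - (LBINT x. (\<Phi> x)^2)\<bar> < \<delta>"
      "(LBINT x:\<Omega>. (norm (Du x))^2) \<le> (1 + \<delta>) * (LBINT x. (norm (G x))^2)"
      by (rule smooth_approximation[OF \<Omega> \<Phi> \<Phi>2 \<Phi>0 G G2 weak \<delta>]) blast+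
    obtain m where m: "m \<in> borel_measurable borel" "integrable lborel (\<lambda>x. \<Phi> x * m x)" "(LBINT x. \<Phi> x * m x) = 0"
      "set_integrable lborel \<Omega> (\<lambda>x. (u x - m x)^2)"
      "(LBINT x:\<Omega>. (u x - m x)^2) \<le> C^2 * (LBINT x:\<Omega>. (norm (Du x))^2)"
      using smooth[OF u(1,2)] by blast
    have u_cont: "continuous_on UNIV u"
      by (intro continuous_at_imp_continuous_on ballI has_derivative_continuous[OF u(1)])
    have [measurable]: "u \<in> borel_measurable borel" "m \<in> borel_measurable borel"
      using u_cont m(1) by (auto intro: borel_measurable_continuous_onI)
    define v where "v x = indicator \<Omega> x * (u x - m x)" for x
    have [measurable]: "v \<in> borel_measurable borel" unfolding v_def by measurable
    have v2: "(v x)^2 = indicator \<Omega> x *\<^sub>R (u x - m x)^2" for x by (simp add: v_def indicator_def)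
    have v2_int: "integrable lborel (\<lambda>x. (v x)^2)" using m(4) unfolding v2 set_integrable_def .
    have \<Phi>v: "integrable lborel (\<lambda>x. \<Phi> x * v x)" by (rule integrable_mult_L2) (use \<Phi>2 v2_int in auto)
    have "\<Phi> x * u x = \<Phi> x * v x + \<Phi> x * m x" for x
      by (cases "x \<in> \<Omega>") (simp_all add: v_def \<Phi>0 algebra_simps)
    then have "(LBINT x. \<Phi> x * u x) = (LBINT x. \<Phi> x * v x)"
      using \<Phi>v m(2,3) by simp
    then have "I - \<delta> \<le> \<bar>LBINT x. \<Phi> x * v x\<bar>" using u(3) unfolding I_def by linarith
    also have "\<dots> \<le> sqrt I * sqrt (LBINT x. (v x)^2)"
      unfolding I_def by (rule Cauchy_Schwarz_integral) (use \<Phi>2 v2_int in auto)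
    also have "\<dots> \<le> sqrt I * sqrt (C^2 * ((1 + \<delta>) * g))"
    proof (intro mult_left_mono real_sqrt_le_mono)
      have "(LBINT x. (v x)^2) = (LBINT x:\<Omega>. (u x - m x)^2)"
        unfolding v2 set_lebesgue_integral_def ..
      also have "\<dots> \<le> C^2 * (LBINT x:\<Omega>. (norm (Du x))^2)" by (rule m(5))
      also have "\<dots> \<le> C^2 * ((1 + \<delta>) * g)" using u(4) unfolding g_def by (intro mult_left_mono) auto
      finally show "(LBINT x. (v x)^2) \<le> C^2 * ((1 + \<delta>) * g)" .
    qed (use I0 in simp)
    also have "sqrt (C^2 * ((1 + \<delta>) * g)) = C * sqrt ((1 + \<delta>) * g)" using C by (simp add: real_sqrt_mult)
    finally show ?thesis .
  qed
  have "I - 0 \<le> sqrt I * (C * sqrt ((1 + 0) * g))"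
  proof (rule tendsto_le[of "at_right (0::real)"])
    show "((\<lambda>\<delta>. I - \<delta>) \<longlongrightarrow> I - 0) (at_right 0)" by (intro tendsto_intros)
    show "((\<lambda>\<delta>. sqrt I * (C * sqrt ((1 + \<delta>) * g))) \<longlongrightarrow> sqrt I * (C * sqrt ((1 + 0) * g))) (at_right 0)"
      by (intro tendsto_intros)
    show "eventually (\<lambda>\<delta>. I - \<delta> \<le> sqrt I * (C * sqrt ((1 + \<delta>) * g))) (at_right 0)"
      using eventually_at_right_less[of 0] by eventually_elim (rule step)
  qed simp
  \<comment> \<open>Duality gives the inequality multiplied by \<open>sqrt I\<close>, which is
    cancelled unless it is zero.\<close>
  then have *: "sqrt I * sqrt I \<le> sqrt I * (C * sqrt g)" using I0 by simp
  have "sqrt I \<le> C * sqrt g"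
  proof (cases "I = 0")
    case False
    then have "0 < sqrt I" using I0 by simp
    with * show ?thesis by (rule mult_left_le_imp_le)
  qed (use C g0 in simp)
  then show ?thesis by (simp add: I_def g_def)
qed

section \<open>Borel representatives on the whole space\<close>

lemma LINT_lebesgue_on_eq:
  fixes f F :: "'a::euclidean_space \<Rightarrow> real"
  assumes S[measurable]: "S \<in> sets borel" and f: "f \<in> borel_measurable (lebesgue_on S)"
    and F[measurable]: "F \<in> borel_measurable borel" and eq: "AE x in lborel. x \<in> S \<longrightarrow> f x = F x"
  shows "(LINT x|lebesgue_on S. f x) = (LBINT x:S. F x)"
    and "integrable (lebesgue_on S) f \<longleftrightarrow> set_integrable lborel S F"
proof -
  have S': "S \<inter> space lebesgue \<in> sets lebesgue" using S by simp
  have f': "(\<lambda>x. indicator S x *\<^sub>R f x) \<in> borel_measurable lebesgue"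
    by (rule iffD1[OF borel_measurable_restrict_space_iff[OF S'] f])
  have F0: "(\<lambda>x. indicator S x *\<^sub>R F x) \<in> borel_measurable lborel" by measurable
  then have F': "(\<lambda>x. indicator S x *\<^sub>R F x) \<in> borel_measurable lebesgue" by (rule measurable_completion)
  have ae: "AE x in lebesgue. indicator S x *\<^sub>R f x = indicator S x *\<^sub>R F x"
    using eq by (simp only: AE_completion_iff) (auto elim!: eventually_mono simp: indicator_def)
  have "(LINT x|lebesgue_on S. f x) = (LINT x|lebesgue. indicator S x *\<^sub>R f x)"
    by (rule integral_restrict_space[OF S'])
  also have "\<dots> = (LINT x|lebesgue. indicator S x *\<^sub>R F x)" by (rule integral_cong_AE[OF f' F' ae])
  also have "\<dots> = (LBINT x. indicator S x *\<^sub>R F x)" by (rule integral_completion[OF F0])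
  finally show "(LINT x|lebesgue_on S. f x) = (LBINT x:S. F x)" by (simp add: set_lebesgue_integral_def)
  have "integrable (lebesgue_on S) f \<longleftrightarrow> integrable lebesgue (\<lambda>x. indicator S x *\<^sub>R f x)"
    by (rule integrable_restrict_space[OF S'])
  also have "\<dots> \<longleftrightarrow> integrable lebesgue (\<lambda>x. indicator S x *\<^sub>R F x)" by (rule integrable_cong_AE[OF f' F' ae])
  also have "\<dots> \<longleftrightarrow> integrable lborel (\<lambda>x. indicator S x *\<^sub>R F x)" by (rule integrable_completion[OF F0])
  finally show "integrable (lebesgue_on S) f \<longleftrightarrow> set_integrable lborel S F" by (simp add: set_integrable_def)
qed

lemma borel_representative_real:
  fixes f :: "'a::euclidean_space \<Rightarrow> real"
  assumes S[measurable]: "S \<in> sets borel" and f: "f \<in> borel_measurable (lebesgue_on S)"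
  obtains F where "F \<in> borel_measurable borel" "\<And>x. x \<notin> S \<Longrightarrow> F x = 0" "AE x in lborel. x \<in> S \<longrightarrow> f x = F x"
proof -
  have S': "S \<inter> space lebesgue \<in> sets lebesgue" using S by simp
  have "(\<lambda>x. indicator S x *\<^sub>R f x) \<in> borel_measurable lebesgue"
    by (rule iffD1[OF borel_measurable_restrict_space_iff[OF S'] f])
  then obtain F where F: "F \<in> borel_measurable lborel" "AE x in lborel. indicator S x *\<^sub>R f x = F x"
    using completion_ex_borel_measurable_real by blast
  show thesis
  proof (rule that[of "\<lambda>x. indicator S x * F x"])
    show "(\<lambda>x. indicator S x * F x) \<in> borel_measurable borel" using F(1) by simp
    show "AE x in lborel. x \<in> S \<longrightarrow> f x = indicator S x * F x"
      using F(2) by eventually_elim auto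
  qed simp
qed

lemma borel_representative:
  fixes f :: "'a::euclidean_space \<Rightarrow> 'b::euclidean_space"
  assumes S: "S \<in> sets borel" and f: "f \<in> borel_measurable (lebesgue_on S)"
  obtains F where "F \<in> borel_measurable borel" "\<And>x. x \<notin> S \<Longrightarrow> F x = 0" "AE x in lborel. x \<in> S \<longrightarrow> f x = F x"
proof -
  let ?Q = "\<lambda>b F. F \<in> borel_measurable borel \<and> (\<forall>x. x \<notin> S \<longrightarrow> F x = 0) \<and> (AE x in lborel. x \<in> S \<longrightarrow> f x \<bullet> b = F x)"
  have ex: "\<exists>F. ?Q b F" for b
  proof -
    have "(\<lambda>x. f x \<bullet> b) \<in> borel_measurable (lebesgue_on S)" using f by simp
    from borel_representative_real[OF S this] show ?thesis by blast
  qed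
  define F where "F b = (SOME F. ?Q b F)" for b
  have "?Q b (F b)" for b unfolding F_def by (rule someI_ex[OF ex])
  then have F: "\<And>b. F b \<in> borel_measurable borel" "\<And>b x. x \<notin> S \<Longrightarrow> F b x = 0"
    "\<And>b. AE x in lborel. x \<in> S \<longrightarrow> f x \<bullet> b = F b x"
    by blast+
  note F(1)[measurable]
  show thesis
  proof (rule that[of "\<lambda>x. \<Sum>b\<in>Basis. F b x *\<^sub>R b"])
    show "(\<lambda>x. \<Sum>b\<in>Basis. F b x *\<^sub>R b) \<in> borel_measurable borel" by measurable
    have "AE x in lborel. \<forall>b\<in>Basis. x \<in> S \<longrightarrow> f x \<bullet> b = F b x"
      using F(3) by (intro AE_finite_allI) auto
    then show "AE x in lborel. x \<in> S \<longrightarrow> f x = (\<Sum>b\<in>Basis. F b x *\<^sub>R b)"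
    proof eventually_elim
      case (elim x)
      show ?case
      proof
        assume "x \<in> S"
        then have "(\<Sum>b\<in>Basis. F b x *\<^sub>R b) = (\<Sum>b\<in>Basis. (f x \<bullet> b) *\<^sub>R b)"
          using elim by (intro sum.cong) auto
        then show "f x = (\<Sum>b\<in>Basis. F b x *\<^sub>R b)" by (simp add: euclidean_representation)
      qed
    qed
  qed (simp add: F(2))
qed

lemma test_function_measurable:
  assumes "\<psi> \<in> test_functions \<Omega>"
  shows "\<psi> \<in> borel_measurable borel" "(\<lambda>x. frechet_derivative \<psi> (at x) b) \<in> borel_measurable borel"
proof -
  have "C_k 0 \<psi>" "C_k (Suc 0) \<psi>" using assms unfolding test_functions_def by blast+
  then show "\<psi> \<in> borel_measurable borel" "(\<lambda>x. frechet_derivative \<psi> (at x) b) \<in> borel_measurable borel"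
    by (auto intro: borel_measurable_continuous_onI)
qed

text \<open>The function spaces are formulated with Lebesgue measure on \<open>\<Omega>\<close>,
  whereas Fubini and the mollifier estimates work with Borel functions on the whole space. Extension
  by zero reconciles them: \<open>\<Phi>\<close> need not be weakly differentiable across the
  boundary, but the identity is only claimed for test functions of \<open>\<Omega>\<close>.\<close>

lemma H1_representative:
  fixes \<phi> :: "'a::euclidean_space \<Rightarrow> real"
  assumes \<Omega>: "open \<Omega>" and \<phi>: "\<phi> \<in> L2 \<Omega>" and g: "has_weak_grad \<Omega> \<phi> g"
  obtains \<Phi> G where "\<Phi> \<in> borel_measurable borel" "integrable lborel (\<lambda>x. (\<Phi> x)^2)" "\<And>x. x \<notin> \<Omega> \<Longrightarrow> \<Phi> x = 0"
    "AE x in lborel. x \<in> \<Omega> \<longrightarrow> \<phi> x = \<Phi> x"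
    "G \<in> borel_measurable borel" "integrable lborel (\<lambda>x. (norm (G x))^2)"
    "\<And>\<psi> b. \<psi> \<in> test_functions \<Omega> \<Longrightarrow> b \<in> Basis \<Longrightarrow>
      (LBINT x. \<Phi> x * frechet_derivative \<psi> (at x) b) = - (LBINT x. (G x \<bullet> b) * \<psi> x)"
    "norm_L2 \<Omega> \<phi> = sqrt (LBINT x. (\<Phi> x)^2)" "norm_L2 \<Omega> g = sqrt (LBINT x. (norm (G x))^2)"
proof -
  have S: "\<Omega> \<in> sets borel" using \<Omega> by simp
  have \<phi>m: "\<phi> \<in> borel_measurable (lebesgue_on \<Omega>)" and \<phi>2: "integrable (lebesgue_on \<Omega>) (\<lambda>x. (norm (\<phi> x))^2)"
    using \<phi> by (auto simp: L2_def)
  have gm: "g \<in> borel_measurable (lebesgue_on \<Omega>)" and g2: "integrable (lebesgue_on \<Omega>) (\<lambda>x. (norm (g x))^2)"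
    using g by (auto simp: L2_def has_weak_grad_def)
  obtain \<Phi> where \<Phi>: "\<Phi> \<in> borel_measurable borel" "\<And>x. x \<notin> \<Omega> \<Longrightarrow> \<Phi> x = 0" "AE x in lborel. x \<in> \<Omega> \<longrightarrow> \<phi> x = \<Phi> x"
    by (rule borel_representative_real[OF S \<phi>m]) blast
  obtain G where G: "G \<in> borel_measurable borel" "\<And>x. x \<notin> \<Omega> \<Longrightarrow> G x = 0" "AE x in lborel. x \<in> \<Omega> \<longrightarrow> g x = G x"
    by (rule borel_representative[OF S gm]) blast
  note [measurable] = \<Phi>(1) G(1)
  have restr: "set_lebesgue_integral lborel \<Omega> h = (LBINT x. h x)" "set_integrable lborel \<Omega> h \<longleftrightarrow> integrable lborel h"
    if "\<And>x. x \<notin> \<Omega> \<Longrightarrow> h x = 0" for h :: "'a \<Rightarrow> real"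
  proof -
    have "(\<lambda>x. indicator \<Omega> x *\<^sub>R h x) = h" using that by (auto simp: fun_eq_iff indicator_def)
    then show "set_lebesgue_integral lborel \<Omega> h = (LBINT x. h x)" "set_integrable lborel \<Omega> h \<longleftrightarrow> integrable lborel h"
      by (simp_all add: set_lebesgue_integral_def set_integrable_def)
  qed
  have \<phi>2_eq: "(LINT x|lebesgue_on \<Omega>. (norm (\<phi> x))^2) = (LBINT x:\<Omega>. (\<Phi> x)^2)"
    "integrable (lebesgue_on \<Omega>) (\<lambda>x. (norm (\<phi> x))^2) \<longleftrightarrow> set_integrable lborel \<Omega> (\<lambda>x. (\<Phi> x)^2)"
    by (rule LINT_lebesgue_on_eq[OF S]; use \<Phi>(3) \<phi>m in \<open>auto elim!: eventually_mono\<close>)+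
  have g2_eq: "(LINT x|lebesgue_on \<Omega>. (norm (g x))^2) = (LBINT x:\<Omega>. (norm (G x))^2)"
    "integrable (lebesgue_on \<Omega>) (\<lambda>x. (norm (g x))^2) \<longleftrightarrow> set_integrable lborel \<Omega> (\<lambda>x. (norm (G x))^2)"
    by (rule LINT_lebesgue_on_eq[OF S]; use G(3) gm in \<open>auto elim!: eventually_mono\<close>)+
  show thesis
  proof (rule that[OF \<Phi>(1) _ \<Phi>(2,3) G(1)])
    show "integrable lborel (\<lambda>x. (\<Phi> x)^2)" using \<phi>2 \<phi>2_eq(2) restr(2)[of "\<lambda>x. (\<Phi> x)^2"] \<Phi>(2) by simp
    show "integrable lborel (\<lambda>x. (norm (G x))^2)" using g2 g2_eq(2) restr(2)[of "\<lambda>x. (norm (G x))^2"] G(2) by simp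
    show "norm_L2 \<Omega> \<phi> = sqrt (LBINT x. (\<Phi> x)^2)"
      using \<phi>2_eq(1) restr(1)[of "\<lambda>x. (\<Phi> x)^2"] \<Phi>(2) by (simp add: norm_L2_def)
    show "norm_L2 \<Omega> g = sqrt (LBINT x. (norm (G x))^2)"
      using g2_eq(1) restr(1)[of "\<lambda>x. (norm (G x))^2"] G(2) by (simp add: norm_L2_def)
    fix \<psi> :: "'a \<Rightarrow> real" and b :: 'a
    assume \<psi>: "\<psi> \<in> test_functions \<Omega>" and b: "b \<in> Basis"
    note [measurable] = test_function_measurable(1)[OF \<psi>] test_function_measurable(2)[OF \<psi>, of b]
    have mr: "h \<in> borel_measurable (lebesgue_on \<Omega>)" if "h \<in> borel_measurable borel" for h :: "'a \<Rightarrow> real"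
      using that by (intro measurable_restrict_space1 measurable_completion) simp
    have "(LINT x|lebesgue_on \<Omega>. \<phi> x * frechet_derivative \<psi> (at x) b) = (LBINT x:\<Omega>. \<Phi> x * frechet_derivative \<psi> (at x) b)"
      by (rule LINT_lebesgue_on_eq(1)[OF S])
        (use \<Phi>(3) \<phi>m mr[OF test_function_measurable(2)[OF \<psi>, of b]] in \<open>auto elim!: eventually_mono\<close>)
    moreover have "(LINT x|lebesgue_on \<Omega>. (g x \<bullet> b) * \<psi> x) = (LBINT x:\<Omega>. (G x \<bullet> b) * \<psi> x)"
      by (rule LINT_lebesgue_on_eq(1)[OF S])
        (use G(3) gm mr[OF test_function_measurable(1)[OF \<psi>]] in \<open>auto elim!: eventually_mono\<close>)
    ultimately show "(LBINT x. \<Phi> x * frechet_derivative \<psi> (at x) b) = - (LBINT x. (G x \<bullet> b) * \<psi> x)"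
      using g \<psi> b restr(1)[of "\<lambda>x. \<Phi> x * frechet_derivative \<psi> (at x) b"] restr(1)[of "\<lambda>x. (G x \<bullet> b) * \<psi> x"] \<Phi>(2) G(2)
      by (simp add: has_weak_grad_def)
  qed
qed

lemma has_weak_grad_weak_grad: "\<phi> \<in> H1 \<Omega> \<Longrightarrow> has_weak_grad \<Omega> \<phi> (weak_grad \<Omega> \<phi>)"
  unfolding weak_grad_def H1_def by (auto intro: someI_ex[of "has_weak_grad \<Omega> \<phi>"])

lemma poincare_bound_exists:
  fixes \<Omega> :: "'a::euclidean_space set"
  assumes \<Omega>: "open \<Omega>" "convex \<Omega>" "bounded \<Omega>" "\<Omega> \<noteq> {}"
  shows "\<exists>c. is_poincare_bound \<Omega> (H1 \<Omega> \<inter> L2_0 \<Omega>) c"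
proof -
  obtain C where C: "0 \<le> C"
    "\<And>u Du. \<lbrakk>\<And>x. (u has_derivative (\<lambda>h. Du x \<bullet> h)) (at x); continuous_on UNIV Du\<rbrakk> \<Longrightarrow>
      (LBINT x:\<Omega>. (u x - (LBINT y:\<Omega>. u y) / (LBINT y:\<Omega>. 1))^2) \<le> C * (LBINT x:\<Omega>. (norm (Du x))^2)"
    by (rule convex_poincare_inequality[OF \<Omega>]) blast
  have S[measurable]: "\<Omega> \<in> sets borel" using \<Omega> by simp
  have "norm_L2 \<Omega> \<phi> \<le> sqrt C * norm_L2 \<Omega> (weak_grad \<Omega> \<phi>)" if \<phi>: "\<phi> \<in> H1 \<Omega>" "\<phi> \<in> L2_0 \<Omega>" for \<phi>
  proof -
    have "\<phi> \<in> L2 \<Omega>" using \<phi> by (simp add: H1_def)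
    then obtain \<Phi> G where \<Phi>: "\<Phi> \<in> borel_measurable borel" "integrable lborel (\<lambda>x. (\<Phi> x)^2)" "\<And>x. x \<notin> \<Omega> \<Longrightarrow> \<Phi> x = 0"
      "AE x in lborel. x \<in> \<Omega> \<longrightarrow> \<phi> x = \<Phi> x"
      and G: "G \<in> borel_measurable borel" "integrable lborel (\<lambda>x. (norm (G x))^2)"
      and weak: "\<And>\<psi> b. \<psi> \<in> test_functions \<Omega> \<Longrightarrow> b \<in> Basis \<Longrightarrow>
        (LBINT x. \<Phi> x * frechet_derivative \<psi> (at x) b) = - (LBINT x. (G x \<bullet> b) * \<psi> x)"
      and norms: "norm_L2 \<Omega> \<phi> = sqrt (LBINT x. (\<Phi> x)^2)" "norm_L2 \<Omega> (weak_grad \<Omega> \<phi>) = sqrt (LBINT x. (norm (G x))^2)"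
      by (rule H1_representative[OF \<Omega>(1) _ has_weak_grad_weak_grad[OF \<phi>(1)]]) blast
    note [measurable] = \<Phi>(1)
    have ind: "indicator \<Omega> x *\<^sub>R \<Phi> x = \<Phi> x" for x by (cases "x \<in> \<Omega>") (simp_all add: \<Phi>(3))
    have "(LINT x|lebesgue_on \<Omega>. \<phi> x) = (LBINT x:\<Omega>. \<Phi> x)"
      using \<phi>(1) \<Phi> by (intro LINT_lebesgue_on_eq(1) S) (auto simp: H1_def L2_def)
    also have "\<dots> = (LBINT x. \<Phi> x)" unfolding set_lebesgue_integral_def ind ..
    finally have mean: "(LBINT x. \<Phi> x) = 0"
      using \<phi>(2) by (simp add: L2_0_def)
    have int: "integrable lborel \<Phi>" by (rule integrable_bounded_support_L2[OF \<Omega>(1,3) \<Phi>(1-3)])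
    have "sqrt (LBINT x. (\<Phi> x)^2) \<le> sqrt C * sqrt (LBINT x. (norm (G x))^2)"
    proof (rule poincare_by_approximation[OF \<Omega> \<Phi>(1-3) G weak])
      fix u :: "'a \<Rightarrow> real" and Du assume u: "\<And>x. (u has_derivative (\<lambda>h. Du x \<bullet> h)) (at x)" "continuous_on UNIV Du"
      have u_cont: "continuous_on UNIV u"
        by (intro continuous_at_imp_continuous_on ballI has_derivative_continuous[OF u(1)])
      define m where "m = (LBINT y:\<Omega>. u y) / (LBINT y:\<Omega>. 1)"
      show "\<exists>m. m \<in> borel_measurable borel \<and> integrable lborel (\<lambda>x. \<Phi> x * m x) \<and> (LBINT x. \<Phi> x * m x) = 0 \<and>
        set_integrable lborel \<Omega> (\<lambda>x. (u x - m x)^2) \<and>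
        (LBINT x:\<Omega>. (u x - m x)^2) \<le> (sqrt C)^2 * (LBINT x:\<Omega>. (norm (Du x))^2)"
        using C(2)[OF u] C(1) int mean \<Omega>
        by (intro exI[of _ "\<lambda>x. m"] conjI set_integrable_bounded_continuous continuous_intros u_cont) (auto simp: m_def)
    qed (use C(1) in auto)
    then show ?thesis by (simp add: norms)
  qed
  then show ?thesis using C(1) by (intro exI[of _ "sqrt C"]) (auto simp: is_poincare_bound_def)
qed

text \<open>The positive and the negative part of \<open>A\<close> are densities of two finite
  measures that agree on all rays, hence everywhere; densities are unique almost everywhere. This
  converts the slab conditions into vanishing slice integrals.\<close>

lemma AE_zero_if_tail_integrals_zero:
  fixes A :: "real \<Rightarrow> real"
  assumes A: "integrable lborel A" and zero: "\<And>x. (LBINT y:{x<..}. A y) = 0"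
  shows "AE x in lborel. A x = 0"
proof -
  have [measurable]: "A \<in> borel_measurable borel" using A by simp
  define P where "P x = max (A x) 0" for x
  define N where "N x = max (- A x) 0" for x
  have PN: "integrable lborel P" "integrable lborel N"
    unfolding P_def N_def using A by auto
  have [measurable]: "P \<in> borel_measurable borel" "N \<in> borel_measurable borel"
    unfolding P_def N_def by measurable
  have em: "emeasure (density lborel (\<lambda>x. ennreal (h x))) {x<..} = ennreal (LBINT y:{x<..}. h y)"
    if h: "integrable lborel h" "\<And>x. 0 \<le> h x" for h :: "real \<Rightarrow> real" and x
  proof -
    have [measurable]: "h \<in> borel_measurable borel" using h by simp
    have "emeasure (density lborel (\<lambda>x. ennreal (h x))) {x<..} = (\<integral>\<^sup>+y. ennreal (indicator {x<..} y *\<^sub>R h y) \<partial>lborel)"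
      by (subst emeasure_density) (auto intro!: nn_integral_cong borel_open simp: indicator_def)
    also have "\<dots> = ennreal (LBINT y:{x<..}. h y)"
      unfolding set_lebesgue_integral_def using h(2)
      by (intro nn_integral_eq_integral integrable_mult_indicator h(1)) (auto intro: borel_open)
    finally show ?thesis .
  qed
  have nn: "0 \<le> P x" "0 \<le> N x" for x by (simp_all add: P_def N_def)
  have "density lborel (\<lambda>x. ennreal (P x)) = density lborel (\<lambda>x. ennreal (N x))"
  proof (rule measure_eqI_lessThan)
    fix x :: real
    have "A y = P y - N y" for y by (simp add: P_def N_def)
    then have "(LBINT y:{x<..}. P y - N y) = 0" using zero[of x] by simp
    moreover have "set_integrable lborel {x<..} P" "set_integrable lborel {x<..} N"
      unfolding set_integrable_def by (intro integrable_mult_indicator PN; simp add: borel_open)+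
    then have "(LBINT y:{x<..}. P y - N y) = (LBINT y:{x<..}. P y) - (LBINT y:{x<..}. N y)"
      by (rule set_integral_diff)
    ultimately have "(LBINT y:{x<..}. P y) = (LBINT y:{x<..}. N y)" by simp
    then show "emeasure (density lborel (\<lambda>x. ennreal (P x))) {x<..} = emeasure (density lborel (\<lambda>x. ennreal (N x))) {x<..}"
      by (simp only: em[OF PN(1) nn(1)] em[OF PN(2) nn(2)])
    show "emeasure (density lborel (\<lambda>x. ennreal (P x))) {x<..} < \<infinity>"
      by (simp only: em[OF PN(1) nn(1)]) simp
  qed simp_all
  then have "AE x in lborel. ennreal (P x) = ennreal (N x)"
    by (intro iffD1[OF sigma_finite_measure.density_unique_iff[OF sigma_finite_lborel]]) auto
  then show ?thesis
    by eventually_elim (auto simp: P_def N_def max_def split: if_splits)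
qed

section \<open>Slices orthogonal to a coordinate direction\<close>

text \<open>The direction \<open>i\<close> comes first so that Fubini on the product splits off the
  slices. For distinct indices the map is a linear isometry.\<close>

definition coords :: "3 \<Rightarrow> 3 \<Rightarrow> 3 \<Rightarrow> real \<times> real \<times> real \<Rightarrow> real^3" where
  "coords i j k p = fst p *\<^sub>R axis i 1 + fst (snd p) *\<^sub>R axis j 1 + snd (snd p) *\<^sub>R axis k 1"

lemma UNIV_3_distinct:
  assumes "distinct [i, j, k :: 3]"
  shows "UNIV = {i, j, k}"
proof -
  have "card {i, j, k} = CARD(3)" using assms by simp
  then show ?thesis by (metis card_subset_eq finite subset_UNIV)
qed

lemma coords_nth:
  assumes "distinct [i, j, k]"
  shows "coords i j k p $ i = fst p" "coords i j k p $ j = fst (snd p)" "coords i j k p $ k = snd (snd p)"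
  using assms by (auto simp: coords_def axis_def)

lemma continuous_on_coords: "continuous_on S (coords i j k)"
  unfolding coords_def by (intro continuous_intros)

lemma coords_linear: "bounded_linear (coords i j k)"
  unfolding linear_conv_bounded_linear[symmetric]
  by (intro linearI) (simp_all add: coords_def algebra_simps)

lemma norm_coords:
  assumes "distinct [i, j, k]"
  shows "norm (coords i j k p) = norm p"
proof -
  have "(norm (coords i j k p))^2 = (\<Sum>m\<in>UNIV. (coords i j k p $ m)^2)"
    unfolding power2_norm_eq_inner inner_vec_def by (simp add: power2_eq_square)
  also have "\<dots> = (norm p)^2"
    using assms coords_nth[OF assms, of p]
    by (cases p) (simp add: UNIV_3_distinct[OF assms] norm_Pair real_sqrt_pow2)
  finally show ?thesis by (simp add: power2_eq_iff_nonneg)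
qed

lemma emeasure_lborel_Times:
  fixes A :: "'a::euclidean_space set" and B :: "'b::euclidean_space set"
  assumes "A \<in> sets borel" "B \<in> sets borel"
  shows "emeasure lborel (A \<times> B) = emeasure lborel A * emeasure lborel B"
  using assms by (simp add: lborel_prod[symmetric] lborel.emeasure_pair_measure_Times)

text \<open>Lebesgue measure is determined by its values on boxes, and the preimage of a box is a
  box with permuted sides.\<close>

lemma distr_coords:
  assumes d: "distinct [i, j, k]"
  shows "distr lborel borel (coords i j k) = lborel"
proof (rule lborel_eqI[symmetric])
  have [measurable]: "coords i j k \<in> borel_measurable borel"
    by (intro borel_measurable_continuous_onI continuous_on_coords)
  fix l u :: "real^3" assume lu: "\<And>b. b \<in> Basis \<Longrightarrow> l \<bullet> b \<le> u \<bullet> b"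
  have le: "l $ m \<le> u $ m" for m
    using lu[of "axis m 1"] by (simp add: inner_axis axis_in_Basis_iff)
  have "coords i j k -` box l u = {l $ i<..<u $ i} \<times> {l $ j<..<u $ j} \<times> {l $ k<..<u $ k}"
  proof -
    have "coords i j k p \<in> box l u \<longleftrightarrow> (\<forall>m\<in>{i, j, k}. l $ m < coords i j k p $ m \<and> coords i j k p $ m < u $ m)" for p
      by (simp only: UNIV_3_distinct[OF d, symmetric] mem_box_cart ball_UNIV)
    then show ?thesis by (auto simp: coords_nth[OF d])
  qed
  then have "emeasure (distr lborel borel (coords i j k)) (box l u)
      = emeasure lborel ({l $ i<..<u $ i} \<times> {l $ j<..<u $ j} \<times> {l $ k<..<u $ k})"
    by (subst emeasure_distr) simp_all
  also have "\<dots> = ennreal (u $ i - l $ i) * (ennreal (u $ j - l $ j) * ennreal (u $ k - l $ k))"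
    by (simp add: emeasure_lborel_Times borel_Times le)
  also have "\<dots> = ennreal (\<Prod>m\<in>UNIV. (u - l) $ m)"
    using d by (simp add: UNIV_3_distinct[OF d] ennreal_mult' le)
  also have "(\<Prod>m\<in>UNIV. (u - l) $ m) = (\<Prod>b\<in>Basis. (u - l) \<bullet> b)"
  proof -
    have bas: "(Basis :: (real^3) set) = (\<lambda>m. axis m 1) ` UNIV" by (auto simp: Basis_vec_def)
    have inj: "inj (\<lambda>m::3. axis m (1::real))" by (auto simp: inj_on_def axis_eq_axis)
    show ?thesis unfolding bas prod.reindex[OF inj] by (simp add: inner_axis)
  qed
  finally show "emeasure (distr lborel borel (coords i j k)) (box l u) = ennreal (\<Prod>b\<in>Basis. (u - l) \<bullet> b)" .
qed simp

lemma LINT_coords: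
  fixes f :: "real^3 \<Rightarrow> real"
  assumes "distinct [i, j, k]" and f: "f \<in> borel_measurable borel"
  shows "(LBINT x. f x) = (LBINT p. f (coords i j k p))"
    and "integrable lborel f \<longleftrightarrow> integrable lborel (\<lambda>p. f (coords i j k p))"
proof -
  have m: "coords i j k \<in> measurable lborel borel"
    by (simp add: borel_measurable_continuous_onI continuous_on_coords)
  show "(LBINT x. f x) = (LBINT p. f (coords i j k p))"
    by (subst distr_coords[OF assms(1), symmetric]) (rule integral_distr[OF m f])
  show "integrable lborel f \<longleftrightarrow> integrable lborel (\<lambda>p. f (coords i j k p))"
    by (subst distr_coords[OF assms(1), symmetric]) (rule integrable_distr_eq[OF m f])
qed

section \<open>Slices and slice means\<close>

definition slice :: "3 \<Rightarrow> 3 \<Rightarrow> 3 \<Rightarrow> (real^3) set \<Rightarrow> real \<Rightarrow> (real \<times> real) set" where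
  "slice i j k \<Omega> s = {y. coords i j k (s, y) \<in> \<Omega>}"

text \<open>On an empty slice both integrals vanish and the quotient \<open>0 / 0\<close> is 0, so
  no restriction on \<open>s\<close> is needed in the bounds below.\<close>

definition slice_mean :: "3 \<Rightarrow> 3 \<Rightarrow> 3 \<Rightarrow> (real^3) set \<Rightarrow> (real^3 \<Rightarrow> real) \<Rightarrow> real \<Rightarrow> real" where
  "slice_mean i j k \<Omega> u s =
    (LBINT y:slice i j k \<Omega> s. u (coords i j k (s, y))) / (LBINT y:slice i j k \<Omega> s. 1)"

lemma open_slice: "open \<Omega> \<Longrightarrow> open (slice i j k \<Omega> s)"
  using open_vimage[of \<Omega> "\<lambda>y. coords i j k (s, y)"]
  by (simp add: slice_def vimage_def continuous_on_compose2[OF continuous_on_coords[of UNIV]] continuous_intros)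

lemma convex_slice:
  assumes "convex \<Omega>"
  shows "convex (slice i j k \<Omega> s)"
proof (rule convexI)
  fix y z :: "real \<times> real" and a b :: real
  assume yz: "y \<in> slice i j k \<Omega> s" "z \<in> slice i j k \<Omega> s" and ab: "0 \<le> a" "0 \<le> b" "a + b = 1"
  have "a * s + b * s = s" using ab(3) by (metis distrib_right mult_1)
  then have "(s, a *\<^sub>R y + b *\<^sub>R z) = a *\<^sub>R (s, y) + b *\<^sub>R (s, z)" by simp
  then have "coords i j k (s, a *\<^sub>R y + b *\<^sub>R z) = a *\<^sub>R coords i j k (s, y) + b *\<^sub>R coords i j k (s, z)"
    using bounded_linear.linear[OF coords_linear[of i j k]] by (simp only: linear_add linear_scale)
  then show "a *\<^sub>R y + b *\<^sub>R z \<in> slice i j k \<Omega> s"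
    using convexD[OF assms _ _ ab, of "coords i j k (s, y)" "coords i j k (s, z)"] yz by (simp add: slice_def)
qed

lemma bounded_slice:
  assumes "distinct [i, j, k]" "bounded \<Omega>"
  shows "bounded (slice i j k \<Omega> s)"
proof -
  obtain R where R: "\<And>x. x \<in> \<Omega> \<Longrightarrow> norm x \<le> R" using assms(2) by (auto simp: bounded_iff)
  have "norm y \<le> R" if "y \<in> slice i j k \<Omega> s" for y
    using R[of "coords i j k (s, y)"] norm_snd_le[of y s] that norm_coords[OF assms(1), of "(s, y)"]
    by (simp add: slice_def)
  then show ?thesis unfolding bounded_iff by blast
qed

lemma slice_fubini:
  fixes F :: "real^3 \<Rightarrow> real"
  assumes d: "distinct [i, j, k]" and \<Omega>: "open \<Omega>" and F: "set_integrable lborel \<Omega> F"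
  shows "integrable lborel (\<lambda>s. LBINT y:slice i j k \<Omega> s. F (coords i j k (s, y)))"
    and "(LBINT x:\<Omega>. F x) = (LBINT s. (LBINT y:slice i j k \<Omega> s. F (coords i j k (s, y))))"
proof -
  have m: "(\<lambda>x. indicator \<Omega> x *\<^sub>R F x) \<in> borel_measurable borel"
    using F unfolding set_integrable_def by simp
  have int: "integrable (lborel \<Otimes>\<^sub>M lborel) (\<lambda>p. indicator \<Omega> (coords i j k p) *\<^sub>R F (coords i j k p))"
    using F LINT_coords(2)[OF d m] unfolding set_integrable_def lborel_prod by simp
  have eq: "(LBINT y. indicator \<Omega> (coords i j k (s, y)) *\<^sub>R F (coords i j k (s, y))) = (LBINT y:slice i j k \<Omega> s. F (coords i j k (s, y)))" for s
    unfolding set_lebesgue_integral_def slice_def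
    by (intro Bochner_Integration.integral_cong) (auto simp: indicator_def)
  show "integrable lborel (\<lambda>s. LBINT y:slice i j k \<Omega> s. F (coords i j k (s, y)))"
    using lborel_pair.integrable_fst'[OF int] unfolding eq .
  have "(LBINT x:\<Omega>. F x) = (LBINT p. indicator \<Omega> (coords i j k p) *\<^sub>R F (coords i j k p))"
    unfolding set_lebesgue_integral_def by (rule LINT_coords(1)[OF d m])
  also have "\<dots> = (LBINT s. LBINT y. indicator \<Omega> (coords i j k (s, y)) *\<^sub>R F (coords i j k (s, y)))"
    using lborel_pair.integral_fst'[OF int] by (simp add: lborel_prod)
  finally show "(LBINT x:\<Omega>. F x) = (LBINT s. (LBINT y:slice i j k \<Omega> s. F (coords i j k (s, y))))"
    unfolding eq .
qed

text \<open>Supplies the dominating functions for the integrability conditions on the comparison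
  function.\<close>

lemma slice_mean_bound:
  assumes d: "distinct [i, j, k]" and \<Omega>: "open \<Omega>" "bounded \<Omega>" and u: "continuous_on UNIV u"
    and B: "\<And>x. x \<in> \<Omega> \<Longrightarrow> \<bar>u x\<bar> \<le> B" "0 \<le> B"
  shows "\<bar>slice_mean i j k \<Omega> u s\<bar> \<le> B"
proof (cases "slice i j k \<Omega> s = {}")
  case True
  then show ?thesis using B(2) by (simp add: slice_mean_def set_lebesgue_integral_def)
next
  case False
  define K where "K = slice i j k \<Omega> s"
  have K: "open K" "bounded K" "K \<noteq> {}"
    using False open_slice[OF \<Omega>(1)] bounded_slice[OF d \<Omega>(2)] by (auto simp: K_def)
  define V where "V = (LBINT y:K. (1::real))"
  have V: "0 < V" unfolding V_def by (rule LINT_one_pos[OF K])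
  define w where "w y = u (coords i j k (s, y))" for y
  have w: "continuous_on UNIV w"
    unfolding w_def by (intro continuous_on_compose2[OF u] continuous_on_compose2[OF continuous_on_coords[of UNIV]] continuous_intros) auto
  have w_le: "\<bar>w y\<bar> \<le> B" if "y \<in> K" for y using that B(1) by (simp add: w_def K_def slice_def)
  have "(LBINT y:K. w y) \<le> (LBINT y:K. 0) + B * V"
    unfolding V_def using w_le by (intro LINT_scaled_bound K w) (force simp: abs_le_iff)+
  moreover have "(LBINT y:K. 0) \<le> (LBINT y:K. w y) + B * V"
    unfolding V_def using w_le by (intro LINT_scaled_bound K w) (force simp: abs_le_iff)+
  ultimately have "\<bar>LBINT y:K. w y\<bar> \<le> B * V"
    by (simp add: set_lebesgue_integral_def abs_le_iff)
  then show ?thesis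
    using V by (simp add: slice_mean_def K_def[symmetric] V_def[symmetric] w_def[symmetric] abs_divide pos_divide_le_eq)
qed

lemma slice_mean_measurable:
  assumes d: "distinct [i, j, k]" and \<Omega>: "open \<Omega>" "bounded \<Omega>" and u: "continuous_on UNIV u"
  shows "slice_mean i j k \<Omega> u \<in> borel_measurable borel"
proof -
  have m: "(\<lambda>s. LBINT y:slice i j k \<Omega> s. v (coords i j k (s, y))) \<in> borel_measurable borel"
    if v: "continuous_on UNIV v" for v :: "real^3 \<Rightarrow> real"
  proof -
    have "set_integrable lborel \<Omega> v" using \<Omega> v by (intro set_integrable_bounded_continuous) auto
    from slice_fubini(1)[OF d \<Omega>(1) this] show ?thesis by simp
  qed
  show ?thesis
    unfolding slice_mean_def using m[OF u] m[of "\<lambda>x. 1"] by (intro borel_measurable_divide) auto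
qed

text \<open>Two points of one slice differ only in the directions \<open>j\<close> and
  \<open>k\<close>, so their distance is that of their projections. The gradient of the restriction
  consists of the components \<open>j\<close> and \<open>k\<close> of \<open>Du\<close> and is no
  longer than \<open>Du\<close>.\<close>

lemma slice_variance_le:
  fixes u :: "real^3 \<Rightarrow> real"
  assumes d: "distinct [i, j, k]" and \<Omega>: "open \<Omega>" "convex \<Omega>" "bounded \<Omega>"
    and u: "\<And>x. (u has_derivative (\<lambda>h. Du x \<bullet> h)) (at x)" and Du: "continuous_on UNIV Du"
  shows "(LBINT y:slice i j k \<Omega> s. (u (coords i j k (s, y)) - slice_mean i j k \<Omega> u s)^2)
    \<le> (diameter (plane_proj j k ` \<Omega>) / pi)^2 * (LBINT y:slice i j k \<Omega> s. (norm (Du (coords i j k (s, y))))^2)"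
proof -
  define K where "K = slice i j k \<Omega> s"
  define c where "c y = coords i j k (s, y)" for y
  have K: "open K" "convex K" "bounded K"
    unfolding K_def using open_slice convex_slice bounded_slice d \<Omega> by auto
  have u_cont: "continuous_on UNIV u"
    by (intro continuous_at_imp_continuous_on ballI has_derivative_continuous[OF u])
  have c_cont: "continuous_on UNIV c"
    unfolding c_def by (intro continuous_on_compose2[OF continuous_on_coords[of UNIV]] continuous_intros) auto
  have lin: "linear (coords i j k)" by (rule bounded_linear.linear[OF coords_linear])
  define \<mu> where "\<mu> = slice_mean i j k \<Omega> u s"
  define w where "w y = u (c y) - \<mu>" for y
  define Dw where "Dw y = (Du (c y) $ j, Du (c y) $ k)" for y
  have w_deriv: "(w has_derivative (\<lambda>h. Dw y \<bullet> h)) (at y)" for y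
  proof -
    have "((\<lambda>y. (s, y)) has_derivative (\<lambda>h. (0, h))) (at y)" by (auto intro!: derivative_eq_intros)
    from has_derivative_compose[OF this bounded_linear_imp_has_derivative[OF coords_linear]]
    have "(c has_derivative (\<lambda>h. coords i j k (0, h))) (at y)" by (simp add: c_def[abs_def])
    from has_derivative_compose[OF this u]
    have "((\<lambda>y. u (c y)) has_derivative (\<lambda>h. Du (c y) \<bullet> coords i j k (0, h))) (at y)" .
    then have "(w has_derivative (\<lambda>h. Du (c y) \<bullet> coords i j k (0, h) - 0)) (at y)"
      unfolding w_def by (intro has_derivative_diff has_derivative_const)
    moreover have "Du (c y) \<bullet> coords i j k (0, h) - 0 = Dw y \<bullet> h" for h
      by (cases h) (simp add: coords_def Dw_def inner_add_right inner_axis)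
    ultimately show ?thesis by simp
  qed
  have Dw_cont: "continuous_on UNIV Dw"
    unfolding Dw_def by (intro continuous_intros continuous_on_compose2[OF Du c_cont]) auto
  have Dw_le: "(norm (Dw y))^2 \<le> (norm (Du (c y)))^2" for y
  proof -
    have "(norm (Du (c y)))^2 = (\<Sum>m\<in>{i, j, k}. (Du (c y) $ m)^2)"
      unfolding power2_norm_eq_inner inner_vec_def UNIV_3_distinct[OF d] by (simp add: power2_eq_square)
    also have "\<dots> = (Du (c y) $ i)^2 + (norm (Dw y))^2"
      using d by (simp add: Dw_def norm_Pair)
    finally show ?thesis by simp
  qed
  have zero: "(LBINT y:K. w y) = 0"
  proof (cases "K = {}")
    case False
    define V where "V = (LBINT y:K. (1::real))"
    have V: "0 < V" unfolding V_def by (rule LINT_one_pos[OF K(1,3) False])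
    have "set_integrable lborel K (\<lambda>y. u (c y))" "set_integrable lborel K (\<lambda>y. \<mu> * 1)"
      using K by (auto intro!: set_integrable_bounded_continuous continuous_on_compose2[OF u_cont c_cont])
    then have "(LBINT y:K. u (c y) - \<mu> * 1) = (LBINT y:K. u (c y)) - (LBINT y:K. \<mu> * 1)"
      by (rule set_integral_diff)
    also have "(LBINT y:K. \<mu> * 1) = \<mu> * V" unfolding V_def by (rule set_integral_mult_right)
    also have "\<mu> * V = (LBINT y:K. u (c y))"
      using V by (simp add: \<mu>_def slice_mean_def K_def[symmetric] V_def[symmetric] c_def)
    finally show ?thesis by (simp add: w_def)
  qed (simp add: set_lebesgue_integral_def)
  have diam: "dist y z \<le> diameter (plane_proj j k ` \<Omega>)" if yz: "y \<in> K" "z \<in> K" for y z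
  proof -
    have proj: "plane_proj j k (c y) = coords i j k (0, y)" for y
      using coords_nth[OF d, of "(s, y)"] by (simp add: plane_proj_def c_def inner_axis coords_def)
    have "dist (plane_proj j k (c y)) (plane_proj j k (c z)) \<le> diameter (plane_proj j k ` \<Omega>)"
    proof (rule diameter_bounded_bound)
      have "bounded_linear (plane_proj j k)"
        unfolding linear_conv_bounded_linear[symmetric]
        by (intro linearI) (simp_all add: plane_proj_def inner_add_left algebra_simps)
      then show "bounded (plane_proj j k ` \<Omega>)" using \<Omega>(3) by (rule bounded_linear_image[rotated])
    qed (use yz in \<open>auto simp: K_def slice_def c_def\<close>)
    also have "dist (plane_proj j k (c y)) (plane_proj j k (c z)) = norm (coords i j k ((0, y) - (0, z)))"
      unfolding proj dist_norm linear_diff[OF lin] ..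
    also have "\<dots> = dist y z" unfolding norm_coords[OF d] by (simp add: dist_norm norm_Pair)
    finally show ?thesis .
  qed
  have "(LBINT y:K. (w y)^2) \<le> (diameter (plane_proj j k ` \<Omega>) / pi)^2 * (LBINT y:K. (norm (Dw y))^2)"
    by (rule payne_weinberger_plane[OF K diam w_deriv Dw_cont zero])
  also have "\<dots> \<le> (diameter (plane_proj j k ` \<Omega>) / pi)^2 * (LBINT y:K. (norm (Du (c y)))^2)"
  proof (rule mult_left_mono)
    have "(LBINT y:K. (norm (Dw y))^2) \<le> (LBINT y:K. (norm (Du (c y)))^2) + 0 * (LBINT y:K. 1)"
      using Dw_le by (intro LINT_scaled_bound K continuous_intros Dw_cont continuous_on_compose2[OF Du c_cont]) auto
    then show "(LBINT y:K. (norm (Dw y))^2) \<le> (LBINT y:K. (norm (Du (c y)))^2)" by simp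
  qed simp
  finally show ?thesis by (simp add: w_def \<mu>_def K_def c_def)
qed

lemma slab_poincare_bound:
  fixes \<Omega> :: "(real^3) set"
  assumes \<Omega>: "open \<Omega>" "convex \<Omega>" "bounded \<Omega>" "\<Omega> \<noteq> {}" and box: "\<Omega> \<subseteq> box 0 l" and d: "distinct [i, j, k]"
  shows "is_poincare_bound \<Omega> (H1 \<Omega> \<inter> slab_mean_free \<Omega> l i) (diameter (plane_proj j k ` \<Omega>) / pi)"
  unfolding is_poincare_bound_def
proof (intro conjI ballI)
  define C where "C = diameter (plane_proj j k ` \<Omega>) / pi"
  have "bounded_linear (plane_proj j k)"
    unfolding linear_conv_bounded_linear[symmetric]
    by (intro linearI) (simp_all add: plane_proj_def inner_add_left algebra_simps)
  then have "bounded (plane_proj j k ` \<Omega>)" using \<Omega>(3) by (rule bounded_linear_image[rotated])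
  then have C0: "0 \<le> C" by (simp add: C_def diameter_ge_0)
  then show "0 \<le> diameter (plane_proj j k ` \<Omega>) / pi" by (simp add: C_def)
  fix \<phi> assume \<phi>: "\<phi> \<in> H1 \<Omega> \<inter> slab_mean_free \<Omega> l i"
  then have L2: "\<phi> \<in> L2 \<Omega>" and H1: "\<phi> \<in> H1 \<Omega>"
    and slabs: "\<And>\<alpha> \<beta>. 0 \<le> \<alpha> \<Longrightarrow> \<alpha> < \<beta> \<Longrightarrow> \<beta> \<le> l $ i \<Longrightarrow> \<phi> \<in> L2_0 (slab \<Omega> i \<alpha> \<beta>)"
    by (auto simp: H1_def slab_mean_free_def)
  obtain \<Phi> G where \<Phi>: "\<Phi> \<in> borel_measurable borel" "integrable lborel (\<lambda>x. (\<Phi> x)^2)" "\<And>x. x \<notin> \<Omega> \<Longrightarrow> \<Phi> x = 0"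
    "AE x in lborel. x \<in> \<Omega> \<longrightarrow> \<phi> x = \<Phi> x"
    and G: "G \<in> borel_measurable borel" "integrable lborel (\<lambda>x. (norm (G x))^2)"
    and weak: "\<And>\<psi> b. \<psi> \<in> test_functions \<Omega> \<Longrightarrow> b \<in> Basis \<Longrightarrow>
      (LBINT x. \<Phi> x * frechet_derivative \<psi> (at x) b) = - (LBINT x. (G x \<bullet> b) * \<psi> x)"
    and norms: "norm_L2 \<Omega> \<phi> = sqrt (LBINT x. (\<Phi> x)^2)" "norm_L2 \<Omega> (weak_grad \<Omega> \<phi>) = sqrt (LBINT x. (norm (G x))^2)"
    by (rule H1_representative[OF \<Omega>(1) L2 has_weak_grad_weak_grad[OF H1]]) blast
  note [measurable] = \<Phi>(1)
  have [measurable]: "\<Omega> \<in> sets borel" using \<Omega>(1) by simp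
  have \<Phi>1: "integrable lborel \<Phi>" by (rule integrable_bounded_support_L2[OF \<Omega>(1,3) \<Phi>(1-3)])
  have ind: "indicator \<Omega> x *\<^sub>R \<Phi> x = \<Phi> x" for x by (cases "x \<in> \<Omega>") (simp_all add: \<Phi>(3))
  have on_\<Omega>: "set_integrable lborel \<Omega> (\<lambda>x. \<Phi> x * h x) \<longleftrightarrow> integrable lborel (\<lambda>x. \<Phi> x * h x)"
    "(LBINT x:\<Omega>. \<Phi> x * h x) = (LBINT x. \<Phi> x * h x)" for h
  proof -
    have "(\<lambda>x. indicator \<Omega> x *\<^sub>R (\<Phi> x * h x)) = (\<lambda>x. \<Phi> x * h x)"
      using \<Phi>(3) by (auto simp: fun_eq_iff indicator_def)
    then show "set_integrable lborel \<Omega> (\<lambda>x. \<Phi> x * h x) \<longleftrightarrow> integrable lborel (\<lambda>x. \<Phi> x * h x)"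
      "(LBINT x:\<Omega>. \<Phi> x * h x) = (LBINT x. \<Phi> x * h x)"
      by (simp_all only: set_integrable_def set_lebesgue_integral_def)
  qed
  \<comment> \<open>A weight that depends on \<open>x $ i\<close> alone sees \<open>\<Phi>\<close>
    only through \<open>A\<close>. Indicators of rays as weights show that \<open>A\<close> vanishes
    almost everywhere; with the slice mean as weight this gives the orthogonality.\<close>
  define A where "A s = (LBINT y:slice i j k \<Omega> s. \<Phi> (coords i j k (s, y)))" for s
  have nth_i: "coords i j k (s, y) $ i = s" for s y using coords_nth(1)[OF d] by simp
  have slice_int: "(LBINT x. \<Phi> x * h (x $ i)) = (LBINT s. A s * h s)"
    if "integrable lborel (\<lambda>x. \<Phi> x * h (x $ i))" for h
  proof -
    have "(LBINT x. \<Phi> x * h (x $ i)) = (LBINT s. (LBINT y:slice i j k \<Omega> s. \<Phi> (coords i j k (s, y)) * h s))"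
      using slice_fubini(2)[OF d \<Omega>(1), of "\<lambda>x. \<Phi> x * h (x $ i)"] that on_\<Omega>[of "\<lambda>x. h (x $ i)"] by (simp add: nth_i)
    then show ?thesis by (simp add: A_def)
  qed
  have A_zero: "AE s in lborel. A s = 0"
  proof (rule AE_zero_if_tail_integrals_zero)
    show "integrable lborel A"
      using slice_fubini(1)[OF d \<Omega>(1), of \<Phi>] \<Phi>1 on_\<Omega>(1)[of "\<lambda>x. 1"] by (simp add: A_def[abs_def])
    fix s :: real
    have int: "integrable lborel (\<lambda>x. \<Phi> x * indicator {s<..} (x $ i))"
      by (rule Bochner_Integration.integrable_bound[OF \<Phi>1]) (auto simp: indicator_def)
    have "(LBINT y:{s<..}. A y) = (LBINT y. A y * indicator {s<..} y)"
      by (simp add: set_lebesgue_integral_def mult.commute)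
    also have "\<dots> = (LBINT x. \<Phi> x * indicator {s<..} (x $ i))" by (rule slice_int[OF int, symmetric])
    also have "\<dots> = 0"
    proof (cases "s < l $ i")
      case False
      have "x $ i < l $ i" if "x \<in> \<Omega>" for x using that box by (auto simp: mem_box_cart)
      then have eq: "\<Phi> x * indicator {s<..} (x $ i) = 0" for x
        using False \<Phi>(3)[of x] by (cases "x \<in> \<Omega>") (force simp: indicator_def)+
      show ?thesis unfolding eq by simp
    next
      case True
      \<comment> \<open>Slabs have to start at a nonnegative height. As \<open>\<Omega>\<close> lies
        in the box, cutting the ray off at 0 and at \<open>l $ i\<close> removes nothing from
        it.\<close>
      define \<alpha> where "\<alpha> = max s 0"
      have in_box: "0 < x $ i" "x $ i < l $ i" if "x \<in> \<Omega>" for x using that box by (auto simp: mem_box_cart)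
      obtain x0 where "x0 \<in> \<Omega>" using \<Omega>(4) by blast
      then have \<alpha>: "0 \<le> \<alpha>" "\<alpha> < l $ i" using True in_box[of x0] by (auto simp: \<alpha>_def)
      define S where "S = slab \<Omega> i \<alpha> (l $ i)"
      have "open {x::real^3. \<alpha> < x $ i}" "open {x::real^3. x $ i < l $ i}"
        by (intro open_Collect_less continuous_intros)+
      moreover have "S = \<Omega> \<inter> {x. \<alpha> < x $ i} \<inter> {x. x $ i < l $ i}" by (auto simp: S_def slab_def)
      ultimately have S: "S \<in> sets borel" using \<Omega>(1) by (auto intro!: borel_open)
      have "\<phi> \<in> L2_0 S" unfolding S_def by (rule slabs[OF \<alpha> order_refl])
      then have S\<phi>: "\<phi> \<in> borel_measurable (lebesgue_on S)" "(LINT x|lebesgue_on S. \<phi> x) = 0"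
        by (auto simp: L2_0_def L2_def)
      have "indicator S x *\<^sub>R \<Phi> x = \<Phi> x * indicator {s<..} (x $ i)" for x
        using in_box[of x] \<Phi>(3)[of x] by (cases "x \<in> \<Omega>") (auto simp: S_def slab_def \<alpha>_def indicator_def)
      then have "(LBINT x. \<Phi> x * indicator {s<..} (x $ i)) = (LBINT x:S. \<Phi> x)"
        by (simp only: set_lebesgue_integral_def)
      also have "\<dots> = (LINT x|lebesgue_on S. \<phi> x)"
        using \<Phi>(4) by (intro LINT_lebesgue_on_eq(1)[OF S S\<phi>(1) \<Phi>(1), symmetric])
          (auto simp: S_def slab_def elim!: eventually_mono)
      finally show ?thesis using S\<phi>(2) by simp
    qed
    finally show "(LBINT y:{s<..}. A y) = 0" .
  qed
  have "sqrt (LBINT x. (\<Phi> x)^2) \<le> C * sqrt (LBINT x. (norm (G x))^2)"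
  proof (rule poincare_by_approximation[OF \<Omega> \<Phi>(1-3) G weak C0])
    fix u :: "real^3 \<Rightarrow> real" and Du assume u: "\<And>x. (u has_derivative (\<lambda>h. Du x \<bullet> h)) (at x)" "continuous_on UNIV Du"
    have u_cont: "continuous_on UNIV u"
      by (intro continuous_at_imp_continuous_on ballI has_derivative_continuous[OF u(1)])
    have "compact (u ` closure \<Omega>)"
      using \<Omega>(3) by (intro compact_continuous_image continuous_on_subset[OF u_cont]) auto
    then obtain B' where B': "\<forall>y\<in>u ` closure \<Omega>. norm y \<le> B'"
      by (auto dest!: compact_imp_bounded simp: bounded_iff)
    define B where "B = max B' 0"
    have B: "\<bar>u x\<bar> \<le> B" if "x \<in> \<Omega>" for x
      using B' that closure_subset[of \<Omega>] by (auto simp: B_def le_max_iff_disj)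
    have B0: "0 \<le> B" by (simp add: B_def)
    define \<mu> where "\<mu> = slice_mean i j k \<Omega> u"
    have \<mu>_le: "\<bar>\<mu> s\<bar> \<le> B" for s
      unfolding \<mu>_def by (rule slice_mean_bound[OF d \<Omega>(1,3) u_cont B B0])
    have [measurable]: "\<mu> \<in> borel_measurable borel" unfolding \<mu>_def by (rule slice_mean_measurable[OF d \<Omega>(1,3) u_cont])
    have [measurable]: "u \<in> borel_measurable borel" using u_cont by (rule borel_measurable_continuous_onI)
    have \<mu>i [measurable]: "(\<lambda>x. \<mu> (x $ i)) \<in> borel_measurable borel" by measurable
    have int1: "integrable lborel (\<lambda>x. \<Phi> x * \<mu> (x $ i))"
      by (rule Bochner_Integration.integrable_bound[of _ "\<lambda>x. \<Phi> x * B"])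
        (use \<Phi>1 \<mu>_le B0 in \<open>auto simp: abs_mult intro!: mult_left_mono\<close>)
    \<comment> \<open>\<open>\<mu>\<close> is constant on each slice, so its orthogonality to
      \<open>\<Phi>\<close> follows from the vanishing of the slice integrals.\<close>
    have "(LBINT x. \<Phi> x * \<mu> (x $ i)) = (LBINT s. A s * \<mu> s)" by (rule slice_int[OF int1])
    also have "\<dots> = 0"
      by (rule integral_eq_zero_AE) (use A_zero in \<open>auto elim!: eventually_mono\<close>)
    finally have zero: "(LBINT x. \<Phi> x * \<mu> (x $ i)) = 0" .
    have int2: "set_integrable lborel \<Omega> (\<lambda>x. (u x - \<mu> (x $ i))^2)"
      unfolding set_integrable_def
    proof (rule Bochner_Integration.integrable_bound)
      show "integrable lborel (\<lambda>x::real^3. indicator \<Omega> x * (2 * B)^2)"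
        using emeasure_bounded_finite[OF \<Omega>(3)] by (intro integrable_mult_left integrable_real_indicator) (auto simp: less_top)
      show "AE x in lborel. norm (indicator \<Omega> x *\<^sub>R (u x - \<mu> (x $ i))^2) \<le> norm (indicator \<Omega> x * (2 * B)^2)"
      proof (intro AE_I2)
        fix x
        show "norm (indicator \<Omega> x *\<^sub>R (u x - \<mu> (x $ i))^2) \<le> norm (indicator \<Omega> x * (2 * B)^2)"
        proof (cases "x \<in> \<Omega>")
          case True
          have "\<bar>u x - \<mu> (x $ i)\<bar> \<le> \<bar>2 * B\<bar>" using B[OF True] \<mu>_le[of "x $ i"] by linarith
          then have "(u x - \<mu> (x $ i))^2 \<le> (2 * B)^2" by (simp only: abs_le_square_iff)
          then show ?thesis using True by simp
        qed simp
      qed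
    qed measurable
    have int3: "set_integrable lborel \<Omega> (\<lambda>x. (norm (Du x))^2)"
      using \<Omega> by (intro set_integrable_bounded_continuous continuous_intros u(2)) auto
    have "(LBINT x:\<Omega>. (u x - \<mu> (x $ i))^2)
      = (LBINT s. (LBINT y:slice i j k \<Omega> s. (u (coords i j k (s, y)) - \<mu> s)^2))"
      using slice_fubini(2)[OF d \<Omega>(1) int2] by (simp add: nth_i)
    also have "\<dots> \<le> (LBINT s. C^2 * (LBINT y:slice i j k \<Omega> s. (norm (Du (coords i j k (s, y))))^2))"
    proof (rule integral_mono)
      show "integrable lborel (\<lambda>s. LBINT y:slice i j k \<Omega> s. (u (coords i j k (s, y)) - \<mu> s)^2)"
        using slice_fubini(1)[OF d \<Omega>(1) int2] by (simp add: nth_i)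
      show "integrable lborel (\<lambda>s. C^2 * (LBINT y:slice i j k \<Omega> s. (norm (Du (coords i j k (s, y))))^2))"
        by (intro integrable_mult_right slice_fubini(1)[OF d \<Omega>(1) int3])
      show "(LBINT y:slice i j k \<Omega> s. (u (coords i j k (s, y)) - \<mu> s)^2)
        \<le> C^2 * (LBINT y:slice i j k \<Omega> s. (norm (Du (coords i j k (s, y))))^2)" for s
        unfolding \<mu>_def C_def by (rule slice_variance_le[OF d \<Omega>(1-3) u])
    qed
    also have "\<dots> = C^2 * (LBINT x:\<Omega>. (norm (Du x))^2)"
      using slice_fubini(2)[OF d \<Omega>(1) int3] by simp
    finally show "\<exists>m. m \<in> borel_measurable borel \<and> integrable lborel (\<lambda>x. \<Phi> x * m x) \<and> (LBINT x. \<Phi> x * m x) = 0 \<and>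
        set_integrable lborel \<Omega> (\<lambda>x. (u x - m x)^2) \<and>
        (LBINT x:\<Omega>. (u x - m x)^2) \<le> C^2 * (LBINT x:\<Omega>. (norm (Du x))^2)"
      using \<mu>i int1 zero int2 by (intro exI[of _ "\<lambda>x. \<mu> (x $ i)"]) simp
  qed
  then show "norm_L2 \<Omega> \<phi> \<le> diameter (plane_proj j k ` \<Omega>) / pi * norm_L2 \<Omega> (weak_grad \<Omega> \<phi>)"
    by (simp only: norms C_def)
qed

theorem lemma7:
  fixes \<Omega> :: "(real^3) set" and l :: "real^3" and i j k :: 3
    and \<phi> :: "real^3 \<Rightarrow> real"
  assumes "\<Omega> \<noteq> {}" and "open \<Omega>" and "convex \<Omega>" and "bounded \<Omega>"
    and "\<forall>m. 0 < l $ m"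
    and "\<Omega> \<subseteq> box 0 l"
    and "\<forall>a b. \<Omega> \<subseteq> box a b \<longrightarrow> box 0 l \<subseteq> box a b"
    and "distinct [i, j, k]"
    and "\<phi> \<in> H1 \<Omega>"
    and "\<forall>\<alpha> \<beta>. 0 \<le> \<alpha> \<and> \<alpha> < \<beta> \<and> \<beta> \<le> l $ i \<longrightarrow> \<phi> \<in> L2_0 (slab \<Omega> i \<alpha> \<beta>)"
  shows "norm_L2 \<Omega> \<phi> \<le> slab_poincare_const \<Omega> l i * norm_L2 \<Omega> (weak_grad \<Omega> \<phi>)
    \<and> slab_poincare_const \<Omega> l i \<le> poincare_const \<Omega>
    \<and> slab_poincare_const \<Omega> l i \<le> diameter (plane_proj j k ` \<Omega>) / pi"
proof (intro conjI)
  note slab_bound = slab_poincare_bound[OF assms(2-4,1,6,8)]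
  show "slab_poincare_const \<Omega> l i \<le> diameter (plane_proj j k ` \<Omega>) / pi"
    unfolding slab_poincare_const_def by (rule best_poincare_bound_least(2)[OF slab_bound])
  have "\<phi> \<in> H1 \<Omega> \<inter> slab_mean_free \<Omega> l i" using assms(9,10) by (simp add: slab_mean_free_def)
  then show "norm_L2 \<Omega> \<phi> \<le> slab_poincare_const \<Omega> l i * norm_L2 \<Omega> (weak_grad \<Omega> \<phi>)"
    using best_poincare_bound_least(1)[OF slab_bound] unfolding slab_poincare_const_def is_poincare_bound_def by blast
  obtain c where "is_poincare_bound \<Omega> (H1 \<Omega> \<inter> L2_0 \<Omega>) c"
    using poincare_bound_exists[OF assms(2-4,1)] by blast
  then have "is_poincare_bound \<Omega> (H1 \<Omega> \<inter> L2_0 \<Omega>) (poincare_const \<Omega>)"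
    unfolding poincare_const_def by (rule best_poincare_bound_least(1))
  \<comment> \<open>The slab from 0 to \<open>l $ i\<close> is all of \<open>\<Omega>\<close>, and a
    smaller class of functions admits every bound of the larger one.\<close>
  moreover have "slab_mean_free \<Omega> l i \<subseteq> L2_0 \<Omega>"
  proof
    fix \<psi> assume "\<psi> \<in> slab_mean_free \<Omega> l i"
    then have "\<psi> \<in> L2_0 (slab \<Omega> i 0 (l $ i))" using assms(5) by (simp add: slab_mean_free_def)
    moreover have "slab \<Omega> i 0 (l $ i) = \<Omega>" using assms(6) by (auto simp: slab_def mem_box_cart)
    ultimately show "\<psi> \<in> L2_0 \<Omega>" by simp
  qed
  ultimately have "is_poincare_bound \<Omega> (H1 \<Omega> \<inter> slab_mean_free \<Omega> l i) (poincare_const \<Omega>)"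
    unfolding is_poincare_bound_def by blast
  then show "slab_poincare_const \<Omega> l i \<le> poincare_const \<Omega>"
    unfolding slab_poincare_const_def by (rule best_poincare_bound_least(2))
qed

end
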